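(* Let $f:(\mathbb{R}^2,0)\to(\mathbb{R},0)$ be a smooth function germ with an $A_1^+$-singularity at the origin such that the origin is not an umbilic point of $f$. Then, generically, any 1-parameter $\mathcal{R}_e$-versal deformation of $f$ is FRS-equivalent to $F:(\mathbb{R}^3,0)\to(\mathbb{R},0)$, $F(x,y,t)=f(x,y)+t$. The geometric configuration of $F_t=0$ is the following: for one sign of the parameter $t$ the curve $F_t=0$ has exactly four vertices and no inflections, and for the other sign of $t$ the curve is empty.
   Context: $f$ has an $A_1^+$-singularity at $0$ if $df(0)=0$ and its quadratic part is a definite quadratic form. The origin is an umbilic point of $f$ if the origin of $\mathbb{R}^3$ is an umbilic point of the surface $z=f(x,y)$, i.e. (when $df(0)=0$) $f_{xx}(0)=f_{yy}(0)$ and $f_{xy}(0)=0$. For a smooth germ $g$, $C_g=\{g=0\}$. At a regular point of $C_g$ let $\kappa$ be the curvature of the curve and $'$ the derivative along it. The point is an inflection if $\kappa=0$ and a vertex if $\kappa'=0$. An $m$-parameter deformation of $f$ is a smooth germ $F:(\mathbb{R}^2\times\mathbb{R}^m,0)\to(\mathbb{R},0)$ with $F(x,y,0)=f(x,y)$; write $F_s(x,y)=F(x,y,s)$. It is $\mathcal{R}_e$-versal if $\partial F/\partial s_1|_{s=0},\dots,\partial F/\partial s_m|_{s=0}$ together with the ideal $\langle f_x,f_y\rangle$ span the ring of smooth function germs at $0$ over $\mathbb{R}$. "Generically" means: for all deformations belonging to some open and dense subset (Whitney topology) of the set of deformations of $f$ with the given number of parameters. FRS-equivalence: let $F_s,\tilde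 F_u$ be $m$-parameter deformations of $f$. Suppose there are stratification germs $(S_1,0)$ and $(S_2,0)$ of $\mathbb{R}^m$ such that, for any two parameters in the same stratum (of $S_1$ for $F$, of $S_2$ for $\tilde F$), the corresponding curves (i) are diffeomorphic; (ii) have the same numbers of inflections and vertices; (iii) have the same relative position of their singularities, self-intersection points, inflections and vertices. $F$ and $\tilde F$ are FRS-equivalent if, for such stratifications, there is a stratified homeomorphism germ $k:(\mathbb{R}^m,(S_1,0))\to(\mathbb{R}^m,(S_2,0))$ such that all pairs of curves $F_s=0$ and $\tilde F_{k(s)}=0$ satisfy (i), (ii), (iii). All curves are considered in a small neighbourhood of the origin and for small parameters. *)

theory Defs
  imports "HOL-Analysis.Analysis" "HOL-Library.Equipollence" "HOL-Library.Disjoint_Sets"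
begin

text \<open>
  The plane is \<^typ>\<open>real \<times> real\<close> with its Euclidean norm, and \<^typ>\<open>'s\<close> (a Euclidean space) is the
  parameter space.  Germs at the origin are given by total functions of which only the values
  near \<open>0\<close> matter.
\<close>

section \<open>Smooth functions and germs\<close>

definition dirderiv :: "'a::euclidean_space \<Rightarrow> ('a \<Rightarrow> 'b::real_normed_vector) \<Rightarrow> 'a \<Rightarrow> 'b" where
  "dirderiv v f x = frechet_derivative f (at x) v"

text \<open>\<open>Ck_on\<close> and \<open>smooth_on\<close> are meant for open sets \<open>U\<close>.\<close>

primrec Ck_on :: "nat \<Rightarrow> 'a::euclidean_space set \<Rightarrow> ('a \<Rightarrow> 'b::real_normed_vector) \<Rightarrow> bool" where
  "Ck_on 0 U f \<longleftrightarrow> continuous_on U f"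
| "Ck_on (Suc k) U f \<longleftrightarrow> (\<forall>x\<in>U. f differentiable (at x)) \<and> (\<forall>v. Ck_on k U (dirderiv v f))"

definition smooth_on :: "'a::euclidean_space set \<Rightarrow> ('a \<Rightarrow> 'b::real_normed_vector) \<Rightarrow> bool" where
  "smooth_on U f \<longleftrightarrow> (\<forall>k. Ck_on k U f)"

definition smooth_germ :: "('a::euclidean_space \<Rightarrow> 'b::real_normed_vector) \<Rightarrow> bool" where
  "smooth_germ f \<longleftrightarrow> (\<exists>U. open U \<and> 0 \<in> U \<and> smooth_on U f)"

definition germ_eq :: "('a::euclidean_space \<Rightarrow> 'b) \<Rightarrow> ('a \<Rightarrow> 'b) \<Rightarrow> bool" where
  "germ_eq f g \<longleftrightarrow> (\<forall>\<^sub>F z in nhds 0. f z = g z)"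

text \<open>Smoothness on an arbitrary subset means that local smooth extensions exist.\<close>

definition smooth_on_subset ::
    "'a::euclidean_space set \<Rightarrow> ('a \<Rightarrow> 'b::real_normed_vector) \<Rightarrow> bool" where
  "smooth_on_subset X \<phi> \<longleftrightarrow>
     (\<forall>p\<in>X. \<exists>U h. open U \<and> p \<in> U \<and> smooth_on U h \<and> (\<forall>q\<in>U \<inter> X. h q = \<phi> q))"

definition diffeomorphism_on ::
    "'a::euclidean_space set \<Rightarrow> 'b::euclidean_space set \<Rightarrow> ('a \<Rightarrow> 'b) \<Rightarrow> ('b \<Rightarrow> 'a) \<Rightarrow> bool" where
  "diffeomorphism_on X Y \<phi> \<psi> \<longleftrightarrow>
     smooth_on_subset X \<phi> \<and> smooth_on_subset Y \<psi> \<and> \<phi> ` X = Y \<and> \<psi> ` Y = X \<and>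
     (\<forall>x\<in>X. \<psi> (\<phi> x) = x) \<and> (\<forall>y\<in>Y. \<phi> (\<psi> y) = y)"

definition diffeomorphic_sets ::
    "'a::euclidean_space set \<Rightarrow> 'b::euclidean_space set \<Rightarrow> bool" where
  "diffeomorphic_sets X Y \<longleftrightarrow> (\<exists>\<phi> \<psi>. diffeomorphism_on X Y \<phi> \<psi>)"

section \<open>Functions on the plane\<close>

abbreviation ddx :: "(real \<times> real \<Rightarrow> real) \<Rightarrow> real \<times> real \<Rightarrow> real" where
  "ddx \<equiv> dirderiv (1, 0)"

abbreviation ddy :: "(real \<times> real \<Rightarrow> real) \<Rightarrow> real \<times> real \<Rightarrow> real" where
  "ddy \<equiv> dirderiv (0, 1)"

definition quadratic_part :: "(real \<times> real \<Rightarrow> real) \<Rightarrow> real \<times> real \<Rightarrow> real" where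
  "quadratic_part f = (\<lambda>(u, v).
     (ddx (ddx f) 0 * u\<^sup>2 + 2 * ddx (ddy f) 0 * u * v + ddy (ddy f) 0 * v\<^sup>2) / 2)"

definition A1_plus :: "(real \<times> real \<Rightarrow> real) \<Rightarrow> bool" where
  "A1_plus f \<longleftrightarrow> (f has_derivative (\<lambda>_. 0)) (at 0) \<and>
     ((\<forall>w. w \<noteq> 0 \<longrightarrow> quadratic_part f w > 0) \<or> (\<forall>w. w \<noteq> 0 \<longrightarrow> quadratic_part f w < 0))"

text \<open>
  The point of the graph \<open>z = f(x,y)\<close> over the origin is umbilic if there the second fundamental
  form is a multiple of the first.  The usual factor \<open>1 / sqrt (1 + f\<^sub>x\<^sup>2 + f\<^sub>y\<^sup>2)\<close> of the second
  fundamental form is absorbed in \<open>c\<close>.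
\<close>

definition umbilic_at_origin :: "(real \<times> real \<Rightarrow> real) \<Rightarrow> bool" where
  "umbilic_at_origin f \<longleftrightarrow> (\<exists>c.
     ddx (ddx f) 0 = c * (1 + (ddx f 0)\<^sup>2) \<and>
     ddx (ddy f) 0 = c * (ddx f 0 * ddy f 0) \<and>
     ddy (ddy f) 0 = c * (1 + (ddy f 0)\<^sup>2))"

lemma umbilic_at_origin_critical:
  assumes "(f has_derivative (\<lambda>_. 0)) (at 0)"
  shows "umbilic_at_origin f \<longleftrightarrow> ddx (ddx f) 0 = ddy (ddy f) 0 \<and> ddx (ddy f) 0 = 0"
proof -
  have "frechet_derivative f (at 0) = (\<lambda>_. 0)"
    using frechet_derivative_at[OF assms] by simp
  then have "dirderiv v f 0 = 0" for v
    by (simp add: dirderiv_def)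
  then show ?thesis
    unfolding umbilic_at_origin_def by auto
qed

section \<open>Geometry of the curve \<open>g = 0\<close> in a ball around the origin\<close>

definition curve :: "real \<Rightarrow> (real \<times> real \<Rightarrow> real) \<Rightarrow> (real \<times> real) set" where
  "curve r g = {p \<in> ball 0 r. g p = 0}"

definition singular_points :: "real \<Rightarrow> (real \<times> real \<Rightarrow> real) \<Rightarrow> (real \<times> real) set" where
  "singular_points r g = {p \<in> curve r g. (g has_derivative (\<lambda>_. 0)) (at p)}"

definition regular_points :: "real \<Rightarrow> (real \<times> real \<Rightarrow> real) \<Rightarrow> (real \<times> real) set" where
  "regular_points r g = curve r g - singular_points r g"

definition local_param ::
    "(real \<times> real \<Rightarrow> real) \<Rightarrow> real \<times> real \<Rightarrow> (real \<Rightarrow> real \<times> real) \<Rightarrow> bool" where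
  "local_param g p \<gamma> \<longleftrightarrow> \<gamma> 0 = p \<and> (\<exists>e>0. smooth_on {-e<..<e} \<gamma> \<and>
     (\<forall>t\<in>{-e<..<e}. g (\<gamma> t) = 0 \<and> vector_derivative \<gamma> (at t) \<noteq> 0))"

definition curvature :: "(real \<Rightarrow> real \<times> real) \<Rightarrow> real \<Rightarrow> real" where
  "curvature \<gamma> t =
     (let v = vector_derivative \<gamma> (at t);
          a = vector_derivative (\<lambda>u. vector_derivative \<gamma> (at u)) (at t)
      in (fst v * snd a - snd v * fst a) / norm v ^ 3)"

text \<open>
  At a regular point two local parametrisations differ by a local reparametrisation.  The
  curvature changes at most by its sign under it, and the vanishing of its derivative does not
  depend on the parameter, so any parametrisation may be used below.
\<close>

definition inflections :: "real \<Rightarrow> (real \<times> real \<Rightarrow> real) \<Rightarrow> (real \<times> real) set" where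
  "inflections r g = {p \<in> regular_points r g. \<exists>\<gamma>. local_param g p \<gamma> \<and> curvature \<gamma> 0 = 0}"

definition vertices :: "real \<Rightarrow> (real \<times> real \<Rightarrow> real) \<Rightarrow> (real \<times> real) set" where
  "vertices r g = {p \<in> regular_points r g.
     \<exists>\<gamma>. local_param g p \<gamma> \<and> (curvature \<gamma> has_real_derivative 0) (at 0)}"

text \<open>
  A self-intersection point is one where two arcs of the curve cross or touch.  The arcs need not
  be smooth, so that singular branches are included; a cusp is not a self-intersection.
\<close>

definition self_intersections :: "(real \<times> real) set \<Rightarrow> (real \<times> real) set" where
  "self_intersections C = {p. \<exists>\<alpha> \<beta> :: real \<Rightarrow> real \<times> real.
     (\<forall>\<gamma>\<in>{\<alpha>, \<beta>}. continuous_on {-1..1} \<gamma> \<and> inj_on \<gamma> {-1..1} \<and> \<gamma> ` {-1..1} \<subseteq> C \<and> \<gamma> 0 = p) \<and>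
     \<alpha> ` {-1..1} \<inter> \<beta> ` {-1..1} = {p}}"

text \<open>
  The four parts: the curves are diffeomorphic; they have equally many inflections; equally many
  vertices; and the same relative position of the special points, i.e. some homeomorphism of the
  ball takes one curve with its special points to the other.
\<close>

definition same_configuration ::
    "real \<Rightarrow> (real \<times> real \<Rightarrow> real) \<Rightarrow> (real \<times> real \<Rightarrow> real) \<Rightarrow> bool" where
  "same_configuration r g h \<longleftrightarrow>
     diffeomorphic_sets (curve r g) (curve r h) \<and>
     inflections r g \<approx> inflections r h \<and>
     vertices r g \<approx> vertices r h \<and>
     (\<exists>\<theta> \<theta>'. homeomorphism (ball 0 r) (ball 0 r) \<theta> \<theta>' \<and>
        \<theta> ` curve r g = curve r h \<and>
        \<theta> ` singular_points r g = singular_points r h \<and>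
        \<theta> ` self_intersections (curve r g) = self_intersections (curve r h) \<and>
        \<theta> ` inflections r g = inflections r h \<and>
        \<theta> ` vertices r g = vertices r h)"

section \<open>Deformations\<close>

definition deformation ::
    "(real \<times> real \<Rightarrow> real) \<Rightarrow> ((real \<times> real) \<times> 's::euclidean_space \<Rightarrow> real) \<Rightarrow> bool" where
  "deformation f F \<longleftrightarrow> smooth_germ F \<and> F 0 = 0 \<and> (\<forall>\<^sub>F p in nhds 0. F (p, 0) = f p)"

definition slice ::
    "((real \<times> real) \<times> 's \<Rightarrow> real) \<Rightarrow> 's \<Rightarrow> real \<times> real \<Rightarrow> real" where
  "slice F s = (\<lambda>p. F (p, s))"

definition Re_versal ::
    "(real \<times> real \<Rightarrow> real) \<Rightarrow> ((real \<times> real) \<times> 's::euclidean_space \<Rightarrow> real) \<Rightarrow> bool" where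
  "Re_versal f F \<longleftrightarrow> (\<forall>g :: real \<times> real \<Rightarrow> real. smooth_germ g \<longrightarrow>
     (\<exists>(a :: real \<times> real \<Rightarrow> real) (b :: real \<times> real \<Rightarrow> real) (c :: 's \<Rightarrow> real).
        smooth_germ a \<and> smooth_germ b \<and>
        (\<forall>\<^sub>F p in nhds 0. g p = a p * ddx f p + b p * ddy f p +
           (\<Sum>i\<in>Basis. c i * dirderiv (0, i) F (p, 0)))))"

subsection \<open>Genericity\<close>

definition whitney_nbhd ::
    "('a::euclidean_space \<Rightarrow> real) \<Rightarrow> nat \<Rightarrow> ('a \<Rightarrow> real) \<Rightarrow> ('a \<Rightarrow> real) set" where
  "whitney_nbhd F k \<delta> = {G. smooth_on UNIV G \<and>
     (\<forall>z. \<forall>vs\<in>lists Basis. length vs \<le> k \<longrightarrow>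
        \<bar>foldr dirderiv vs G z - foldr dirderiv vs F z\<bar> < \<delta> z)}"

text \<open>The Whitney (strong) \<open>C\<^sup>\<infinity>\<close> topology on the smooth functions on the whole space.\<close>

definition whitney_topology :: "('a::euclidean_space \<Rightarrow> real) topology" where
  "whitney_topology = topology_generated_by
     {whitney_nbhd F k \<delta> | F k \<delta>. smooth_on UNIV F \<and> continuous_on UNIV \<delta> \<and> (\<forall>z. \<delta> z > 0)}"

text \<open>Every deformation germ has a representative which is smooth on the whole space.\<close>

definition deformation_space ::
    "(real \<times> real \<Rightarrow> real) \<Rightarrow> ((real \<times> real) \<times> 's::euclidean_space \<Rightarrow> real) topology" where
  "deformation_space f = subtopology whitney_topology {F. deformation f F}"

text \<open>
  \<open>D\<close> is invariant under \<^const>\<open>germ_eq\<close>, so it is a set of germs; openness and density are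
  those of the quotient topology on germs.
\<close>

definition generically ::
    "(real \<times> real \<Rightarrow> real) \<Rightarrow> (((real \<times> real) \<times> 's::euclidean_space \<Rightarrow> real) \<Rightarrow> bool) \<Rightarrow> bool" where
  "generically f P \<longleftrightarrow> (\<exists>D.
     openin (deformation_space f) D \<and>
     deformation_space f closure_of D = topspace (deformation_space f) \<and>
     (\<forall>G\<in>D. \<forall>H\<in>topspace (deformation_space f). germ_eq G H \<longrightarrow> H \<in> D) \<and>
     (\<forall>F. deformation f F \<and> (\<exists>G\<in>D. germ_eq F G) \<longrightarrow> P F))"

subsection \<open>Stratifications of the parameter space and FRS-equivalence\<close>

definition smooth_submanifold :: "'a::euclidean_space set \<Rightarrow> bool" where
  "smooth_submanifold X \<longleftrightarrow> (\<exists>d. \<forall>p\<in>X. \<exists>W V \<phi> \<psi> (L :: 'a set).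
     open W \<and> p \<in> W \<and> open V \<and> diffeomorphism_on W V \<phi> \<psi> \<and>
     subspace L \<and> dim L = d \<and> \<phi> ` (W \<inter> X) = V \<inter> L)"

text \<open>
  A representative, on the neighbourhood \<open>U\<close> of the origin, of a stratification germ: a locally
  finite partition into connected submanifolds satisfying the frontier condition.
\<close>

definition stratification :: "'s::euclidean_space set \<Rightarrow> 's set set \<Rightarrow> bool" where
  "stratification U S \<longleftrightarrow> open U \<and> 0 \<in> U \<and> partition_on U S \<and>
     (\<forall>p\<in>U. \<exists>V. open V \<and> p \<in> V \<and> finite {X \<in> S. X \<inter> V \<noteq> {}}) \<and>
     (\<forall>X\<in>S. connected X \<and> smooth_submanifold X) \<and>
     (\<forall>X\<in>S. \<forall>Y\<in>S. X \<inter> closure Y \<noteq> {} \<longrightarrow> X \<subseteq> closure Y)"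

text \<open>\<open>k\<close> is a homeomorphism germ at \<open>0\<close>, defined on \<open>V\<^sub>1\<close>, taking strata to strata.\<close>

definition stratified_homeo ::
    "'s::euclidean_space set \<Rightarrow> 's set set \<Rightarrow> 's set \<Rightarrow> 's set set \<Rightarrow> 's set \<Rightarrow> ('s \<Rightarrow> 's) \<Rightarrow> bool" where
  "stratified_homeo U\<^sub>1 S\<^sub>1 U\<^sub>2 S\<^sub>2 V\<^sub>1 k \<longleftrightarrow> open V\<^sub>1 \<and> 0 \<in> V\<^sub>1 \<and> V\<^sub>1 \<subseteq> U\<^sub>1 \<and> k 0 = 0 \<and>
     (\<exists>V\<^sub>2 k'. open V\<^sub>2 \<and> V\<^sub>2 \<subseteq> U\<^sub>2 \<and> homeomorphism V\<^sub>1 V\<^sub>2 k k' \<and>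
        {k ` (X \<inter> V\<^sub>1) | X. X \<in> S\<^sub>1 \<and> X \<inter> V\<^sub>1 \<noteq> {}} = {Y \<inter> V\<^sub>2 | Y. Y \<in> S\<^sub>2 \<and> Y \<inter> V\<^sub>2 \<noteq> {}})"

text \<open>
  Curves in a small neighbourhood of the origin and for small parameters: the radius \<open>r\<close> is small,
  and the parameters are small with respect to \<open>r\<close>.  The stratifications and \<open>k\<close> do not depend
  on \<open>r\<close>.
\<close>

definition FRS_equivalent ::
    "(real \<times> real \<Rightarrow> real) \<Rightarrow> ((real \<times> real) \<times> 's::euclidean_space \<Rightarrow> real) \<Rightarrow>
     ((real \<times> real) \<times> 's \<Rightarrow> real) \<Rightarrow> bool" where
  "FRS_equivalent f F F' \<longleftrightarrow> deformation f F \<and> deformation f F' \<and>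
     (\<exists>U\<^sub>1 S\<^sub>1 U\<^sub>2 S\<^sub>2 V\<^sub>1 k.
        stratification U\<^sub>1 S\<^sub>1 \<and> stratification U\<^sub>2 S\<^sub>2 \<and> stratified_homeo U\<^sub>1 S\<^sub>1 U\<^sub>2 S\<^sub>2 V\<^sub>1 k \<and>
        (\<exists>r\<^sub>0>0. \<forall>r. 0 < r \<and> r < r\<^sub>0 \<longrightarrow> (\<exists>\<delta>>0.
           (\<forall>X\<in>S\<^sub>1. \<forall>s\<in>X \<inter> ball 0 \<delta>. \<forall>s'\<in>X \<inter> ball 0 \<delta>.
              same_configuration r (slice F s) (slice F s')) \<and>
           (\<forall>Y\<in>S\<^sub>2. \<forall>u\<in>Y \<inter> ball 0 \<delta>. \<forall>u'\<in>Y \<inter> ball 0 \<delta>.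
              same_configuration r (slice F' u) (slice F' u')) \<and>
           (\<forall>s\<in>V\<^sub>1 \<inter> ball 0 \<delta>.
              same_configuration r (slice F s) (slice F' (k s))))))"

end

theory Submission
  imports Defs "HOL-Library.Landau_Symbols"
begin

text \<open>
  Versality, tested on the constant function \<open>1\<close>, forces \<open>\<partial>F/\<partial>s \<noteq> 0\<close> at the origin.  Conversely the
  argument works for every deformation with this property, so the generic set can be taken to be the
  whole space.  By the implicit function theorem \<open>F(p, s) = 0\<close> means \<open>s = S(p)\<close> near the origin, where \<open>S\<close>
  has a nondegenerate extremum at the origin, a minimum after changing the sign of \<open>s\<close> if necessary.  So
  all curves of the family are level sets of one function of two variables.  Since the origin is not
  umbilic, the eigenvalues \<open>a\<close>, \<open>b\<close> of the Hessian of \<open>S\<close> are distinct.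

  In eigencoordinates \<open>x\<close>, \<open>y\<close> the numerator of the curvature of the level sets has the leading term
  \<open>a b (a x^2 + b y^2)\<close>, which does not vanish.  The numerator of the derivative of the curvature has
  the leading term \<open>3 a^2 b^2 (a - b) (a x^2 + b y^2) x y\<close>, and its derivative along the level set the
  leading term \<open>3 a^2 b^2 (a - b) (a x^2 + b y^2) (a x^2 - b y^2)\<close>.  Hence there is exactly one vertex
  in a narrow sector around each of the four half axes, and none elsewhere.

  Each level set \<open>S = s\<close> with \<open>s > 0\<close> meets every ray from the origin exactly once, so a homeomorphism from the plane to the ball
  takes the unit circle to the curve and the four points \<open>(\<plusminus>1, 0)\<close>, \<open>(0, \<plusminus>1)\<close> to its vertices.  Composing two
  of these homeomorphisms identifies any two such curves together with their vertices.
\<close>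

section \<open>Calculus of smooth functions\<close>

text \<open>\<open>vert_fun\<close> contains third derivatives of \<open>S\<close>, and its
  tangential derivative fourth ones, yet the leading terms see only the Hessian: every tangential
  derivative carries a factor from the gradient, which vanishes at the origin. Differentiation along
  the level sets therefore preserves the order of vanishing, and higher derivatives of
  \<open>S\<close> go into the error. The asymptotic estimates are uniform in the direction, so all
  sign conditions hold on one punctured disc, fixed before the level is chosen. No rescaling of the
  level sets is needed; only the bound on the parameter depends on the radius \<open>r\<close>. The
  vertices lie near the half axes but not on them, and this shapes the comparison of two curves.
  Central projection is a diffeomorphism between them but moves the vertices. The homeomorphism of
  the ball therefore contains a piecewise linear tilt of the half axes, which is bijective because
  the sectors are narrow.\<close>

lemma dirderiv_eq:
  assumes "(f has_derivative f') (at x)"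
  shows "dirderiv v f x = f' v"
  using frechet_derivative_at[OF assms] by (simp add: dirderiv_def)

lemma has_derivative_dirderiv:
  "f differentiable (at x) \<Longrightarrow> (f has_derivative (\<lambda>v. dirderiv v f x)) (at x)"
  by (simp add: dirderiv_def frechet_derivative_works)

lemma Ck_on_Suc_has_derivative:
  "Ck_on (Suc k) U f \<Longrightarrow> x \<in> U \<Longrightarrow> (f has_derivative (\<lambda>v. dirderiv v f x)) (at x)"
  by (simp add: has_derivative_dirderiv)

section \<open>Closure properties of the classes C^k\<close>

lemma Ck_on_cong:
  assumes "open U" "\<And>x. x \<in> U \<Longrightarrow> f x = g x" "Ck_on k U f"
  shows "Ck_on k U g"
  using assms(2,3)
proof (induction k arbitrary: f g)
  case 0
  then show ?case by (simp cong: continuous_on_cong)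
next
  case (Suc k)
  have d: "(g has_derivative (\<lambda>v. dirderiv v f x)) (at x)" if "x \<in> U" for x
    using has_derivative_transform_within_open[OF Ck_on_Suc_has_derivative[OF Suc.prems(2) that]
        assms(1) that Suc.prems(1)] by simp
  have e: "dirderiv v f x = dirderiv v g x" if "x \<in> U" for v x
    using dirderiv_eq[OF d[OF that]] by metis
  have "Ck_on k U (dirderiv v g)" for v
    using Suc.IH[OF e] Suc.prems(2) by simp
  then show ?case using d by (auto simp: differentiable_def)
qed

text \<open>The derivative \<open>f'\<close> is known only on \<open>U\<close>, whereas
  \<open>dirderiv v f\<close> is a total function; the two are exchanged by
  \<open>Ck_on_cong\<close>, which is where openness of \<open>U\<close> enters.\<close>

lemma Ck_on_SucI:
  assumes U: "open U" and d: "\<And>x. x \<in> U \<Longrightarrow> (f has_derivative f' x) (at x)"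
    and "\<And>v. Ck_on k U (\<lambda>x. f' x v)"
  shows "Ck_on (Suc k) U f"
proof -
  have "f' x v = dirderiv v f x" if "x \<in> U" for v x
    using dirderiv_eq[OF d[OF that]] by metis
  then have "Ck_on k U (dirderiv v f)" for v
    using Ck_on_cong[OF U _ assms(3)[of v]] by simp
  then show ?thesis using d by (auto simp: differentiable_def)
qed

lemma Ck_on_subset: "Ck_on k U f \<Longrightarrow> V \<subseteq> U \<Longrightarrow> Ck_on k V f"
  by (induction k arbitrary: f) (auto intro: continuous_on_subset)

lemma Ck_on_SucD: "Ck_on (Suc k) U f \<Longrightarrow> Ck_on k U f"
proof (induction k arbitrary: f)
  case 0
  then have "continuous_on U f"
    by (intro differentiable_imp_continuous_on) (simp add: differentiable_on_def differentiable_at_withinI)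
  then show ?case by simp
qed auto

lemma Ck_on_bounded_linear:
  assumes L: "bounded_linear L" and U: "open U"
  shows "Ck_on k U f \<Longrightarrow> Ck_on k U (\<lambda>x. L (f x))"
proof (induction k arbitrary: f)
  case 0
  then show ?case using L by (auto intro: bounded_linear.continuous_on)
next
  case (Suc k)
  then show ?case
    by (intro Ck_on_SucI[OF U bounded_linear.has_derivative[OF L Ck_on_Suc_has_derivative]] Suc.IH)
      auto
qed

lemma Ck_on_add:
  assumes U: "open U"
  shows "Ck_on k U f \<Longrightarrow> Ck_on k U g \<Longrightarrow> Ck_on k U (\<lambda>x. f x + g x)"
proof (induction k arbitrary: f g)
  case 0
  then show ?case by (auto intro: continuous_on_add)
next
  case (Suc k)
  show ?case
    by (rule Ck_on_SucI[OF U has_derivative_add[OF Ck_on_Suc_has_derivative[OF Suc.prems(1)]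
            Ck_on_Suc_has_derivative[OF Suc.prems(2)]]]) (use Suc in auto)
qed

text \<open>The product rule pairs a derivative of one factor with the other factor itself, so the
  induction runs over both functions and lowers the class of the undifferentiated factor by
  \<open>Ck_on_SucD\<close>.\<close>

lemma Ck_on_bilinear:
  assumes U: "open U" and B: "bounded_bilinear B"
  shows "Ck_on k U f \<Longrightarrow> Ck_on k U g \<Longrightarrow> Ck_on k U (\<lambda>x. B (f x) (g x))"
proof (induction k arbitrary: f g)
  case 0
  then show ?case using B by (auto intro: bounded_bilinear.continuous_on)
next
  case (Suc k)
  have "Ck_on k U (\<lambda>x. B (f x) (dirderiv v g x) + B (dirderiv v f x) (g x))" for v
    using Ck_on_SucD[OF Suc.prems(1)] Ck_on_SucD[OF Suc.prems(2)] Suc.prems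
    by (intro Ck_on_add[OF U] Suc.IH) auto
  then show ?case
    by (intro Ck_on_SucI[OF U bounded_bilinear.FDERIV[OF B Ck_on_Suc_has_derivative[OF Suc.prems(1)]
            Ck_on_Suc_has_derivative[OF Suc.prems(2)]]])
qed

lemma Ck_on_const: "Ck_on k U (\<lambda>x :: 'a::euclidean_space. c)"
proof (induction k arbitrary: c)
  case (Suc k)
  have "dirderiv v (\<lambda>x. c) x = 0" for v x :: 'a by (rule dirderiv_eq) (rule has_derivative_const)
  then have "dirderiv v (\<lambda>x. c) = (\<lambda>x. 0)" for v :: 'a by (rule ext)
  with Suc show ?case by simp
qed auto

lemma Ck_on_linear:
  assumes "bounded_linear L" shows "Ck_on k U L"
proof (cases k)
  case 0
  then show ?thesis using assms by (simp add: linear_continuous_on)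
next
  case (Suc k')
  have "Ck_on (Suc k') UNIV L"
    by (rule Ck_on_SucI[OF open_UNIV bounded_linear_imp_has_derivative[OF assms] Ck_on_const])
  then show ?thesis using Suc Ck_on_subset by blast
qed

lemma Ck_on_sum:
  assumes "open U" "\<And>i. i \<in> I \<Longrightarrow> Ck_on k U (f i)"
  shows "Ck_on k U (\<lambda>x. \<Sum>i\<in>I. f i x)"
  using assms(2)
  by (induction I rule: infinite_finite_induct) (auto simp: Ck_on_const intro!: Ck_on_add assms(1))

text \<open>The chain rule yields \<open>dirderiv (dirderiv v g x) f (g x)\<close>, whose direction
  varies with \<open>x\<close>. Expanding that direction in \<open>Basis\<close> gives a sum of
  products with fixed directions, to which the induction hypothesis applies.\<close>

lemma Ck_on_compose:
  fixes g :: "'a::euclidean_space \<Rightarrow> 'b::euclidean_space"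
  assumes U: "open U" and gU: "g ` U \<subseteq> V"
  shows "Ck_on k V f \<Longrightarrow> Ck_on k U g \<Longrightarrow> Ck_on k U (\<lambda>x. f (g x))"
proof (induction k arbitrary: f)
  case 0
  then show ?case using gU continuous_on_compose2[of V f U g] by auto
next
  case (Suc k)
  have f: "(f has_derivative (\<lambda>v. dirderiv v f (g x))) (at (g x))" if "x \<in> U" for x
    using that gU by (intro Ck_on_Suc_has_derivative[OF Suc.prems(1)]) auto
  have e: "dirderiv w f (g x) = (\<Sum>b\<in>Basis. (w \<bullet> b) *\<^sub>R dirderiv b f (g x))"
    if "x \<in> U" for w x
  proof -
    note lin = has_derivative_linear[OF f[OF that]]
    have "dirderiv (\<Sum>b\<in>Basis. (w \<bullet> b) *\<^sub>R b) f (g x) = (\<Sum>b\<in>Basis. (w \<bullet> b) *\<^sub>R dirderiv b f (g x))"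
      by (simp only: linear_sum[OF lin] linear_scale[OF lin])
    then show ?thesis by (simp only: euclidean_representation)
  qed
  have "Ck_on k U (\<lambda>x. \<Sum>b\<in>Basis. (dirderiv v g x \<bullet> b) *\<^sub>R dirderiv b f (g x))" for v
  proof (intro Ck_on_sum[OF U] Ck_on_bilinear[OF U bounded_bilinear_scaleR]
        Ck_on_bounded_linear[OF bounded_linear_inner_left U] Suc.IH)
    show "Ck_on k U g" by (rule Ck_on_SucD[OF Suc.prems(2)])
  qed (use Suc.prems in auto)
  then have "Ck_on k U (\<lambda>x. dirderiv (dirderiv v g x) f (g x))" for v
    by (rule Ck_on_cong[OF U, rotated]) (simp add: e)
  then show ?case
    by (intro Ck_on_SucI[OF U has_derivative_compose[OF
          Ck_on_Suc_has_derivative[OF Suc.prems(2)] f]])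
qed

text \<open>The derivative of the inverse is a polynomial in the inverse, so the induction closes on
  itself.\<close>

lemma Ck_on_inverse: "Ck_on k (- {0}) (inverse :: real \<Rightarrow> real)"
proof (induction k)
  case 0
  then show ?case by (auto intro!: continuous_intros)
next
  case (Suc k)
  have U: "open (- {0::real})" by (simp add: open_Compl)
  have "Ck_on k (- {0}) (\<lambda>x::real. - (inverse x * v * inverse x))" for v
    by (intro Ck_on_bounded_linear[OF bounded_linear_minus[OF bounded_linear_ident] U]
        Ck_on_bilinear[OF U bounded_bilinear_mult] Suc.IH Ck_on_const)
  then show ?case by (intro Ck_on_SucI[OF U has_derivative_inverse']) auto
qed

section \<open>Closure properties of smooth functions\<close>

lemma smooth_on_cong:
  "open U \<Longrightarrow> (\<And>x. x \<in> U \<Longrightarrow> f x = g x) \<Longrightarrow> smooth_on U f \<Longrightarrow> smooth_on U g"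
  unfolding smooth_on_def using Ck_on_cong by blast

lemma smooth_on_subset: "smooth_on U f \<Longrightarrow> V \<subseteq> U \<Longrightarrow> smooth_on V f"
  unfolding smooth_on_def using Ck_on_subset by blast

lemma smooth_on_dirderiv: "smooth_on U f \<Longrightarrow> smooth_on U (dirderiv v f)"
  unfolding smooth_on_def by (metis Ck_on.simps(2))

lemma smooth_on_differentiable: "smooth_on U f \<Longrightarrow> x \<in> U \<Longrightarrow> f differentiable (at x)"
  unfolding smooth_on_def by (metis Ck_on.simps(2))

lemma smooth_on_has_derivative:
  "smooth_on U f \<Longrightarrow> x \<in> U \<Longrightarrow> (f has_derivative (\<lambda>v. dirderiv v f x)) (at x)"
  by (simp add: has_derivative_dirderiv smooth_on_differentiable)

lemma smooth_on_continuous_on: "smooth_on U f \<Longrightarrow> continuous_on U f"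
  unfolding smooth_on_def by (metis Ck_on.simps(1))

lemma smooth_on_isCont: "smooth_on U f \<Longrightarrow> x \<in> U \<Longrightarrow> isCont f x"
  using smooth_on_differentiable differentiable_imp_continuous_within by blast

lemma smooth_on_const: "smooth_on U (\<lambda>x. c)"
  by (simp add: smooth_on_def Ck_on_const)

lemma smooth_on_linear: "bounded_linear L \<Longrightarrow> smooth_on U L"
  by (simp add: smooth_on_def Ck_on_linear)

lemma smooth_on_bounded_linear:
  "bounded_linear L \<Longrightarrow> open U \<Longrightarrow> smooth_on U f \<Longrightarrow> smooth_on U (\<lambda>x. L (f x))"
  unfolding smooth_on_def using Ck_on_bounded_linear by blast

lemma smooth_on_add:
  "open U \<Longrightarrow> smooth_on U f \<Longrightarrow> smooth_on U g \<Longrightarrow> smooth_on U (\<lambda>x. f x + g x)"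
  unfolding smooth_on_def using Ck_on_add by blast

lemma smooth_on_mult:
  fixes f g :: "'a::euclidean_space \<Rightarrow> real"
  shows "open U \<Longrightarrow> smooth_on U f \<Longrightarrow> smooth_on U g \<Longrightarrow> smooth_on U (\<lambda>x. f x * g x)"
  unfolding smooth_on_def using Ck_on_bilinear[OF _ bounded_bilinear_mult] by blast

lemma smooth_on_scaleR:
  "open U \<Longrightarrow> smooth_on U f \<Longrightarrow> smooth_on U g \<Longrightarrow> smooth_on U (\<lambda>x. f x *\<^sub>R g x)"
  unfolding smooth_on_def using Ck_on_bilinear[OF _ bounded_bilinear_scaleR] by blast

lemma smooth_on_compose:
  fixes g :: "'a::euclidean_space \<Rightarrow> 'b::euclidean_space"
  shows "open U \<Longrightarrow> g ` U \<subseteq> V \<Longrightarrow> smooth_on V f \<Longrightarrow> smooth_on U g \<Longrightarrow> smooth_on U (\<lambda>x. f (g x))"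
  unfolding smooth_on_def using Ck_on_compose by blast

lemma smooth_on_uminus:
  "open U \<Longrightarrow> smooth_on U f \<Longrightarrow> smooth_on U (\<lambda>x. - f x)"
  using smooth_on_bounded_linear[OF bounded_linear_minus[OF bounded_linear_ident]] .

lemma smooth_on_diff:
  "open U \<Longrightarrow> smooth_on U f \<Longrightarrow> smooth_on U g \<Longrightarrow> smooth_on U (\<lambda>x. f x - g x)"
  using smooth_on_add[OF _ _ smooth_on_uminus] by fastforce

lemma Ck_on_divide:
  fixes f g :: "'a::euclidean_space \<Rightarrow> real"
  assumes "open U" "Ck_on k U f" "Ck_on k U g" "\<And>x. x \<in> U \<Longrightarrow> g x \<noteq> 0"
  shows "Ck_on k U (\<lambda>x. f x / g x)"
proof -
  have "Ck_on k U (\<lambda>x. inverse (g x))"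
    using assms by (intro Ck_on_compose[OF assms(1) _ Ck_on_inverse]) auto
  from Ck_on_bilinear[OF assms(1) bounded_bilinear_mult assms(2) this]
  show ?thesis by (simp add: divide_inverse)
qed

section \<open>Derivatives along curves and symmetry of second derivatives\<close>

lemma has_real_derivative_along:
  assumes "(\<phi> has_derivative \<phi>') (at (\<gamma> t))" "(\<gamma> has_vector_derivative v) (at t)"
  shows "((\<lambda>t. \<phi> (\<gamma> t)) has_real_derivative \<phi>' v) (at t)"
proof -
  have "((\<lambda>t. \<phi> (\<gamma> t)) has_derivative (\<lambda>h. \<phi>' (h *\<^sub>R v))) (at t)"
    using has_derivative_compose[OF assms(2)[unfolded has_vector_derivative_def] assms(1)] .
  then show ?thesis
    by (simp add: has_field_derivative_def linear_scale[OF has_derivative_linear[OF assms(1)]]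
        mult.commute[of _ "\<phi>' v"])
qed

lemma has_vector_derivative_line:
  "((\<lambda>t. p + t *\<^sub>R u) has_vector_derivative u) (at t)"
  by (auto intro!: derivative_eq_intros)

text \<open>By the mean value theorem in the direction \<open>u\<close>, the second difference over
  the parallelogram is \<open>h\<close> times an increment of \<open>dirderiv u \<phi>\<close> in
  the direction \<open>v\<close>; differentiability of that function at \<open>p\<close> gives the
  limit. The second difference is symmetric in \<open>u\<close> and \<open>v\<close>, which makes
  mixed derivatives commute.\<close>

lemma mixed_dirderiv_quotient:
  fixes \<phi> :: "'a::euclidean_space \<Rightarrow> real"
  assumes U: "open U" "p \<in> U" and s: "smooth_on U \<phi>"
  shows "((\<lambda>h. (\<phi> (p + h *\<^sub>R u + h *\<^sub>R v) - \<phi> (p + h *\<^sub>R u) - \<phi> (p + h *\<^sub>R v) + \<phi> p) / h\<^sup>2)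
     \<longlongrightarrow> dirderiv v (dirderiv u \<phi>) p) (at_right 0)"
proof (rule tendstoI)
  fix e :: real assume e: "e > 0"
  define \<psi> where "\<psi> = dirderiv u \<phi>"
  \<comment> \<open>Per unit of \<open>h\<close>, \<open>2 * norm u + norm v\<close> bounds the sum
    of the two displacements from \<open>p\<close> that occur below; the summand 1 makes
    \<open>M\<close> positive.\<close>
  define M where "M = 2 * norm u + norm v + 1"
  have M: "M > 0" by (simp add: M_def add_nonneg_pos)
  have psi: "(\<psi> has_derivative (\<lambda>v. dirderiv v \<psi> p)) (at p)"
    unfolding \<psi>_def by (intro smooth_on_has_derivative[OF smooth_on_dirderiv[OF s] U(2)])
  have "e / (2 * M) > 0" using e M by simp
  then obtain d where d: "d > 0" and
    "\<And>y. norm (y - p) < d \<Longrightarrow> \<bar>\<psi> y - \<psi> p - dirderiv (y - p) \<psi> p\<bar> \<le> e / (2 * M) * norm (y - p)"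
    using psi unfolding has_derivative_at_alt real_norm_def by blast
  from this(2)[of "p + _"]
  have dd: "norm w < d \<Longrightarrow> \<bar>\<psi> (p + w) - \<psi> p - dirderiv w \<psi> p\<bar> \<le> e / (2 * M) * norm w" for w
    by simp
  obtain \<rho> where rho: "\<rho> > 0" "ball p \<rho> \<subseteq> U" using U open_contains_ball by blast
  note lin = has_derivative_linear[OF psi]
  show "\<forall>\<^sub>F h in at_right 0. dist ((\<phi> (p + h *\<^sub>R u + h *\<^sub>R v) - \<phi> (p + h *\<^sub>R u) -
      \<phi> (p + h *\<^sub>R v) + \<phi> p) / h\<^sup>2) (dirderiv v (dirderiv u \<phi>) p) < e"
    unfolding eventually_at_right_field
  proof (intro exI[of _ "min d \<rho> / M"] conjI allI impI)
    show "0 < min d \<rho> / M" using d rho M by simp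
    fix h assume h: "0 < h" "h < min d \<rho> / M"
    have hM: "h * M < d" "h * M < \<rho>" using h M by (auto simp: pos_less_divide_eq)
    have n1: "norm (t *\<^sub>R u + h *\<^sub>R v) \<le> h * (norm u + norm v)" "norm (t *\<^sub>R u) \<le> h * norm u"
      if "0 \<le> t" "t \<le> h" for t
    proof -
      show "norm (t *\<^sub>R u) \<le> h * norm u" using that by (simp add: mult_right_mono)
      then show "norm (t *\<^sub>R u + h *\<^sub>R v) \<le> h * (norm u + norm v)"
        using norm_triangle_ineq[of "t *\<^sub>R u" "h *\<^sub>R v"] h by (simp add: algebra_simps)
    qed
    have le: "h * (norm u + norm v) \<le> h * M" "h * norm u \<le> h * M" using h by (auto simp: M_def)
    have in_U: "p + t *\<^sub>R u + h *\<^sub>R v \<in> U" "p + t *\<^sub>R u \<in> U" if "0 \<le> t" "t \<le> h" for t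
    proof -
      have "norm (t *\<^sub>R u + h *\<^sub>R v) < \<rho>" "norm (t *\<^sub>R u) < \<rho>"
        using n1[OF that] le hM by linarith+
      then have "p + t *\<^sub>R u + h *\<^sub>R v \<in> ball p \<rho>" "p + t *\<^sub>R u \<in> ball p \<rho>"
        by (simp_all only: mem_ball dist_norm norm_minus_commute[of p] add.assoc add_diff_cancel_left')
      then show "p + t *\<^sub>R u + h *\<^sub>R v \<in> U" "p + t *\<^sub>R u \<in> U" using rho by auto
    qed
    have line: "((\<lambda>t. \<phi> (q + t *\<^sub>R u)) has_real_derivative \<psi> (q + t *\<^sub>R u)) (at t)"
      if "q + t *\<^sub>R u \<in> U" for q t
      using has_real_derivative_along[of \<phi> _ "\<lambda>t. q + t *\<^sub>R u" t u,
          OF smooth_on_has_derivative[OF s that] has_vector_derivative_line]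
      by (simp add: \<psi>_def)
    \<comment> \<open>The mean value theorem is applied to the difference \<open>g\<close>, so that
      one intermediate point serves both terms.\<close>
    define g where "g t = \<phi> (p + h *\<^sub>R v + t *\<^sub>R u) - \<phi> (p + t *\<^sub>R u)" for t
    have g: "(g has_real_derivative \<psi> (p + h *\<^sub>R v + t *\<^sub>R u) - \<psi> (p + t *\<^sub>R u)) (at t)"
      if "0 \<le> t" "t \<le> h" for t
      unfolding g_def using in_U[OF that] by (intro DERIV_diff line) (simp_all add: add_ac)
    obtain \<xi> where xi: "0 < \<xi>" "\<xi> < h" and
      g2: "g h - g 0 = (h - 0) * (\<psi> (p + h *\<^sub>R v + \<xi> *\<^sub>R u) - \<psi> (p + \<xi> *\<^sub>R u))"
      using MVT2[OF h(1) g] by metis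
    define w where "w = \<xi> *\<^sub>R u + h *\<^sub>R v"
    have nw: "norm w \<le> h * (norm u + norm v)" "norm (\<xi> *\<^sub>R u) \<le> h * norm u"
      using n1[of \<xi>] xi by (auto simp: w_def)
    have "\<bar>\<psi> (p + w) - \<psi> p - dirderiv w \<psi> p\<bar> \<le> e / (2 * M) * norm w"
      "\<bar>\<psi> (p + \<xi> *\<^sub>R u) - \<psi> p - dirderiv (\<xi> *\<^sub>R u) \<psi> p\<bar> \<le> e / (2 * M) * norm (\<xi> *\<^sub>R u)"
      using nw le hM by (intro dd; linarith)+
    moreover have "dirderiv w \<psi> p = dirderiv (\<xi> *\<^sub>R u) \<psi> p + h * dirderiv v \<psi> p"
      unfolding w_def by (simp only: linear_add[OF lin] linear_scale[OF lin] real_scaleR_def)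
    ultimately have "\<bar>\<psi> (p + w) - \<psi> (p + \<xi> *\<^sub>R u) - h * dirderiv v \<psi> p\<bar>
        \<le> e / (2 * M) * norm w + e / (2 * M) * norm (\<xi> *\<^sub>R u)"
      by linarith
    also have "\<dots> = e / (2 * M) * (norm w + norm (\<xi> *\<^sub>R u))" by (simp only: distrib_left)
    also have "\<dots> \<le> e / (2 * M) * (h * M)"
    proof (rule mult_left_mono)
      have "h * (norm u + norm v) + h * norm u \<le> h * M"
        using h(1) by (simp add: M_def algebra_simps)
      then show "norm w + norm (\<xi> *\<^sub>R u) \<le> h * M" using nw by linarith
    qed (use e M in auto)
    also have "\<dots> = e / 2 * h" using M by simp
    also have "\<dots> < e * h" using e h by simp
    finally have main: "\<bar>\<psi> (p + w) - \<psi> (p + \<xi> *\<^sub>R u) - h * dirderiv v \<psi> p\<bar> < e * h" .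
    have "\<phi> (p + h *\<^sub>R u + h *\<^sub>R v) - \<phi> (p + h *\<^sub>R u) - \<phi> (p + h *\<^sub>R v) + \<phi> p = g h - g 0"
      by (simp add: g_def add.commute add.left_commute)
    also have "\<dots> = h * (\<psi> (p + w) - \<psi> (p + \<xi> *\<^sub>R u))"
      using g2 by (simp add: w_def algebra_simps)
    finally have num: "\<phi> (p + h *\<^sub>R u + h *\<^sub>R v) - \<phi> (p + h *\<^sub>R u) - \<phi> (p + h *\<^sub>R v) + \<phi> p
        = h * (\<psi> (p + w) - \<psi> (p + \<xi> *\<^sub>R u))" .
    have "(\<phi> (p + h *\<^sub>R u + h *\<^sub>R v) - \<phi> (p + h *\<^sub>R u) - \<phi> (p + h *\<^sub>R v) + \<phi> p) / h\<^sup>2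
        - dirderiv v \<psi> p = (\<psi> (p + w) - \<psi> (p + \<xi> *\<^sub>R u) - h * dirderiv v \<psi> p) / h"
      unfolding num using h by (simp add: field_simps power2_eq_square)
    then show "dist ((\<phi> (p + h *\<^sub>R u + h *\<^sub>R v) - \<phi> (p + h *\<^sub>R u) -
      \<phi> (p + h *\<^sub>R v) + \<phi> p) / h\<^sup>2) (dirderiv v (dirderiv u \<phi>) p) < e"
      using main h by (simp add: dist_norm \<psi>_def pos_divide_less_eq)
  qed
qed

lemma dirderiv_commute:
  fixes \<phi> :: "'a::euclidean_space \<Rightarrow> real"
  assumes U: "open U" "p \<in> U" and s: "smooth_on U \<phi>"
  shows "dirderiv v (dirderiv u \<phi>) p = dirderiv u (dirderiv v \<phi>) p"
proof -
  have "\<phi> (p + h *\<^sub>R v + h *\<^sub>R u) - \<phi> (p + h *\<^sub>R v) - \<phi> (p + h *\<^sub>R u) + \<phi> p =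
    \<phi> (p + h *\<^sub>R u + h *\<^sub>R v) - \<phi> (p + h *\<^sub>R u) - \<phi> (p + h *\<^sub>R v) + \<phi> p" for h
  proof -
    have "p + h *\<^sub>R v + h *\<^sub>R u = p + h *\<^sub>R u + h *\<^sub>R v" by (simp only: add_ac)
    show ?thesis unfolding \<open>p + h *\<^sub>R v + h *\<^sub>R u = p + h *\<^sub>R u + h *\<^sub>R v\<close> by simp
  qed
  with mixed_dirderiv_quotient[OF assms, of v u]
  have "((\<lambda>h. (\<phi> (p + h *\<^sub>R u + h *\<^sub>R v) - \<phi> (p + h *\<^sub>R u) - \<phi> (p + h *\<^sub>R v) + \<phi> p) / h\<^sup>2)
     \<longlongrightarrow> dirderiv u (dirderiv v \<phi>) p) (at_right 0)" by simp
  from tendsto_unique[OF trivial_limit_at_right_real mixed_dirderiv_quotient[OF assms] this]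
  show ?thesis .
qed

section \<open>Regularity of implicitly defined functions\<close>

text \<open>On the zero set the linear approximation of \<open>G\<close> says that
  \<open>G' (h, 0) + c * k\<close> is small compared with \<open>norm h + \<bar>k\<bar>\<close>. It
  is used twice: first crudely, to bound \<open>k\<close> by a multiple of \<open>norm h\<close>,
  then to make the error small compared with \<open>norm h\<close>. Continuity of
  \<open>\<sigma>\<close> brings the points within reach of the approximation.\<close>

lemma implicit_has_derivative:
  fixes G :: "'a::euclidean_space \<times> real \<Rightarrow> real"
  assumes G: "(G has_derivative G') (at (x, \<sigma> x))" and c: "G' (0, 1) \<noteq> 0"
    and U: "open U" "x \<in> U" and z: "\<And>x. x \<in> U \<Longrightarrow> G (x, \<sigma> x) = 0" and cont: "isCont \<sigma> x"
  shows "(\<sigma> has_derivative (\<lambda>h. - G' (h, 0) / G' (0, 1))) (at x)"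
proof -
  define c where "c = G' (0, 1)"
  have c0: "c \<noteq> 0" using c by (simp add: c_def)
  note lin = has_derivative_linear[OF G]
  have G'_eq: "G' (h, k) = G' (h, 0) + c * k" for h k
    using linear_add[OF lin, of "(h, 0)" "(0, k)"] linear_scale[OF lin, of k "(0, 1)"]
    by (simp add: c_def mult.commute)
  have "bounded_linear (\<lambda>h. G' (h, 0))"
    by (rule bounded_linear_compose[OF has_derivative_bounded_linear[OF G]])
      (intro bounded_linear_Pair bounded_linear_ident bounded_linear_zero)
  then obtain M where M: "M > 0" "\<And>h. \<bar>G' (h, 0)\<bar> \<le> norm h * M"
    using bounded_linear.pos_bounded by (metis real_norm_def)
  \<comment> \<open>Solving \<open>\<bar>c\<bar> * \<bar>k\<bar> \<le> M * norm h + \<bar>c\<bar> /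
    2 * (norm h + \<bar>k\<bar>)\<close> for \<open>\<bar>k\<bar>\<close> gives this
    constant.\<close>
  define K where "K = 2 * M / \<bar>c\<bar> + 1"
  have K: "K > 0" using M by (simp add: K_def add_nonneg_pos)
  have bl: "bounded_linear (\<lambda>h. - G' (h, 0) / c)"
    by (intro bounded_linear_compose[OF bounded_linear_divide] bounded_linear_minus)
      (rule \<open>bounded_linear (\<lambda>h. G' (h, 0))\<close>)
  have "\<exists>d>0. \<forall>y. norm (y - x) < d \<longrightarrow> norm (\<sigma> y - \<sigma> x - (- G' (y - x, 0) / c)) \<le> e * norm (y - x)"
    if e: "e > 0" for e
  proof -
    \<comment> \<open>The bound \<open>\<bar>c\<bar> / 2\<close> lets the term with \<open>k\<close>
      be absorbed on the left; the other one turns the final error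
      \<open>\<eta> * (1 + K) * norm h\<close> into
      \<open>e * \<bar>c\<bar> * norm h\<close>.\<close>
    define \<eta> where "\<eta> = min (\<bar>c\<bar> / 2) (e * \<bar>c\<bar> / (1 + K))"
    have K1: "0 < 1 + K" using K by simp
    have "\<eta> \<le> e * \<bar>c\<bar> / (1 + K)" by (simp add: \<eta>_def)
    then have eta3: "\<eta> * (1 + K) \<le> e * \<bar>c\<bar>" using K1 by (simp only: pos_le_divide_eq)
    have eta: "\<eta> > 0" "\<eta> \<le> \<bar>c\<bar> / 2"
      using e c0 K1 by (simp add: \<eta>_def) (simp only: \<eta>_def min.cobounded1)
    obtain d where d: "d > 0" "\<And>z. norm (z - (x, \<sigma> x)) < d \<Longrightarrow>
        \<bar>G z - G (x, \<sigma> x) - G' (z - (x, \<sigma> x))\<bar> \<le> \<eta> * norm (z - (x, \<sigma> x))"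
      using G eta(1) unfolding has_derivative_at_alt real_norm_def by blast
    obtain d1 where d1: "d1 > 0" "\<And>y. norm (y - x) < d1 \<Longrightarrow> \<bar>\<sigma> y - \<sigma> x\<bar> < d / 2"
      using cont d(1) unfolding continuous_at_eps_delta dist_norm real_norm_def
      by (metis half_gt_zero)
    obtain d2 where d2: "d2 > 0" "ball x d2 \<subseteq> U" using U open_contains_ball by blast
    show ?thesis
    proof (intro exI[of _ "Min {d1, d2, d / 2}"] conjI allI impI)
      show "0 < Min {d1, d2, d / 2}" using d1 d2 d by simp
      fix y assume y: "norm (y - x) < Min {d1, d2, d / 2}"
      define h k where "h = y - x" and "k = \<sigma> y - \<sigma> x"
      have "y \<in> U" using y d2 by (auto simp: dist_norm norm_minus_commute)
      then have z0: "G (y, \<sigma> y) = 0" "G (x, \<sigma> x) = 0" using z U by auto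
      have nle: "norm (h, k) \<le> norm h + \<bar>k\<bar>"
        using norm_Pair_le[of h k] by simp
      have "norm (h, k) < d"
        using nle y d1(2)[of y] by (simp add: h_def k_def)
      then have "\<bar>G' (h, k)\<bar> \<le> \<eta> * norm (h, k)"
        using d(2)[of "(y, \<sigma> y)"] z0 by (simp add: h_def k_def)
      also have "\<dots> \<le> \<eta> * (norm h + \<bar>k\<bar>)" using nle eta(1) by simp
      finally have b: "\<bar>G' (h, 0) + c * k\<bar> \<le> \<eta> * (norm h + \<bar>k\<bar>)" by (simp add: G'_eq[of h k])
      have "\<bar>c\<bar> * \<bar>k\<bar> \<le> \<bar>G' (h, 0)\<bar> + \<eta> * (norm h + \<bar>k\<bar>)"
        using b by (simp add: abs_mult[symmetric])
      also have "\<dots> \<le> norm h * M + \<bar>c\<bar> / 2 * (norm h + \<bar>k\<bar>)"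
        using M(2)[of h] eta by (intro add_mono mult_right_mono) auto
      finally have "\<bar>c\<bar> * \<bar>k\<bar> \<le> 2 * (norm h * M) + \<bar>c\<bar> * norm h" by argo
      then have k: "\<bar>k\<bar> \<le> K * norm h"
        using c0 by (simp add: K_def field_simps)
      have "\<bar>G' (h, 0) + c * k\<bar> \<le> \<eta> * (norm h + K * norm h)"
        using b k eta(1) by (meson add_left_mono mult_left_mono order_trans less_imp_le)
      also have "\<dots> = (\<eta> * (1 + K)) * norm h" by (simp add: algebra_simps)
      also have "\<dots> \<le> e * \<bar>c\<bar> * norm h" using eta3 by (intro mult_right_mono) auto
      finally have f: "\<bar>G' (h, 0) + c * k\<bar> \<le> e * \<bar>c\<bar> * norm h" .
      have "k - (- G' (h, 0) / c) = (G' (h, 0) + c * k) / c" using c0 by (simp add: field_simps)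
      then have "\<bar>k - (- G' (h, 0) / c)\<bar> = \<bar>G' (h, 0) + c * k\<bar> / \<bar>c\<bar>" by (simp add: abs_divide)
      also have "\<dots> \<le> e * norm h" using f c0 by (simp add: pos_divide_le_eq mult_ac)
      finally show "norm (\<sigma> y - \<sigma> x - (- G' (y - x, 0) / c)) \<le> e * norm (y - x)"
        by (simp add: h_def k_def)
    qed
  qed
  with bl show ?thesis unfolding has_derivative_at_alt c_def by blast
qed

text \<open>Bootstrapping: the derivative of \<open>\<sigma>\<close> is a quotient of smooth
  functions evaluated at \<open>(x, \<sigma> x)\<close>, hence of the same class as
  \<open>\<sigma>\<close>, so \<open>\<sigma>\<close> gains one order at each step.\<close>

lemma implicit_smooth_on:
  fixes G :: "'a::euclidean_space \<times> real \<Rightarrow> real"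
  assumes W: "open W" "smooth_on W G" and U: "open U" and cont: "continuous_on U \<sigma>"
    and z: "\<And>x. x \<in> U \<Longrightarrow> (x, \<sigma> x) \<in> W \<and> G (x, \<sigma> x) = 0 \<and> dirderiv (0, 1) G (x, \<sigma> x) \<noteq> 0"
  shows "smooth_on U \<sigma>"
proof -
  have d: "(\<sigma> has_derivative (\<lambda>h. - dirderiv (h, 0) G (x, \<sigma> x) / dirderiv (0, 1) G (x, \<sigma> x))) (at x)"
    if "x \<in> U" for x
    using that z cont U continuous_on_eq_continuous_at
    by (intro implicit_has_derivative[of G _ x \<sigma> U] smooth_on_has_derivative[OF W(2)]) auto
  have "Ck_on k U \<sigma>" for k
  proof (induction k)
    case 0
    then show ?case using cont by simp
  next
    case (Suc k)
    have b1: "bounded_linear (\<lambda>y::'a. (y, 0::real))" "bounded_linear (\<lambda>z::real. (0::'a, z))"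
      by (intro bounded_linear_Pair bounded_linear_ident bounded_linear_zero)+
    have g: "Ck_on k U (\<lambda>x. (x, \<sigma> x))"
      using Ck_on_add[OF U Ck_on_linear[OF b1(1)] Ck_on_bounded_linear[OF b1(2) U Suc]] by simp
    have "Ck_on k U (\<lambda>x. dirderiv w G (x, \<sigma> x))" for w
      using smooth_on_dirderiv[OF W(2)] z
      by (intro Ck_on_compose[OF U _ _ g, of W]) (auto simp: smooth_on_def)
    then have "Ck_on k U (\<lambda>x. - dirderiv (v, 0) G (x, \<sigma> x) / dirderiv (0, 1) G (x, \<sigma> x))" for v
      using z by (intro Ck_on_divide[OF U]
          Ck_on_bounded_linear[OF bounded_linear_minus[OF bounded_linear_ident] U]) auto
    then show ?case by (intro Ck_on_SucI[OF U d])
  qed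
  then show ?thesis by (simp add: smooth_on_def)
qed

text \<open>For \<open>c\<close> slightly below \<open>\<sigma> x\<close> the sign of
  \<open>G\<close> at \<open>(x, c)\<close> persists at nearby points \<open>y\<close>, and by
  hypothesis this sign says that \<open>c\<close> is below \<open>\<sigma> y\<close> too; likewise
  above.\<close>

lemma implicit_continuous_on:
  fixes G :: "'a::euclidean_space \<times> real \<Rightarrow> real"
  assumes W: "open W" "continuous_on W G" and U: "open U"
    and W': "\<And>x. x \<in> U \<Longrightarrow> (x, \<sigma> x) \<in> W"
    and neg: "\<And>x t. x \<in> U \<Longrightarrow> (x, t) \<in> W \<Longrightarrow> G (x, t) < 0 \<longleftrightarrow> t < \<sigma> x"
    and pos: "\<And>x t. x \<in> U \<Longrightarrow> (x, t) \<in> W \<Longrightarrow> G (x, t) > 0 \<longleftrightarrow> t > \<sigma> x"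
  shows "continuous_on U \<sigma>"
proof -
  have op: "open (W \<inter> G -` T)" if "open T" for T
    using continuous_open_preimage[OF W(2,1) that] .
  have ev: "\<forall>\<^sub>F y in nhds x. P y" if "open A" "(x, c) \<in> A" "\<And>y. (y, c) \<in> A \<Longrightarrow> y \<in> U \<Longrightarrow> P y" "x \<in> U"
    for A P x and c :: real
  proof -
    have "open ((\<lambda>y. (y, c)) -` A \<inter> U)"
      using that(1) U by (intro open_Int open_vimage) (auto intro!: continuous_intros)
    then show ?thesis unfolding eventually_nhds using that
      by (intro exI[of _ "(\<lambda>y. (y, c)) -` A \<inter> U"]) auto
  qed
  have "(\<sigma> \<longlongrightarrow> \<sigma> x) (at x)" if x: "x \<in> U" for x
  proof (rule order_tendstoI)
    have "open ((\<lambda>t. (x, t)) -` W)"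
      using W(1) by (intro open_vimage) (auto intro!: continuous_intros)
    moreover have "\<sigma> x \<in> (\<lambda>t. (x, t)) -` W" using W'[OF x] by simp
    ultimately obtain d where d: "d > 0" "\<And>t. \<bar>t - \<sigma> x\<bar> < d \<Longrightarrow> (x, t) \<in> W"
      unfolding open_dist dist_real_def vimage_eq by blast
    {
      fix a assume a: "a < \<sigma> x"
      \<comment> \<open>The point \<open>(x, a)\<close> may lie outside \<open>W\<close>, so
        \<open>a\<close> is moved closer to \<open>\<sigma> x\<close>.\<close>
      define c where "c = max a (\<sigma> x - d / 2)"
      have c: "a \<le> c" "c < \<sigma> x" using a d(1) by (simp_all add: c_def)
      have cW: "(x, c) \<in> W" by (rule d(2)) (use a d(1) in \<open>simp add: c_def max_def abs_if\<close>)
      with neg[OF x cW] c have cA: "(x, c) \<in> W \<inter> G -` {..<0}" by simp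
      have "a < \<sigma> y" if "(y, c) \<in> W \<inter> G -` {..<0}" "y \<in> U" for y
        using neg[OF that(2), of c] that(1) c by simp
      from ev[of _ x c "\<lambda>y. a < \<sigma> y", OF op[OF open_lessThan] cA this x]
      show "\<forall>\<^sub>F y in at x. a < \<sigma> y" by (simp add: eventually_at_filter eventually_mono)
    next
      fix a assume a: "a > \<sigma> x"
      define c where "c = min a (\<sigma> x + d / 2)"
      have c: "a \<ge> c" "c > \<sigma> x" using a d(1) by (simp_all add: c_def)
      have cW: "(x, c) \<in> W" by (rule d(2)) (use a d(1) in \<open>simp add: c_def min_def abs_if\<close>)
      with pos[OF x cW] c have cA: "(x, c) \<in> W \<inter> G -` {0<..}" by simp
      have "a > \<sigma> y" if "(y, c) \<in> W \<inter> G -` {0<..}" "y \<in> U" for y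
        using pos[OF that(2), of c] that(1) c by simp
      from ev[of _ x c "\<lambda>y. a > \<sigma> y", OF op[OF open_greaterThan] cA this x]
      show "\<forall>\<^sub>F y in at x. a > \<sigma> y" by (simp add: eventually_at_filter eventually_mono)
    }
  qed
  then show ?thesis by (simp add: continuous_on_eq_continuous_at[OF U] isCont_def)
qed

section \<open>Ovals\<close>

definition rot :: "real \<times> real \<Rightarrow> real \<times> real" where
  "rot p = (- snd p, fst p)"

lemma rot_simps [simp]:
  "fst (rot p) = - snd p" "snd (rot p) = fst p" "norm (rot p) = norm p" "rot (rot p) = - p"
  by (simp_all add: rot_def norm_prod_def prod_eq_iff add.commute)

section \<open>Self-intersections under homeomorphisms\<close>

lemma self_intersections_image_subset:
  assumes cont: "continuous_on A \<theta>" and inj: "inj_on \<theta> A" and C: "C \<subseteq> A"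
  shows "\<theta> ` self_intersections C \<subseteq> self_intersections (\<theta> ` C)"
proof
  fix y assume "y \<in> \<theta> ` self_intersections C"
  then obtain p \<alpha> \<beta> where y: "y = \<theta> p" and
    ab: "\<forall>\<gamma>\<in>{\<alpha>, \<beta>}. continuous_on {-1..1::real} \<gamma> \<and> inj_on \<gamma> {-1..1} \<and> \<gamma> ` {-1..1} \<subseteq> C \<and> \<gamma> 0 = p"
    and int: "\<alpha> ` {-1..1} \<inter> \<beta> ` {-1..1} = {p}"
    unfolding self_intersections_def image_iff mem_Collect_eq by blast
  have "\<forall>\<gamma>\<in>{\<theta> \<circ> \<alpha>, \<theta> \<circ> \<beta>}. continuous_on {-1..1} \<gamma> \<and> inj_on \<gamma> {-1..1} \<and>
      \<gamma> ` {-1..1} \<subseteq> \<theta> ` C \<and> \<gamma> 0 = y"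
  proof -
    have "continuous_on {-1..1} (\<theta> \<circ> \<gamma>) \<and> inj_on (\<theta> \<circ> \<gamma>) {-1..1} \<and>
        (\<theta> \<circ> \<gamma>) ` {-1..1} \<subseteq> \<theta> ` C \<and> (\<theta> \<circ> \<gamma>) 0 = y" if "\<gamma> \<in> {\<alpha>, \<beta>}" for \<gamma>
    proof -
      have g: "continuous_on {-1..1} \<gamma>" "inj_on \<gamma> {-1..1}" "\<gamma> ` {-1..1} \<subseteq> C" "\<gamma> 0 = p"
        using ab that by auto
      moreover have "\<gamma> ` {-1..1} \<subseteq> A" using g(3) C by blast
      ultimately show ?thesis
        using y continuous_on_compose[OF g(1) continuous_on_subset[OF cont]]
          comp_inj_on[OF g(2) inj_on_subset[OF inj]] by auto
    qed
    then show ?thesis by auto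
  qed
  moreover have "(\<theta> \<circ> \<alpha>) ` {-1..1} \<inter> (\<theta> \<circ> \<beta>) ` {-1..1} = {y}"
  proof -
    have "\<alpha> ` {-1..1} \<subseteq> A" "\<beta> ` {-1..1} \<subseteq> A" using ab C by auto
    then have "\<theta> ` (\<alpha> ` {-1..1} \<inter> \<beta> ` {-1..1}) = \<theta> ` \<alpha> ` {-1..1} \<inter> \<theta> ` \<beta> ` {-1..1}"
      by (rule inj_on_image_Int[OF inj])
    then show ?thesis using int y by (simp add: image_comp)
  qed
  ultimately show "y \<in> self_intersections (\<theta> ` C)"
    unfolding self_intersections_def by blast
qed

lemma self_intersections_homeomorphism:
  assumes h: "homeomorphism A B \<theta> \<theta>'" and C: "C \<subseteq> A"
  shows "\<theta> ` self_intersections C = self_intersections (\<theta> ` C)"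
proof
  have inj: "inj_on \<theta> A" "inj_on \<theta>' B"
    using inj_on_inverseI[of A \<theta>' \<theta>] inj_on_inverseI[of B \<theta> \<theta>'] homeomorphism_apply1[OF h]
      homeomorphism_apply2[OF h] by blast+
  have sub: "\<theta> ` C \<subseteq> B" using h C by (auto simp: homeomorphism_def)
  show "\<theta> ` self_intersections C \<subseteq> self_intersections (\<theta> ` C)"
    using self_intersections_image_subset[OF homeomorphism_cont1[OF h] inj(1) C] .
  have "\<theta>' ` self_intersections (\<theta> ` C) \<subseteq> self_intersections (\<theta>' ` \<theta> ` C)"
    using self_intersections_image_subset[OF homeomorphism_cont2[OF h] inj(2) sub] .
  moreover have "\<theta>' ` \<theta> ` C = (\<lambda>x. x) ` C"
    unfolding image_image using homeomorphism_apply1[OF h] C by (intro image_cong) auto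
  ultimately have s: "\<theta>' ` self_intersections (\<theta> ` C) \<subseteq> self_intersections C" by simp
  have "self_intersections D \<subseteq> D" for D
  proof
    fix p assume "p \<in> self_intersections D"
    then obtain \<alpha> \<beta> :: "real \<Rightarrow> real \<times> real" where "\<forall>\<gamma>\<in>{\<alpha>, \<beta>}. continuous_on {-1..1} \<gamma> \<and>
        inj_on \<gamma> {-1..1} \<and> \<gamma> ` {-1..1} \<subseteq> D \<and> \<gamma> 0 = p"
      unfolding self_intersections_def mem_Collect_eq by (elim exE conjE)
    then have "\<alpha> ` {-1..1} \<subseteq> D" "\<alpha> 0 = p" by simp_all
    moreover have "\<alpha> 0 \<in> \<alpha> ` {-1..1}" by (rule imageI) simp
    ultimately show "p \<in> D" by blast
  qed
  then have "self_intersections (\<theta> ` C) \<subseteq> B" using sub by blast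
  then have "\<theta> ` \<theta>' ` self_intersections (\<theta> ` C) = (\<lambda>x. x) ` self_intersections (\<theta> ` C)"
    unfolding image_image using homeomorphism_apply2[OF h] by (intro image_cong) auto
  then show "self_intersections (\<theta> ` C) \<subseteq> \<theta> ` self_intersections C"
    using image_mono[OF s, of \<theta>] by simp
qed

lemma diffeomorphism_on_ident: "diffeomorphism_on X X (\<lambda>x. x) (\<lambda>x. x)"
proof -
  have "smooth_on_subset X (\<lambda>x. x)"
    unfolding smooth_on_subset_def
    by (intro ballI exI[of _ UNIV] exI[of _ "\<lambda>x. x"]) (simp add: smooth_on_linear)
  then show ?thesis by (simp add: diffeomorphism_on_def)
qed

text \<open>Serves for the empty curves and for the single points: all special sets coincide there,
  and the identity is the homeomorphism.\<close>

lemma same_configuration_cong: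
  assumes "curve r g = curve r h" "singular_points r g = singular_points r h"
    "inflections r g = inflections r h" "vertices r g = vertices r h"
  shows "same_configuration r g h"
proof -
  have "diffeomorphic_sets (curve r h) (curve r h)"
    unfolding diffeomorphic_sets_def using diffeomorphism_on_ident by blast
  then show ?thesis
    unfolding same_configuration_def assms
    by (auto intro!: eqpoll_refl exI[of _ "\<lambda>x. x"] simp: homeomorphism_def)
qed

text \<open>
  The gauge \<open>\<lambda>\<close> is positively homogeneous of degree \<open>-1\<close>, so that \<open>\<lambda>(p) p\<close> is the point of the curve
  on the ray through \<open>p\<close>.  The four vertices lie in narrow sectors around the four half axes spanned
  by \<open>e\<close> and \<open>rot e\<close>.
\<close>

definition oval_with ::
  "real \<Rightarrow> (real \<times> real \<Rightarrow> real) \<Rightarrow> (real \<times> real \<Rightarrow> real) \<Rightarrow> real \<times> real \<Rightarrow>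
    real \<Rightarrow> real \<Rightarrow> real \<Rightarrow> real \<Rightarrow> bool" where
  "oval_with r g \<Lambda> e m0 m1 m2 m3 \<longleftrightarrow>
     singular_points r g = {} \<and> inflections r g = {} \<and> smooth_on (- {0}) \<Lambda> \<and>
     (\<forall>p. p \<noteq> 0 \<longrightarrow> \<Lambda> p > 0 \<and> norm (\<Lambda> p *\<^sub>R p) \<le> r / 2) \<and>
     (\<forall>p c. p \<noteq> 0 \<longrightarrow> c > 0 \<longrightarrow> \<Lambda> (c *\<^sub>R p) = \<Lambda> p / c) \<and>
     curve r g = {p. p \<noteq> 0 \<and> \<Lambda> p = 1} \<and>
     norm e = 1 \<and> \<bar>m0\<bar> \<le> 1/8 \<and> \<bar>m1\<bar> \<le> 1/8 \<and> \<bar>m2\<bar> \<le> 1/8 \<and> \<bar>m3\<bar> \<le> 1/8 \<and>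
     vertices r g = (\<lambda>w. \<Lambda> w *\<^sub>R w) `
       {e + m0 *\<^sub>R rot e, rot e - m1 *\<^sub>R e, - e - m2 *\<^sub>R rot e, - rot e + m3 *\<^sub>R e}"

definition oval :: "real \<Rightarrow> (real \<times> real \<Rightarrow> real) \<Rightarrow> bool" where
  "oval r g \<longleftrightarrow> (\<exists>\<Lambda> e m0 m1 m2 m3. oval_with r g \<Lambda> e m0 m1 m2 m3)"

section \<open>The model homeomorphism from the plane to the ball\<close>

text \<open>In frame coordinates, the map that is linear on each closed quadrant and sends
  \<open>(1, 0)\<close> to \<open>(1, m0)\<close>, \<open>(0, 1)\<close> to
  \<open>(- m1, 1)\<close>, \<open>(- 1, 0)\<close> to \<open>(- 1, - m2)\<close> and
  \<open>(0, - 1)\<close> to \<open>(m3, - 1)\<close>, the directions of the vertices in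
  \<open>oval_with\<close>.\<close>

definition skew :: "real \<Rightarrow> real \<Rightarrow> real \<Rightarrow> real \<Rightarrow> real \<times> real \<Rightarrow> real \<times> real" where
  "skew m0 m1 m2 m3 z =
     (fst z - m1 * max 0 (snd z) + m3 * max 0 (- snd z), snd z + m0 * max 0 (fst z) - m2 * max 0 (- fst z))"

lemma max_lipschitz:
  fixes m m' :: real
  assumes "\<bar>m\<bar> \<le> 1/8" "\<bar>m'\<bar> \<le> 1/8"
  shows "\<bar>(m * max 0 x - m' * max 0 (- x)) - (m * max 0 y - m' * max 0 (- y))\<bar> \<le> 1/4 * \<bar>x - y\<bar>"
proof -
  have "(m * max 0 x - m' * max 0 (- x)) - (m * max 0 y - m' * max 0 (- y))
    = m * (max 0 x - max 0 y) - m' * (max 0 (- x) - max 0 (- y))" by (simp add: algebra_simps)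
  also have "\<bar>\<dots>\<bar> \<le> \<bar>m\<bar> * \<bar>max 0 x - max 0 y\<bar> + \<bar>m'\<bar> * \<bar>max 0 (- x) - max 0 (- y)\<bar>"
    using abs_triangle_ineq4 by (simp only: abs_mult[symmetric])
  also have "\<dots> \<le> 1/8 * \<bar>x - y\<bar> + 1/8 * \<bar>x - y\<bar>"
    using assms by (intro add_mono mult_mono) auto
  finally show ?thesis by simp
qed

text \<open>Solving for \<open>z\<close> reduces to a fixed point of a contraction of the line.\<close>

lemma bij_skew:
  assumes m: "\<bar>m0\<bar> \<le> 1/8" "\<bar>m1\<bar> \<le> 1/8" "\<bar>m2\<bar> \<le> 1/8" "\<bar>m3\<bar> \<le> 1/8"
  shows "bij (skew m0 m1 m2 m3)"
proof -
  define \<phi> where "\<phi> y = m1 * max 0 y - m3 * max 0 (- y)" for y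
  define \<psi> where "\<psi> x = m0 * max 0 x - m2 * max 0 (- x)" for x
  have l: "\<bar>\<phi> x - \<phi> y\<bar> \<le> 1/4 * \<bar>x - y\<bar>" "\<bar>\<psi> x - \<psi> y\<bar> \<le> 1/4 * \<bar>x - y\<bar>" for x y
    unfolding \<phi>_def \<psi>_def using max_lipschitz m by auto
  have eq: "skew m0 m1 m2 m3 z = (fst z - \<phi> (snd z), snd z + \<psi> (fst z))" for z
    by (simp add: skew_def \<phi>_def \<psi>_def)
  \<comment> \<open>The second component forces \<open>snd z = v - \<psi> (fst z)\<close>. Inserted
    in the first, it makes \<open>fst z\<close> a fixed point of a map with Lipschitz constant
    \<open>1/4 * 1/4\<close>.\<close>
  have "\<exists>!z. skew m0 m1 m2 m3 z = (u, v)" for u v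
  proof -
    have "dist (u + \<phi> (v - \<psi> x)) (u + \<phi> (v - \<psi> y)) \<le> 1/4 * dist x y" for x y
    proof -
      have "\<bar>(v - \<psi> x) - (v - \<psi> y)\<bar> = \<bar>\<psi> x - \<psi> y\<bar>" by (simp add: abs_minus_commute)
      then have "\<bar>\<phi> (v - \<psi> x) - \<phi> (v - \<psi> y)\<bar> \<le> 1/4 * \<bar>\<psi> x - \<psi> y\<bar>"
        using l(1)[of "v - \<psi> x" "v - \<psi> y"] by (simp only:)
      also have "\<dots> \<le> 1/4 * (1/4 * \<bar>x - y\<bar>)" using l(2) by (rule mult_left_mono) simp
      also have "\<dots> \<le> 1/4 * \<bar>x - y\<bar>" by simp
      finally show ?thesis by (simp add: dist_real_def)
    qed
    then have "\<exists>!x. u + \<phi> (v - \<psi> x) = x"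
      by (intro banach_fix_type[of "1/4"]) auto
    then obtain x where x: "u + \<phi> (v - \<psi> x) = x" "\<And>y. u + \<phi> (v - \<psi> y) = y \<Longrightarrow> y = x" by metis
    show ?thesis
    proof
      show "skew m0 m1 m2 m3 (x, v - \<psi> x) = (u, v)" using x(1) by (simp add: eq)
      fix z assume "skew m0 m1 m2 m3 z = (u, v)"
      then have z: "fst z - \<phi> (snd z) = u" "snd z + \<psi> (fst z) = v" by (simp_all add: eq)
      then have sz: "snd z = v - \<psi> (fst z)" by simp
      with z(1) have "u + \<phi> (v - \<psi> (fst z)) = fst z" by simp
      from x(2)[OF this] sz show "z = (x, v - \<psi> x)" by (simp add: prod_eq_iff)
    qed
  qed
  then show ?thesis unfolding bij_iff by (metis surj_pair)
qed

lemma skew_scaleR: "c \<ge> 0 \<Longrightarrow> skew m0 m1 m2 m3 (c *\<^sub>R z) = c *\<^sub>R skew m0 m1 m2 m3 z"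
proof -
  assume c: "c \<ge> 0"
  have "max 0 (c * x) = c * max 0 x" for x
    using max_mult_distrib_left[of c 0 x] c by simp
  from this[of "fst z"] this[of "snd z"] this[of "- fst z"] this[of "- snd z"] show ?thesis
    by (simp add: skew_def algebra_simps)
qed

lemma frame_coordinates:
  assumes "norm e = 1"
  shows "(a *\<^sub>R e + b *\<^sub>R rot e) \<bullet> e = a" "(a *\<^sub>R e + b *\<^sub>R rot e) \<bullet> rot e = b"
    "w = (w \<bullet> e) *\<^sub>R e + (w \<bullet> rot e) *\<^sub>R rot e"
proof -
  obtain c s where e: "e = (c, s)" by fastforce
  obtain x y where w: "w = (x, y)" by fastforce
  have n: "c * c + s * s = 1"
    using assms by (simp add: e norm_prod_def power2_eq_square)
  have "(a * c - b * s) * c + (a * s + b * c) * s = a" "(a * c - b * s) * (- s) + (a * s + b * c) * c = b"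
    "(x * c + y * s) * c + (x * (- s) + y * c) * (- s) = x"
    "(x * c + y * s) * s + (x * (- s) + y * c) * c = y" using n by algebra+
  then show "(a *\<^sub>R e + b *\<^sub>R rot e) \<bullet> e = a" "(a *\<^sub>R e + b *\<^sub>R rot e) \<bullet> rot e = b"
    "w = (w \<bullet> e) *\<^sub>R e + (w \<bullet> rot e) *\<^sub>R rot e"
    unfolding e w rot_def by simp_all
qed

lemma frame_bij:
  assumes "norm e = 1"
  shows "bij (\<lambda>z. fst z *\<^sub>R e + snd z *\<^sub>R rot e)"
  by (rule bij_betw_byWitness[where f' = "\<lambda>w. (w \<bullet> e, w \<bullet> rot e)"])
    (use frame_coordinates[OF assms] in auto)

text \<open>\<open>T\<close> sends rays to rays and the half axes to the vertex directions; a
  rescaling of each ray then puts the unit vectors on the curve and fills the ball. Invariance of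
  domain supplies continuity of the inverse, so continuity and bijectivity suffice.\<close>

lemma oval_homeomorphism:
  assumes ov: "oval_with r g \<Lambda> e m0 m1 m2 m3" and r: "r > 0"
  obtains H H' :: "real \<times> real \<Rightarrow> real \<times> real" where "homeomorphism UNIV (ball 0 r) H H'"
    "H ` {z. norm z = 1} = curve r g"
    "H ` {(1, 0), (0, 1), (- 1, 0), (0, - 1)} = vertices r g"
proof -
  define T where "T z = fst (skew m0 m1 m2 m3 z) *\<^sub>R e + snd (skew m0 m1 m2 m3 z) *\<^sub>R rot e" for z
  have o: "smooth_on (- {0}) \<Lambda>" "\<And>p. p \<noteq> 0 \<Longrightarrow> \<Lambda> p > 0" "\<And>p. p \<noteq> 0 \<Longrightarrow> norm (\<Lambda> p *\<^sub>R p) \<le> r / 2"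
    "\<And>p c. p \<noteq> 0 \<Longrightarrow> c > 0 \<Longrightarrow> \<Lambda> (c *\<^sub>R p) = \<Lambda> p / c" "curve r g = {p. p \<noteq> 0 \<and> \<Lambda> p = 1}"
    "norm e = 1" "\<bar>m0\<bar> \<le> 1/8" "\<bar>m1\<bar> \<le> 1/8" "\<bar>m2\<bar> \<le> 1/8" "\<bar>m3\<bar> \<le> 1/8"
    "vertices r g = (\<lambda>w. \<Lambda> w *\<^sub>R w) `
       {e + m0 *\<^sub>R rot e, rot e - m1 *\<^sub>R e, - e - m2 *\<^sub>R rot e, - rot e + m3 *\<^sub>R e}"
    using ov unfolding oval_with_def by blast+
  have "bij T"
    using bij_comp[OF bij_skew[OF o(7-10)] frame_bij[OF o(6)]] by (simp add: T_def[abs_def] o_def)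
  then have injT: "T z = T z' \<Longrightarrow> z = z'" and surjT: "\<exists>z. T z = w" for z z' w
    by (blast dest: bij_is_inj injD, metis bij_is_surj surjD)
  have Tc: "T (c *\<^sub>R z) = c *\<^sub>R T z" if "c \<ge> 0" for c z
    using that by (simp add: T_def skew_scaleR scaleR_right_distrib)
  have T0: "T z = 0 \<longleftrightarrow> z = 0" for z
    using Tc[of 0 z] injT[of z 0] by auto
  have contT: "continuous_on UNIV T"
    unfolding T_def skew_def by (auto intro!: continuous_intros)
  \<comment> \<open>The central projection onto the curve, constant on rays.\<close>
  define q where "q w = \<Lambda> w *\<^sub>R w" for w :: "real \<times> real"
  \<comment> \<open>\<open>t \<mapsto> R t \<rho> * \<rho>\<close> maps \<open>[0, \<infinity>)\<close> increasingly onto \<open>[0, r)\<close> and \<open>1\<close> to \<open>\<rho>\<close>.\<close>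
  define R where "R t \<rho> = r * t / (\<rho> * t + r - \<rho>)" for t \<rho>
  define H where "H z = R (norm z) (norm (q (T z))) *\<^sub>R q (T z)" for z
  have q: "q w \<noteq> 0" "\<Lambda> (q w) = 1" "0 < norm (q w)" "norm (q w) \<le> r / 2" if "w \<noteq> 0" for w
    using o(2-4)[OF that] that by (auto simp: q_def)
  have qc: "q (c *\<^sub>R w) = q w" if "w \<noteq> 0" "c > 0" for c w
    using o(4)[OF that] that by (simp add: q_def)
  have den: "\<rho> * t + r - \<rho> > 0" if "0 \<le> t" "0 \<le> \<rho>" "\<rho> \<le> r / 2" for t \<rho>
  proof -
    have "\<rho> * t \<ge> 0" "\<rho> < r" using that r by auto
    then show ?thesis by linarith
  qed
  have Rpos: "R t \<rho> > 0" if "0 < t" "0 \<le> \<rho>" "\<rho> \<le> r / 2" for t \<rho>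
    using that r den[of t \<rho>] by (simp add: R_def)
  have R1: "R t \<rho> = 1 \<longleftrightarrow> t = 1" if "0 \<le> t" "0 \<le> \<rho>" "\<rho> \<le> r / 2" for t \<rho>
  proof -
    have "R t \<rho> = 1 \<longleftrightarrow> (r - \<rho>) * (t - 1) = 0"
      using den[OF that] by (auto simp: R_def field_simps)
    then show ?thesis using that r by auto
  qed
  have H0: "H 0 = 0" by (simp add: H_def R_def)
  have LH: "H z \<noteq> 0 \<and> \<Lambda> (H z) = 1 / R (norm z) (norm (q (T z)))" if "z \<noteq> 0" for z
  proof -
    have w: "T z \<noteq> 0" using T0 that by simp
    have "R (norm z) (norm (q (T z))) > 0" using q[OF w] that by (intro Rpos) auto
    then show ?thesis unfolding H_def using q[OF w] o(4)[OF q(1)[OF w]] by simp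
  qed
  have curveH: "H z \<in> curve r g \<longleftrightarrow> norm z = 1" for z
  proof (cases "z = 0")
    case False
    then have w: "T z \<noteq> 0" using T0 by simp
    show ?thesis unfolding o(5) using LH[OF False] R1[of "norm z" "norm (q (T z))"] q[OF w] by auto
  qed (simp add: H0 o(5))
  have surj: "\<exists>z. H z = p" if p: "p \<in> ball 0 r" for p
  proof (cases "p = 0")
    case True
    then show ?thesis using H0 by blast
  next
    case False
    obtain z0 where z0: "T z0 = p" using surjT by blast
    then have z00: "z0 \<noteq> 0" using T0[of z0] False by simp
    define \<rho> where "\<rho> = norm (q p)"
    have \<rho>: "0 < \<rho>" "\<rho> \<le> r / 2" using q[OF False] by (auto simp: \<rho>_def)
    \<comment> \<open>The solution of \<open>R t \<rho> = norm p / \<rho>\<close>, which is the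
      radial part of \<open>H z = p\<close>.\<close>
    define t where "t = norm p * (r - \<rho>) / (\<rho> * (r - norm p))"
    have pr: "norm p < r" using p by simp
    have t: "t > 0" using \<rho> pr False r by (auto simp: t_def)
    define z where "z = (t / norm z0) *\<^sub>R z0"
    have nz: "norm z = t" using t z00 by (simp add: z_def)
    have Tz: "T z = (t / norm z0) *\<^sub>R p" using Tc[of "t / norm z0" z0] t z0 by (simp add: z_def)
    have qz: "q (T z) = q p" using qc[OF False, of "t / norm z0"] Tz t z00 by simp
    have tt: "t * (\<rho> * (r - norm p)) = norm p * (r - \<rho>)" using \<rho> pr by (simp add: t_def)
    then have "r * t * \<rho> = norm p * (\<rho> * t + r - \<rho>)" by (simp add: algebra_simps)
    then have "R t \<rho> = norm p / \<rho>"
      using den[of t \<rho>] t \<rho> by (simp add: R_def field_simps)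
    then have "H z = (norm p / \<rho>) *\<^sub>R q p" by (simp add: H_def nz qz \<rho>_def)
    also have "\<dots> = p"
      using o(2)[OF False] False by (simp add: \<rho>_def q_def)
    finally show ?thesis by blast
  qed
  have Hball: "H z \<in> ball 0 r" for z
  proof (cases "z = 0")
    case False
    then have w: "T z \<noteq> 0" using T0 by simp
    define t \<rho> where "t = norm z" and "\<rho> = norm (q (T z))"
    have b: "0 < t" "0 < \<rho>" "\<rho> \<le> r / 2" using False q[OF w] by (auto simp: t_def \<rho>_def)
    have "R t \<rho> * \<rho> < r"
    proof -
      have "r * t * \<rho> < r * (\<rho> * t + r - \<rho>)" using b r by (simp add: algebra_simps)
      then show ?thesis using den[of t \<rho>] b by (simp add: R_def pos_divide_less_eq)
    qed
    then show ?thesis using Rpos[of t \<rho>] b by (simp add: H_def t_def \<rho>_def)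
  qed (simp add: H0 r)
  have inj: "inj H"
  proof (rule injI)
    fix z z' assume eq: "H z = H z'"
    show "z = z'"
    proof (cases "z = 0 \<or> z' = 0")
      case True
      then show ?thesis using LH eq H0 by metis
    next
      case False
      then have w: "T z \<noteq> 0" "T z' \<noteq> 0" and n: "norm z > 0" "norm z' > 0" using T0 by auto
      define c where "c = R (norm z) (norm (q (T z))) * \<Lambda> (T z)"
      define c' where "c' = R (norm z') (norm (q (T z'))) * \<Lambda> (T z')"
      have c: "c > 0" "c' > 0"
        using Rpos[of "norm z" "norm (q (T z))"] Rpos[of "norm z'" "norm (q (T z'))"] q(3,4)[OF w(1)]
          q(3,4)[OF w(2)] o(2)[OF w(1)] o(2)[OF w(2)] n by (simp_all add: c_def c'_def)
      have "c *\<^sub>R T z = c' *\<^sub>R T z'"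
        using eq unfolding H_def q_def c_def c'_def by simp
      then have "T (c *\<^sub>R z) = T (c' *\<^sub>R z')" using Tc c by simp
      then have zz: "c *\<^sub>R z = c' *\<^sub>R z'" by (rule injT)
      have qq: "q (T z) = q (T z')"
        using \<open>c *\<^sub>R T z = c' *\<^sub>R T z'\<close> qc[OF w(1) c(1)] qc[OF w(2) c(2)] by simp
      define \<rho> where "\<rho> = norm (q (T z))"
      have \<rho>: "0 < \<rho>" "\<rho> \<le> r / 2" "norm (q (T z')) = \<rho>" using q[OF w(1)] qq by (auto simp: \<rho>_def)
      \<comment> \<open>On a common ray the gauge of \<open>H\<close> recovers \<open>R\<close>, and
        \<open>R\<close> is injective in its first argument, so the two norms agree.\<close>
      have "R (norm z) \<rho> = R (norm z') \<rho>"
        using LH[of z] LH[of z'] eq False by (auto simp: \<rho> \<rho>_def[symmetric])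
      then have "r * norm z * (\<rho> * norm z' + r - \<rho>) = r * norm z' * (\<rho> * norm z + r - \<rho>)"
        using den[of "norm z" \<rho>] den[of "norm z'" \<rho>] \<rho> by (simp add: R_def frac_eq_eq)
      then have "r * (r - \<rho>) * (norm z - norm z') = 0" by (simp add: algebra_simps)
      then have nn: "norm z = norm z'" using \<rho> r by auto
      have "c * norm z = c' * norm z'" using arg_cong[OF zz, of norm] c by simp
      then have "c = c'" using nn n by simp
      then show ?thesis using zz c by simp
    qed
  qed
  have "isCont H z" for z
  proof (cases "z = 0")
    case True
    \<comment> \<open>\<open>q\<close> has no limit at the origin, but \<open>H\<close> is dominated
      by \<open>r * norm x\<close>: from \<open>\<rho> \<le> r / 2\<close> the denominator of
      \<open>R\<close> is at least \<open>\<rho>\<close>.\<close>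
    have "norm (H x) \<le> r * norm x" for x
    proof (cases "x = 0")
      case False
      then have w: "T x \<noteq> 0" using T0 by simp
      define t \<rho> where "t = norm x" and "\<rho> = norm (q (T x))"
      have b: "0 < t" "0 < \<rho>" "\<rho> \<le> r / 2" using False q[OF w] by (auto simp: t_def \<rho>_def)
      have "r * t * \<rho> \<le> r * t * (\<rho> * t + r - \<rho>)"
        using b r by (intro mult_left_mono) (auto intro: add_increasing)
      then have "R t \<rho> * \<rho> \<le> r * t"
        using den[of t \<rho>] b by (simp add: R_def pos_divide_le_eq)
      then show ?thesis using Rpos[of t \<rho>] b by (simp add: H_def t_def \<rho>_def)
    qed (simp add: H0)
    moreover have "((\<lambda>x. r * norm x) \<longlongrightarrow> r * norm (0 :: real \<times> real)) (at (0 :: real \<times> real))"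
      by (intro tendsto_intros)
    ultimately have "(H \<longlongrightarrow> 0) (at 0)"
      by (intro Lim_null_comparison[of H "\<lambda>x. r * norm x"]) auto
    then show ?thesis using True H0 by (simp add: isCont_def)
  next
    case False
    then have w: "T z \<noteq> 0" using T0 by simp
    have cT: "isCont T z" using contT by (simp add: continuous_on_eq_continuous_at del: split_paired_All)
    have "isCont \<Lambda> (T z)" using smooth_on_isCont[OF o(1)] w by simp
    then have "isCont (\<lambda>z. \<Lambda> (T z)) z" by (rule isCont_o2[OF cT])
    moreover have "norm (q (T z)) * norm z + r - norm (q (T z)) \<noteq> 0"
      using den[of "norm z" "norm (q (T z))"] q[OF w] by simp
    ultimately show ?thesis unfolding H_def R_def q_def using cT
      by (intro continuous_intros) (auto simp: q_def)
  qed
  then have contH: "continuous_on UNIV H" by (simp add: continuous_on_eq_continuous_at)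
  have img: "H ` UNIV = ball 0 r" using Hball surj by blast
  obtain H' where H': "homeomorphism UNIV (ball 0 r) H H'"
    using invariance_of_domain_homeomorphism[of UNIV H] contH inj img by auto
  have "H ` {z. norm z = 1} = curve r g"
  proof
    show "H ` {z. norm z = 1} \<subseteq> curve r g" using curveH by auto
    show "curve r g \<subseteq> H ` {z. norm z = 1}"
    proof
      fix p assume p: "p \<in> curve r g"
      then have "p \<in> ball 0 r" by (simp add: curve_def)
      from surj[OF this] p curveH show "p \<in> H ` {z. norm z = 1}" by auto
    qed
  qed
  moreover have "H ` {(1, 0), (0, 1), (- 1, 0), (0, - 1)} = vertices r g"
  proof -
    have H1: "H z = q (T z)" if "norm z = 1" for z
    proof -
      have "T z \<noteq> 0" using T0[of z] that by auto
      then show ?thesis unfolding H_def using R1[of 1 "norm (q (T z))"] q that by simp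
    qed
    have "T (1, 0) = e + m0 *\<^sub>R rot e" "T (0, 1) = rot e - m1 *\<^sub>R e"
      "T (- 1, 0) = - e - m2 *\<^sub>R rot e" "T (0, - 1) = - rot e + m3 *\<^sub>R e"
      by (simp_all add: T_def skew_def)
    then show ?thesis unfolding o(11)
      using H1[of "(1, 0)"] H1[of "(0, 1)"] H1[of "(- 1, 0)"] H1[of "(0, - 1)"] by (simp add: q_def)
  qed
  ultimately show ?thesis using that H' by blast
qed

text \<open>Two different maps are used. The homeomorphism of the ball passes through the common
  model and so matches the vertices. The diffeomorphism of the curves is the central projection,
  smooth because the gauges are smooth away from the origin; it need not carry vertices to
  vertices.\<close>

lemma oval_same_configuration:
  assumes g: "oval r g" and h: "oval r h" and r: "r > 0"
  shows "same_configuration r g h"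
proof -
  obtain \<Lambda> e m0 m1 m2 m3 where ov: "oval_with r g \<Lambda> e m0 m1 m2 m3" using g unfolding oval_def by blast
  obtain \<Lambda>' e' m0' m1' m2' m3' where ov': "oval_with r h \<Lambda>' e' m0' m1' m2' m3'"
    using h unfolding oval_def by blast
  obtain H Hi :: "real \<times> real \<Rightarrow> real \<times> real" where H: "homeomorphism UNIV (ball 0 r) H Hi" "H ` {z. norm z = 1} = curve r g"
    "H ` {(1, 0), (0, 1), (- 1, 0), (0, - 1)} = vertices r g"
    by (rule oval_homeomorphism[OF ov r])
  obtain K Ki :: "real \<times> real \<Rightarrow> real \<times> real" where K: "homeomorphism UNIV (ball 0 r) K Ki" "K ` {z. norm z = 1} = curve r h"
    "K ` {(1, 0), (0, 1), (- 1, 0), (0, - 1)} = vertices r h"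
    by (rule oval_homeomorphism[OF ov' r])
  have \<theta>: "homeomorphism (ball 0 r) (ball 0 r) (K \<circ> Hi) (H \<circ> Ki)"
    using homeomorphism_compose[OF homeomorphism_symD[OF H(1)] K(1)] .
  have im: "(K \<circ> Hi) ` H ` A = K ` A" for A
    unfolding image_image comp_def using homeomorphism_apply1[OF H(1)] by simp
  have \<theta>c: "(K \<circ> Hi) ` curve r g = curve r h" and \<theta>v: "(K \<circ> Hi) ` vertices r g = vertices r h"
    using im[of "{z. norm z = 1}"] im[of "{(1, 0), (0, 1), (- 1, 0), (0, - 1)}"]
    unfolding H(2,3) K(2,3) by this+
  have "bij_betw (K \<circ> Hi) (vertices r g) (vertices r h)"
  proof -
    have "vertices r g \<subseteq> ball 0 r" by (auto simp: vertices_def regular_points_def curve_def)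
    moreover have "inj_on (K \<circ> Hi) (ball 0 r)"
      using homeomorphism_apply1[OF \<theta>] by (rule inj_on_inverseI)
    ultimately show ?thesis using \<theta>v by (auto simp: bij_betw_def intro: inj_on_subset)
  qed
  then have ve: "vertices r g \<approx> vertices r h" unfolding eqpoll_def by blast
  have se: "(K \<circ> Hi) ` self_intersections (curve r g) = self_intersections (curve r h)"
  proof -
    have "curve r g \<subseteq> ball 0 r" by (auto simp: curve_def)
    from self_intersections_homeomorphism[OF \<theta> this] show ?thesis unfolding \<theta>c .
  qed
  have emp: "singular_points r g = {}" "singular_points r h = {}" "inflections r g = {}"
    "inflections r h = {}" using ov ov' by (auto simp: oval_with_def)
  have "diffeomorphic_sets (curve r g) (curve r h)"
  proof -
    have o: "smooth_on (- {0}) \<Lambda>" "\<And>p. p \<noteq> 0 \<Longrightarrow> \<Lambda> p > 0" 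
      "\<And>p c. p \<noteq> 0 \<Longrightarrow> c > 0 \<Longrightarrow> \<Lambda> (c *\<^sub>R p) = \<Lambda> p / c" "curve r g = {p. p \<noteq> 0 \<and> \<Lambda> p = 1}"
      using ov unfolding oval_with_def by blast+
    have o': "smooth_on (- {0}) \<Lambda>'" "\<And>p. p \<noteq> 0 \<Longrightarrow> \<Lambda>' p > 0" 
      "\<And>p c. p \<noteq> 0 \<Longrightarrow> c > 0 \<Longrightarrow> \<Lambda>' (c *\<^sub>R p) = \<Lambda>' p / c" "curve r h = {p. p \<noteq> 0 \<and> \<Lambda>' p = 1}"
      using ov' unfolding oval_with_def by blast+
    have op: "open (- {0 :: real \<times> real})" by (simp add: open_Compl)
    have sm: "smooth_on_subset X (\<lambda>p. L p *\<^sub>R p)" if "smooth_on (- {0}) L" "X \<subseteq> - {0}"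
      for X :: "(real \<times> real) set" and L
      unfolding smooth_on_subset_def
      using smooth_on_scaleR[OF op that(1) smooth_on_linear[OF bounded_linear_ident]] op that(2)
      by (intro ballI exI[of _ "- {0}"] exI[of _ "\<lambda>p. L p *\<^sub>R p"]) auto
    \<comment> \<open>On the curve \<open>\<Lambda> p = 1\<close>, so homogeneity gives
      \<open>\<Lambda> (\<Lambda>' p *\<^sub>R p) = 1 / \<Lambda>' p\<close> and the factors
      cancel.\<close>
    have inv: "\<Lambda> (\<Lambda>' p *\<^sub>R p) *\<^sub>R (\<Lambda>' p *\<^sub>R p) = p \<and> \<Lambda>' p *\<^sub>R p \<in> curve r h" if "p \<in> curve r g" for p
      using that o(3)[of p "\<Lambda>' p"] o'(2)[of p] o'(3)[of p "\<Lambda>' p"] by (auto simp: o(4) o'(4))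
    have inv': "\<Lambda>' (\<Lambda> p *\<^sub>R p) *\<^sub>R (\<Lambda> p *\<^sub>R p) = p \<and> \<Lambda> p *\<^sub>R p \<in> curve r g" if "p \<in> curve r h" for p
      using that o'(3)[of p "\<Lambda> p"] o(2)[of p] o(3)[of p "\<Lambda> p"] by (auto simp: o(4) o'(4))
    have "diffeomorphism_on (curve r g) (curve r h) (\<lambda>p. \<Lambda>' p *\<^sub>R p) (\<lambda>p. \<Lambda> p *\<^sub>R p)"
      unfolding diffeomorphism_on_def
    proof (intro conjI)
      show "smooth_on_subset (curve r g) (\<lambda>p. \<Lambda>' p *\<^sub>R p)" by (rule sm[OF o'(1)]) (auto simp: o(4))
      show "smooth_on_subset (curve r h) (\<lambda>p. \<Lambda> p *\<^sub>R p)" by (rule sm[OF o(1)]) (auto simp: o'(4))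
      show "(\<lambda>p. \<Lambda>' p *\<^sub>R p) ` curve r g = curve r h"
      proof
        show "(\<lambda>p. \<Lambda>' p *\<^sub>R p) ` curve r g \<subseteq> curve r h" using inv by blast
        show "curve r h \<subseteq> (\<lambda>p. \<Lambda>' p *\<^sub>R p) ` curve r g"
        proof
          fix p assume "p \<in> curve r h"
          from inv'[OF this] show "p \<in> (\<lambda>p. \<Lambda>' p *\<^sub>R p) ` curve r g"
            by (intro image_eqI[of p _ "\<Lambda> p *\<^sub>R p"]) (simp_all only: simp_thms)
        qed
      qed
      show "(\<lambda>p. \<Lambda> p *\<^sub>R p) ` curve r h = curve r g"
      proof
        show "(\<lambda>p. \<Lambda> p *\<^sub>R p) ` curve r h \<subseteq> curve r g" using inv' by blast
        show "curve r g \<subseteq> (\<lambda>p. \<Lambda> p *\<^sub>R p) ` curve r h"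
        proof
          fix p assume "p \<in> curve r g"
          from inv[OF this] show "p \<in> (\<lambda>p. \<Lambda> p *\<^sub>R p) ` curve r h"
            by (intro image_eqI[of p _ "\<Lambda>' p *\<^sub>R p"]) (simp_all only: simp_thms)
        qed
      qed
    qed (rule ballI, erule inv[THEN conjunct1], rule ballI, erule inv'[THEN conjunct1])
    then show ?thesis unfolding diffeomorphic_sets_def by blast
  qed
  then show ?thesis unfolding same_configuration_def emp
    using \<theta> \<theta>c \<theta>v se ve by (intro conjI exI[of _ "K \<circ> Hi"] exI[of _ "H \<circ> Ki"]) (simp_all only: eqpoll_refl image_empty)
qed

text \<open>The vertices are the images of the four unit vectors on the axes under an injective map,
  hence pairwise distinct.\<close>

lemma oval_card_vertices:
  assumes g: "oval r g" and r: "r > 0"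
  shows "card (vertices r g) = 4"
proof -
  obtain \<Lambda> e m0 m1 m2 m3 where ov: "oval_with r g \<Lambda> e m0 m1 m2 m3" using g unfolding oval_def by blast
  obtain H Hi :: "real \<times> real \<Rightarrow> real \<times> real" where H: "homeomorphism UNIV (ball 0 r) H Hi" 
    "H ` {(1, 0), (0, 1), (- 1, 0), (0, - 1)} = vertices r g"
    by (rule oval_homeomorphism[OF ov r])
  have "inj H" using homeomorphism_apply1[OF H(1)] by (rule inj_on_inverseI)
  then have "card (vertices r g) = card {(1, 0), (0, 1), (- 1, 0), (0, - 1) :: real \<times> real}"
    unfolding H(2)[symmetric] by (intro card_image inj_on_subset[OF \<open>inj H\<close>] subset_UNIV)
  then show ?thesis by simp
qed

section \<open>Inflections and vertices of a level set\<close>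

text \<open>
  The derivative along the rotated gradient of \<open>S\<close>, which is tangent to the level sets of \<open>S\<close>;
  \<open>e\<close>, \<open>rot e\<close> is an orthonormal frame.
\<close>

definition tangent_deriv ::
    "real \<times> real \<Rightarrow> (real \<times> real \<Rightarrow> real) \<Rightarrow> (real \<times> real \<Rightarrow> real) \<Rightarrow> real \<times> real \<Rightarrow> real" where
  "tangent_deriv e S \<phi> p =
     dirderiv e S p * dirderiv (rot e) \<phi> p - dirderiv (rot e) S p * dirderiv e \<phi> p"

text \<open>
  With \<open>N\<close> the norm of the gradient, the level curve of \<open>S\<close> through a point has there the curvature
  \<open>infl_fun / N^3\<close>, and the derivative of this quotient along the rotated gradient is \<open>vert_fun / N^5\<close>.
\<close>

definition infl_fun :: "real \<times> real \<Rightarrow> (real \<times> real \<Rightarrow> real) \<Rightarrow> real \<times> real \<Rightarrow> real" where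
  "infl_fun e S p =
     dirderiv e S p * tangent_deriv e S (dirderiv (rot e) S) p
     - dirderiv (rot e) S p * tangent_deriv e S (dirderiv e S) p"

definition vert_fun :: "real \<times> real \<Rightarrow> (real \<times> real \<Rightarrow> real) \<Rightarrow> real \<times> real \<Rightarrow> real" where
  "vert_fun e S p =
     ((dirderiv e S p)\<^sup>2 + (dirderiv (rot e) S p)\<^sup>2) * tangent_deriv e S (infl_fun e S) p
     - 3 * infl_fun e S p * (dirderiv e S p * tangent_deriv e S (dirderiv e S) p
         + dirderiv (rot e) S p * tangent_deriv e S (dirderiv (rot e) S) p)"

lemma smooth_on_tangent_deriv:
  "open U \<Longrightarrow> smooth_on U S \<Longrightarrow> smooth_on U \<phi> \<Longrightarrow> smooth_on U (tangent_deriv e S \<phi>)"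
  unfolding tangent_deriv_def[abs_def]
  by (intro smooth_on_diff smooth_on_mult smooth_on_dirderiv)

lemma smooth_on_infl_fun:
  "open U \<Longrightarrow> smooth_on U S \<Longrightarrow> smooth_on U (infl_fun e S)"
  unfolding infl_fun_def[abs_def]
  by (intro smooth_on_diff smooth_on_mult smooth_on_dirderiv smooth_on_tangent_deriv)

lemma smooth_on_power2:
  fixes f :: "'a::euclidean_space \<Rightarrow> real"
  shows "open U \<Longrightarrow> smooth_on U f \<Longrightarrow> smooth_on U (\<lambda>x. (f x)\<^sup>2)"
  by (simp add: power2_eq_square smooth_on_mult)

lemma smooth_on_vert_fun:
  "open U \<Longrightarrow> smooth_on U S \<Longrightarrow> smooth_on U (vert_fun e S)"
  unfolding vert_fun_def[abs_def]
  by (intro smooth_on_diff smooth_on_mult smooth_on_add smooth_on_power2 smooth_on_dirderiv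
      smooth_on_tangent_deriv smooth_on_infl_fun smooth_on_const)

lemma has_vector_derivative_lincomb:
  assumes "(f has_real_derivative f') (at t)" "(g has_real_derivative g') (at t)"
  shows "((\<lambda>t. f t *\<^sub>R a - g t *\<^sub>R b) has_vector_derivative f' *\<^sub>R a - g' *\<^sub>R b) (at t)"
  using has_vector_derivative_diff[OF has_vector_derivative_scaleR[OF assms(1) has_vector_derivative_const]
      has_vector_derivative_scaleR[OF assms(2) has_vector_derivative_const]] by simp

lemma tangent_deriv_eq_dirderiv:
  assumes "(\<phi> has_derivative \<phi>') (at p)"
  shows "tangent_deriv e S \<phi> p = \<phi>' (dirderiv e S p *\<^sub>R rot e - dirderiv (rot e) S p *\<^sub>R e)"
proof -
  note lin = has_derivative_linear[OF assms]
  show ?thesis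
    by (simp add: tangent_deriv_def dirderiv_eq[OF assms] linear_diff[OF lin] linear_scale[OF lin])
qed

section \<open>Curvature of a regular parametrisation of a level set\<close>

context
  fixes U :: "(real \<times> real) set" and S :: "real \<times> real \<Rightarrow> real" and e :: "real \<times> real"
    and \<gamma> :: "real \<Rightarrow> real \<times> real" and s d :: real
  assumes U: "open U" and S: "smooth_on U S" and e: "norm e = 1"
    and d: "d > 0" and \<gamma>: "smooth_on {-d<..<d} \<gamma>"
    and reg: "\<And>t. \<bar>t\<bar> < d \<Longrightarrow> vector_derivative \<gamma> (at t) \<noteq> 0"
    and in_U: "\<And>t. \<bar>t\<bar> < d \<Longrightarrow> \<gamma> t \<in> U"
    and level: "\<And>t. \<bar>t\<bar> < d \<Longrightarrow> S (\<gamma> t) = s"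
    and grad: "\<And>t. \<bar>t\<bar> < d \<Longrightarrow> (dirderiv e S (\<gamma> t))\<^sup>2 + (dirderiv (rot e) S (\<gamma> t))\<^sup>2 > 0"
begin

private definition "tv p = dirderiv e S p *\<^sub>R rot e - dirderiv (rot e) S p *\<^sub>R e"
private definition "sq p = (dirderiv e S p)\<^sup>2 + (dirderiv (rot e) S p)\<^sup>2"
private definition "v t = vector_derivative \<gamma> (at t)"
text \<open>The velocity as a multiple of the rotated gradient \<open>tv\<close>; since the frame is
  orthonormal, \<open>sq\<close> is the squared length of \<open>tv\<close>.\<close>

private definition "c t = (v t \<bullet> tv (\<gamma> t)) / sq (\<gamma> t)"

private lemma has_vd: "\<bar>t\<bar> < d \<Longrightarrow> (\<gamma> has_vector_derivative v t) (at t)"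
  using smooth_on_differentiable[OF \<gamma>, of t]
  by (simp add: abs_less_iff v_def vector_derivative_works[symmetric] differentiable_at_withinI)

private lemma v_eq: "\<bar>t\<bar> < d \<Longrightarrow> v t = dirderiv 1 \<gamma> t"
  using dirderiv_eq[OF has_vd[unfolded has_vector_derivative_def], of t 1] by simp

private lemma chain:
  assumes "smooth_on U \<phi>" "\<bar>t\<bar> < d"
  shows "((\<lambda>t. \<phi> (\<gamma> t)) has_real_derivative dirderiv (v t) \<phi> (\<gamma> t)) (at t)"
  using has_real_derivative_along[of \<phi> _ \<gamma> t, OF smooth_on_has_derivative[OF assms(1) in_U[OF assms(2)]]
      has_vd[OF assms(2)]] .

text \<open>\<open>S\<close> is constant along \<open>\<gamma>\<close>, so the velocity is
  orthogonal to the gradient and hence, in the plane, parallel to the rotated gradient.\<close>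

private lemma v_tangent: "\<bar>t\<bar> < d \<Longrightarrow> v t = c t *\<^sub>R tv (\<gamma> t)"
proof -
  assume t: "\<bar>t\<bar> < d"
  define a b where "a = v t \<bullet> e" and "b = v t \<bullet> rot e"
  define g1 g2 where "g1 = dirderiv e S (\<gamma> t)" and "g2 = dirderiv (rot e) S (\<gamma> t)"
  have q: "g1\<^sup>2 + g2\<^sup>2 > 0" using grad[OF t] by (simp add: g1_def g2_def)
  have vt: "v t = a *\<^sub>R e + b *\<^sub>R rot e" unfolding a_def b_def by (rule frame_coordinates(3)[OF e])
  have "((\<lambda>t. S (\<gamma> t)) has_real_derivative 0) (at t)"
  proof (rule DERIV_cong_ev[THEN iffD1, OF refl _ refl])
    have "\<forall>\<^sub>F t in nhds t. t \<in> {-d<..<d}" using t by (intro eventually_nhds_in_open) auto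
    then show "\<forall>\<^sub>F t in nhds t. s = S (\<gamma> t)" by eventually_elim (auto simp: level)
  qed auto
  then have "dirderiv (v t) S (\<gamma> t) = 0" using DERIV_unique[OF chain[OF S t]] by simp
  moreover have "dirderiv (v t) S (\<gamma> t) = a * g1 + b * g2"
  proof -
    note lin = has_derivative_linear[OF smooth_on_has_derivative[OF S in_U[OF t]]]
    show ?thesis unfolding vt by (simp add: linear_add[OF lin] linear_scale[OF lin] g1_def g2_def)
  qed
  ultimately have z: "a * g1 + b * g2 = 0" by simp
  have ip: "v t \<bullet> tv (\<gamma> t) = b * g1 - a * g2"
    by (simp add: tv_def inner_diff_right a_def b_def g1_def g2_def)
  have ct: "c t * (g1\<^sup>2 + g2\<^sup>2) = b * g1 - a * g2"
    using q by (simp add: c_def ip sq_def g1_def g2_def)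
  have "(c t * g1 - b) * (g1\<^sup>2 + g2\<^sup>2) = 0" "(c t * g2 + a) * (g1\<^sup>2 + g2\<^sup>2) = 0"
    using ct z by algebra+
  then have "b = c t * g1" "a = - (c t * g2)" using q by auto
  then show ?thesis unfolding vt tv_def by (simp add: g1_def g2_def scaleR_diff_right)
qed

private lemma c_nz: "\<bar>t\<bar> < d \<Longrightarrow> c t \<noteq> 0"
  using v_tangent[of t] reg[of t] by (auto simp: v_def)

private lemma tangent_eq:
  assumes "smooth_on U \<phi>" "\<bar>t\<bar> < d"
  shows "((\<lambda>t. \<phi> (\<gamma> t)) has_real_derivative c t * tangent_deriv e S \<phi> (\<gamma> t)) (at t)"
proof -
  note hd = smooth_on_has_derivative[OF assms(1) in_U[OF assms(2)]]
  have "dirderiv (v t) \<phi> (\<gamma> t) = c t * tangent_deriv e S \<phi> (\<gamma> t)"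
    unfolding tangent_deriv_eq_dirderiv[OF hd] v_tangent[OF assms(2)] tv_def
    by (simp add: linear_scale[OF has_derivative_linear[OF hd]])
  with chain[OF assms] show ?thesis by simp
qed

text \<open>The acceleration is computed by the product rule from \<open>c\<close> times the rotated
  gradient, which presupposes a differentiable \<open>c\<close>. Its continuity will also make the
  sign of \<open>c\<close> locally constant.\<close>

private lemma v_diff:
  assumes t: "\<bar>t\<bar> < d"
  shows "(v has_vector_derivative dirderiv 1 v t) (at t)" "\<exists>c'. (c has_real_derivative c') (at t)"
proof -
  have "smooth_on {-d<..<d} v"
    by (rule smooth_on_cong[OF _ _ smooth_on_dirderiv[OF \<gamma>, of 1]]) (simp_all add: v_eq abs_less_iff)
  then have hd: "(v has_derivative (\<lambda>h. dirderiv h v t)) (at t)"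
    by (rule smooth_on_has_derivative) (use t in auto)
  have "dirderiv h v t = h *\<^sub>R dirderiv 1 v t" for h
    using linear_scale[OF has_derivative_linear[OF hd], of h 1] by simp
  from this[symmetric] show v: "(v has_vector_derivative dirderiv 1 v t) (at t)"
    using hd by (simp only: has_vector_derivative_def)
  have g: "((\<lambda>t. dirderiv w S (\<gamma> t)) has_real_derivative dirderiv (v t) (dirderiv w S) (\<gamma> t)) (at t)" for w
    by (rule chain[OF smooth_on_dirderiv[OF S] t])
  have tvd: "((\<lambda>t. tv (\<gamma> t)) has_vector_derivative
      dirderiv (v t) (dirderiv e S) (\<gamma> t) *\<^sub>R rot e - dirderiv (v t) (dirderiv (rot e) S) (\<gamma> t) *\<^sub>R e) (at t)"
    unfolding tv_def
    by (rule has_vector_derivative_lincomb[OF g g])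
  have "((\<lambda>t. v t \<bullet> tv (\<gamma> t)) has_vector_derivative
      v t \<bullet> (dirderiv (v t) (dirderiv e S) (\<gamma> t) *\<^sub>R rot e - dirderiv (v t) (dirderiv (rot e) S) (\<gamma> t) *\<^sub>R e)
      + dirderiv 1 v t \<bullet> tv (\<gamma> t)) (at t)"
    by (rule bounded_bilinear.has_vector_derivative[OF bounded_bilinear_inner v tvd])
  then have n: "((\<lambda>t. v t \<bullet> tv (\<gamma> t)) has_real_derivative
      v t \<bullet> (dirderiv (v t) (dirderiv e S) (\<gamma> t) *\<^sub>R rot e - dirderiv (v t) (dirderiv (rot e) S) (\<gamma> t) *\<^sub>R e)
      + dirderiv 1 v t \<bullet> tv (\<gamma> t)) (at t)"
    by (simp add: has_real_derivative_iff_has_vector_derivative)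
  have "smooth_on U sq" unfolding sq_def
    by (intro smooth_on_add smooth_on_power2 smooth_on_dirderiv S U)
  from DERIV_divide[OF n chain[OF this t]] grad[OF t]
  show "\<exists>c'. (c has_real_derivative c') (at t)"
    unfolding c_def sq_def by fastforce
qed

text \<open>In the cross product of velocity and acceleration the term with the derivative of
  \<open>c\<close> is parallel to the velocity and drops out. What remains is cubic in
  \<open>c\<close>, like the denominator, so the parametrisation is felt only through
  \<open>sgn (c t)\<close>.\<close>

private lemma curvature_eq:
  assumes t: "\<bar>t\<bar> < d"
  shows "curvature \<gamma> t = sgn (c t) * (infl_fun e S (\<gamma> t) / sqrt (sq (\<gamma> t)) ^ 3)"
proof -
  define u w u1 w1 where "u = dirderiv e S (\<gamma> t)" and "w = dirderiv (rot e) S (\<gamma> t)"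
    and "u1 = tangent_deriv e S (dirderiv e S) (\<gamma> t)"
    and "w1 = tangent_deriv e S (dirderiv (rot e) S) (\<gamma> t)"
  obtain c' where c': "(c has_real_derivative c') (at t)" using v_diff(2)[OF t] by blast
  have g: "((\<lambda>t. dirderiv z S (\<gamma> t)) has_real_derivative c t * tangent_deriv e S (dirderiv z S) (\<gamma> t)) (at t)" for z
    by (rule tangent_eq[OF smooth_on_dirderiv[OF S] t])
  have tvd: "((\<lambda>t. tv (\<gamma> t)) has_vector_derivative (c t * u1) *\<^sub>R rot e - (c t * w1) *\<^sub>R e) (at t)"
    unfolding tv_def u1_def w1_def
    by (rule has_vector_derivative_lincomb[OF g g])
  have ctv: "((\<lambda>t. c t *\<^sub>R tv (\<gamma> t)) has_vector_derivative
      c t *\<^sub>R ((c t * u1) *\<^sub>R rot e - (c t * w1) *\<^sub>R e) + c' *\<^sub>R tv (\<gamma> t)) (at t)"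
    using has_vector_derivative_scaleR[OF c' tvd] by simp
  have "(v has_vector_derivative
      c t *\<^sub>R ((c t * u1) *\<^sub>R rot e - (c t * w1) *\<^sub>R e) + c' *\<^sub>R tv (\<gamma> t)) (at t)"
    by (rule has_vector_derivative_transform_within_open[OF ctv, of "{-d<..<d}"])
      (use t v_tangent in auto)
  then have a: "vector_derivative v (at t) =
      c t *\<^sub>R ((c t * u1) *\<^sub>R rot e - (c t * w1) *\<^sub>R e) + c' *\<^sub>R tv (\<gamma> t)"
    by (rule vector_derivative_at)
  obtain e1 e2 where e12: "e = (e1, e2)" by fastforce
  have n: "e1 * e1 + e2 * e2 = 1" using e by (simp add: e12 norm_prod_def power2_eq_square)
  have vt: "v t = c t *\<^sub>R (u *\<^sub>R rot e - w *\<^sub>R e)" using v_tangent[OF t] by (simp add: tv_def u_def w_def)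
  have num: "fst (v t) * snd (vector_derivative v (at t)) - snd (v t) * fst (vector_derivative v (at t))
      = c t ^ 3 * infl_fun e S (\<gamma> t)"
    unfolding a vt infl_fun_def tv_def u_def[symmetric] w_def[symmetric] u1_def[symmetric] w1_def[symmetric]
    unfolding e12 rot_def using n by simp algebra
  have "(norm (v t))\<^sup>2 = (c t)\<^sup>2 * (u\<^sup>2 + w\<^sup>2)"
    unfolding vt e12 rot_def power2_norm_eq_inner inner_prod_def using n by simp algebra
  then have nv: "norm (v t) = \<bar>c t\<bar> * sqrt (u\<^sup>2 + w\<^sup>2)"
    by (metis norm_ge_zero real_sqrt_abs real_sqrt_mult abs_of_nonneg)
  have "curvature \<gamma> t = c t ^ 3 * infl_fun e S (\<gamma> t) / (\<bar>c t\<bar> * sqrt (u\<^sup>2 + w\<^sup>2)) ^ 3"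
    unfolding curvature_def Let_def v_def[abs_def, symmetric] v_def[symmetric] num nv ..
  also have "\<dots> = sgn (c t) * (infl_fun e S (\<gamma> t) / sqrt (u\<^sup>2 + w\<^sup>2) ^ 3)"
    using c_nz[OF t] by (cases "c t > 0") (auto simp: power_mult_distrib sgn_if power3_eq_cube)
  finally show ?thesis by (simp add: sq_def u_def w_def)
qed

text \<open>A single \<open>k\<close> governs the velocity and the derivatives of all functions
  along \<open>\<gamma>\<close>, so its sign can be read off from the velocity.\<close>

lemma level_velocity:
  assumes "\<bar>t\<bar> < d"
  obtains k where "vector_derivative \<gamma> (at t) =
      k *\<^sub>R (dirderiv e S (\<gamma> t) *\<^sub>R rot e - dirderiv (rot e) S (\<gamma> t) *\<^sub>R e)"
    "\<And>\<phi>. smooth_on U \<phi> \<Longrightarrow>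
      ((\<lambda>t. \<phi> (\<gamma> t)) has_real_derivative k * tangent_deriv e S \<phi> (\<gamma> t)) (at t)"
  using v_tangent[OF assms] tangent_eq[OF _ assms] that[of "c t"] by (simp add: v_def tv_def)

lemma curvature_zero_iff: "curvature \<gamma> 0 = 0 \<longleftrightarrow> infl_fun e S (\<gamma> 0) = 0"
proof -
  have "\<bar>0::real\<bar> < d" using d by simp
  then have "c 0 \<noteq> 0" "sq (\<gamma> 0) > 0"
    "curvature \<gamma> 0 = sgn (c 0) * (infl_fun e S (\<gamma> 0) / sqrt (sq (\<gamma> 0)) ^ 3)"
    using c_nz grad curvature_eq by (auto simp: sq_def)
  then show ?thesis by (simp add: sgn_zero_iff)
qed

text \<open>Near 0 the sign of \<open>c\<close> is constant, so up to that sign the curvature is the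
  quotient \<open>K\<close>. By the chain rule the derivative of \<open>K\<close> is a nonzero
  multiple of \<open>vert_fun\<close>.\<close>

lemma curvature_stationary_iff:
  "(curvature \<gamma> has_real_derivative 0) (at 0) \<longleftrightarrow> vert_fun e S (\<gamma> 0) = 0"
proof -
  define K where "K t = infl_fun e S (\<gamma> t) / sqrt (sq (\<gamma> t)) ^ 3" for t
  have d0: "\<bar>0::real\<bar> < d" using d by simp
  have q: "sq (\<gamma> 0) > 0" using grad[OF d0] by (simp add: sq_def)
  define u w u1 w1 where "u = dirderiv e S (\<gamma> 0)" and "w = dirderiv (rot e) S (\<gamma> 0)"
    and "u1 = tangent_deriv e S (dirderiv e S) (\<gamma> 0)"
    and "w1 = tangent_deriv e S (dirderiv (rot e) S) (\<gamma> 0)"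
  have g: "((\<lambda>t. dirderiv z S (\<gamma> t)) has_real_derivative c 0 * tangent_deriv e S (dirderiv z S) (\<gamma> 0)) (at 0)" for z
    by (rule tangent_eq[OF smooth_on_dirderiv[OF S] d0])
  have h: "((\<lambda>t. infl_fun e S (\<gamma> t)) has_real_derivative c 0 * tangent_deriv e S (infl_fun e S) (\<gamma> 0)) (at 0)"
    by (rule tangent_eq[OF smooth_on_infl_fun[OF U S] d0])
  define n where "n = sqrt (sq (\<gamma> 0))"
  have n: "n > 0" "n\<^sup>2 = u\<^sup>2 + w\<^sup>2" using q by (auto simp: n_def sq_def u_def w_def)
  have sqd: "((\<lambda>t. sq (\<gamma> t)) has_real_derivative 2 * c 0 * (u * u1 + w * w1)) (at 0)"
    unfolding sq_def by (auto intro!: derivative_eq_intros g simp: u_def w_def u1_def w1_def algebra_simps)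
  have sd: "((\<lambda>t. sqrt (sq (\<gamma> t))) has_real_derivative c 0 * (u * u1 + w * w1) / n) (at 0)"
    using DERIV_chain2[OF DERIV_real_sqrt[OF q] sqd]
    by (rule DERIV_cong) (use n(1) in \<open>simp add: n_def[symmetric] field_simps\<close>)
  have s3: "((\<lambda>t. sqrt (sq (\<gamma> t)) ^ 3) has_real_derivative 3 * n\<^sup>2 * (c 0 * (u * u1 + w * w1) / n)) (at 0)"
    using DERIV_power[OF sd, of 3] by (rule DERIV_cong) (simp add: n_def numeral_eq_Suc)
  have Kd: "(K has_real_derivative c 0 * vert_fun e S (\<gamma> 0) / n ^ 5) (at 0)"
    unfolding K_def[abs_def]
  proof (rule DERIV_cong[OF DERIV_divide[OF h s3]])
    show "sqrt (sq (\<gamma> 0)) ^ 3 \<noteq> 0" using q by simp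
    have "vert_fun e S (\<gamma> 0) = n\<^sup>2 * tangent_deriv e S (infl_fun e S) (\<gamma> 0)
        - 3 * infl_fun e S (\<gamma> 0) * (u * u1 + w * w1)"
      by (simp add: vert_fun_def n u_def w_def u1_def w1_def)
    moreover have "3 * n\<^sup>2 * (c 0 * (u * u1 + w * w1) / n) = 3 * (n * (c 0 * (u * u1 + w * w1)))"
      using n(1) by (simp add: power2_eq_square)
    ultimately have "c 0 * tangent_deriv e S (infl_fun e S) (\<gamma> 0) * n ^ 3 -
        infl_fun e S (\<gamma> 0) * (3 * n\<^sup>2 * (c 0 * (u * u1 + w * w1) / n)) = n * (c 0 * vert_fun e S (\<gamma> 0))"
      by (simp only:) (simp (no_asm) add: power2_eq_square power3_eq_cube algebra_simps)
    moreover have "n ^ 3 * n ^ 3 = n * n ^ 5" by (simp add: eval_nat_numeral)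
    ultimately show "(c 0 * tangent_deriv e S (infl_fun e S) (\<gamma> 0) * sqrt (sq (\<gamma> 0)) ^ 3 -
        infl_fun e S (\<gamma> 0) * (3 * n\<^sup>2 * (c 0 * (u * u1 + w * w1) / n))) /
        (sqrt (sq (\<gamma> 0)) ^ 3 * sqrt (sq (\<gamma> 0)) ^ 3) = c 0 * vert_fun e S (\<gamma> 0) / n ^ 5"
      unfolding n_def[symmetric] using n(1) by simp
  qed
  have sgnc: "\<forall>\<^sub>F t in nhds 0. sgn (c t) = sgn (c 0)"
  proof -
    have "isCont c 0" using v_diff(2)[OF d0] DERIV_isCont by blast
    then have lim: "(c \<longlongrightarrow> c 0) (nhds 0)" by (simp add: isCont_def tendsto_at_iff_tendsto_nhds)
    consider "c 0 > 0" | "c 0 < 0" using c_nz[OF d0] by linarith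
    then show ?thesis
    proof cases
      case 1
      from order_tendstoD(1)[OF lim 1] show ?thesis by eventually_elim (use 1 in simp)
    next
      case 2
      from order_tendstoD(2)[OF lim 2] show ?thesis by eventually_elim (use 2 in simp)
    qed
  qed
  have "\<forall>\<^sub>F t in nhds 0. t \<in> {-d<..<d}" using d by (intro eventually_nhds_in_open) auto
  with sgnc have ev: "\<forall>\<^sub>F t in nhds 0. sgn (c 0) * K t = curvature \<gamma> t"
    by eventually_elim (use curvature_eq in \<open>auto simp: K_def\<close>)
  have kd: "(curvature \<gamma> has_real_derivative sgn (c 0) * (c 0 * vert_fun e S (\<gamma> 0) / n ^ 5)) (at 0)"
    using DERIV_cong_ev[OF refl ev refl] DERIV_cmult[OF Kd, of "sgn (c 0)"] by simp
  show ?thesis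
  proof
    assume "(curvature \<gamma> has_real_derivative 0) (at 0)"
    from DERIV_unique[OF this kd] show "vert_fun e S (\<gamma> 0) = 0"
      using c_nz[OF d0] n by (auto simp: sgn_zero_iff)
  next
    assume "vert_fun e S (\<gamma> 0) = 0"
    with kd show "(curvature \<gamma> has_real_derivative 0) (at 0)" by simp
  qed
qed

end

section \<open>Asymptotics at a nondegenerate critical point\<close>

text \<open>\<open>q\<close> stands for the leading term of order \<open>n\<close>. The bound on
  \<open>q\<close> lets leading terms be multiplied; the choice \<open>q = 0\<close> says that
  \<open>\<phi>\<close> is of smaller order.\<close>

definition approx :: "nat \<Rightarrow> ('a::real_normed_vector \<Rightarrow> real) \<Rightarrow> ('a \<Rightarrow> real) \<Rightarrow> bool" where
  "approx n \<phi> q \<longleftrightarrow> (\<lambda>p. \<phi> p - q p) \<in> o[at 0](\<lambda>p. norm p ^ n) \<and> q \<in> O[at 0](\<lambda>p. norm p ^ n)"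

lemma approx_add: "approx n \<phi> q \<Longrightarrow> approx n \<psi> r \<Longrightarrow> approx n (\<lambda>p. \<phi> p + \<psi> p) (\<lambda>p. q p + r p)"
  unfolding approx_def using sum_in_smallo(1)[of "\<lambda>p. \<phi> p - q p" "at 0" _ "\<lambda>p. \<psi> p - r p"]
  by (auto intro: sum_in_bigo simp: algebra_simps)

lemma approx_diff: "approx n \<phi> q \<Longrightarrow> approx n \<psi> r \<Longrightarrow> approx n (\<lambda>p. \<phi> p - \<psi> p) (\<lambda>p. q p - r p)"
  unfolding approx_def using sum_in_smallo(2)[of "\<lambda>p. \<phi> p - q p" "at 0" _ "\<lambda>p. \<psi> p - r p"]
  by (auto intro: sum_in_bigo simp: algebra_simps)

lemma approx_mult:
  assumes "approx n \<phi> q" "approx m \<psi> r"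
  shows "approx (n + m) (\<lambda>p. \<phi> p * \<psi> p) (\<lambda>p. q p * r p)"
proof -
  let ?n = "\<lambda>n p :: 'a. norm p ^ n"
  have a: "(\<lambda>p. \<phi> p - q p) \<in> o[at 0](?n n)" "q \<in> O[at 0](?n n)"
    "(\<lambda>p. \<psi> p - r p) \<in> o[at 0](?n m)" "r \<in> O[at 0](?n m)"
    using assms by (auto simp: approx_def)
  have "(\<lambda>p. (\<phi> p - q p) * (\<psi> p - r p) + (\<phi> p - q p) * r p + q p * (\<psi> p - r p))
      \<in> o[at 0](\<lambda>p. ?n n p * ?n m p)"
    by (intro sum_in_smallo landau_o.small_mult landau_o.small_big_mult landau_o.big_small_mult a)
  moreover have "(\<lambda>p. q p * r p) \<in> O[at 0](\<lambda>p. ?n n p * ?n m p)"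
    by (intro landau_o.big_mult a)
  ultimately show ?thesis by (simp add: approx_def power_add algebra_simps)
qed

lemma approx_const: "approx 0 (\<lambda>p. c) (\<lambda>p. c)"
  by (simp add: approx_def)

lemma approx_derivative:
  assumes d: "(\<phi> has_derivative \<phi>') (at 0)" and "\<phi> 0 = 0"
  shows "approx 1 \<phi> \<phi>'"
proof -
  obtain B where B: "\<And>p. \<bar>\<phi>' p\<bar> \<le> norm p * B"
    using bounded_linear.bounded[OF has_derivative_bounded_linear[OF d]] by (metis real_norm_def)
  have "\<phi>' \<in> O[at 0](\<lambda>p. norm p)"
    by (intro bigoI[of _ B] always_eventually) (use B in \<open>simp add: mult.commute\<close>)
  moreover have "((\<lambda>h. \<bar>\<phi> h - \<phi>' h\<bar> / norm h) \<longlongrightarrow> 0) (at 0)"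
    using d assms(2) by (simp add: has_derivative_at)
  then have "((\<lambda>h. (\<phi> h - \<phi>' h) / norm h) \<longlongrightarrow> 0) (at 0)"
    by (subst tendsto_rabs_zero_iff[symmetric]) (simp add: abs_divide)
  then have "(\<lambda>h. \<phi> h - \<phi>' h) \<in> o[at 0](\<lambda>p. norm p)"
    by (rule smalloI_tendsto) (simp add: eventually_at_filter)
  ultimately show ?thesis by (simp add: approx_def)
qed

text \<open>The implication stays inside \<open>eventually\<close>, so that one punctured
  neighbourhood serves a whole sector on which the leading term is bounded below.\<close>

lemma approx_eventually_pos:
  assumes "approx n \<phi> q" "c > 0"
  shows "\<forall>\<^sub>F p in at 0. c * norm p ^ n \<le> q p \<longrightarrow> \<phi> p > 0"
proof -
  have "\<forall>\<^sub>F p in at 0. norm (\<phi> p - q p) \<le> c / 2 * norm (norm p ^ n)"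
    using assms by (intro landau_o.smallD) (auto simp: approx_def)
  moreover have "\<forall>\<^sub>F p in at (0::'a). p \<noteq> 0" by (simp add: eventually_at_filter)
  ultimately show ?thesis
  proof eventually_elim
    case (elim p)
    have "c * norm p ^ n > 0" using assms(2) elim(2) by simp
    moreover have "\<bar>\<phi> p - q p\<bar> \<le> c * norm p ^ n / 2" using elim(1) by simp
    ultimately show ?case by argo
  qed
qed

lemma approx_cmult: "approx n \<phi> q \<Longrightarrow> approx n (\<lambda>p. c * \<phi> p) (\<lambda>p. c * q p)"
  using approx_mult[OF approx_const, of n \<phi> q c] by simp

section \<open>Leading terms of the curvature expressions\<close>

context
  fixes U :: "(real \<times> real) set" and S :: "real \<times> real \<Rightarrow> real" and e :: "real \<times> real" and a b :: real
  assumes U: "open U" "0 \<in> U" and S: "smooth_on U S" and e: "norm e = 1"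
    and crit: "dirderiv e S 0 = 0" "dirderiv (rot e) S 0 = 0"
    and hess: "dirderiv e (dirderiv e S) 0 = a" "dirderiv (rot e) (dirderiv e S) 0 = 0"
      "dirderiv e (dirderiv (rot e) S) 0 = 0" "dirderiv (rot e) (dirderiv (rot e) S) 0 = b"
begin

private abbreviation "D \<equiv> tangent_deriv e S"
private definition "lin \<phi> \<alpha> \<beta> \<longleftrightarrow> smooth_on U \<phi> \<and> \<phi> 0 = 0 \<and> dirderiv e \<phi> 0 = \<alpha> \<and> dirderiv (rot e) \<phi> 0 = \<beta>"

private lemma dirderiv_mult:
  fixes \<phi> \<psi> :: "real \<times> real \<Rightarrow> real"
  assumes "smooth_on U \<phi>" "smooth_on U \<psi>" "p \<in> U"
  shows "dirderiv v (\<lambda>p. \<phi> p * \<psi> p) p = \<phi> p * dirderiv v \<psi> p + dirderiv v \<phi> p * \<psi> p"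
  by (rule dirderiv_eq[OF has_derivative_mult[OF smooth_on_has_derivative[OF assms(1,3)]
        smooth_on_has_derivative[OF assms(2,3)]]])

private lemma dirderiv_diff:
  fixes \<phi> \<psi> :: "real \<times> real \<Rightarrow> real"
  assumes "smooth_on U \<phi>" "smooth_on U \<psi>" "p \<in> U"
  shows "dirderiv v (\<lambda>p. \<phi> p - \<psi> p) p = dirderiv v \<phi> p - dirderiv v \<psi> p"
  by (rule dirderiv_eq[OF has_derivative_diff[OF smooth_on_has_derivative[OF assms(1,3)]
        smooth_on_has_derivative[OF assms(2,3)]]])

private lemma dirderiv_add:
  fixes \<phi> \<psi> :: "real \<times> real \<Rightarrow> real"
  assumes "smooth_on U \<phi>" "smooth_on U \<psi>" "p \<in> U"
  shows "dirderiv v (\<lambda>p. \<phi> p + \<psi> p) p = dirderiv v \<phi> p + dirderiv v \<psi> p"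
  by (rule dirderiv_eq[OF has_derivative_add[OF smooth_on_has_derivative[OF assms(1,3)]
        smooth_on_has_derivative[OF assms(2,3)]]])

private lemma D_mult:
  assumes "smooth_on U \<phi>" "smooth_on U \<psi>" "p \<in> U"
  shows "D (\<lambda>p. \<phi> p * \<psi> p) p = D \<phi> p * \<psi> p + \<phi> p * D \<psi> p"
  by (simp add: tangent_deriv_def dirderiv_mult[OF assms] algebra_simps)

private lemma D_diff:
  assumes "smooth_on U \<phi>" "smooth_on U \<psi>" "p \<in> U"
  shows "D (\<lambda>p. \<phi> p - \<psi> p) p = D \<phi> p - D \<psi> p"
  by (simp add: tangent_deriv_def dirderiv_diff[OF assms] algebra_simps)

private lemma D_add:
  assumes "smooth_on U \<phi>" "smooth_on U \<psi>" "p \<in> U"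
  shows "D (\<lambda>p. \<phi> p + \<psi> p) p = D \<phi> p + D \<psi> p"
  by (simp add: tangent_deriv_def dirderiv_add[OF assms] algebra_simps)

private lemma D_cong:
  assumes "smooth_on U \<phi>" "\<And>p. p \<in> U \<Longrightarrow> \<phi> p = \<psi> p" "p \<in> U"
  shows "D \<psi> p = D \<phi> p"
proof -
  have "(\<psi> has_derivative (\<lambda>v. dirderiv v \<phi> p)) (at p)"
    by (rule has_derivative_transform_within_open[OF smooth_on_has_derivative[OF assms(1,3)] U(1) assms(3,2)])
  then show ?thesis by (simp add: tangent_deriv_def dirderiv_eq)
qed

text \<open>Each term of \<open>D \<phi>\<close> is a first derivative of \<open>S\<close>, which
  vanishes at the origin, times one of \<open>\<phi>\<close>. Differentiating there leaves the
  Hessian of \<open>S\<close> times the gradient of \<open>\<phi>\<close>; no second derivative of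
  \<open>\<phi>\<close> survives.\<close>

private lemma lin_D:
  assumes "lin \<phi> \<alpha> \<beta>"
  shows "lin (D \<phi>) (a * \<beta>) (- b * \<alpha>)"
proof -
  have \<phi>: "smooth_on U \<phi>" "\<phi> 0 = 0" "dirderiv e \<phi> 0 = \<alpha>" "dirderiv (rot e) \<phi> 0 = \<beta>"
    using assms by (auto simp: lin_def)
  note sm = smooth_on_dirderiv[OF S] smooth_on_dirderiv[OF \<phi>(1)]
  have "dirderiv v (D \<phi>) 0 = dirderiv v (dirderiv e S) 0 * \<beta> - dirderiv v (dirderiv (rot e) S) 0 * \<alpha>" for v
    unfolding tangent_deriv_def[abs_def]
    by (simp add: dirderiv_diff[OF smooth_on_mult[OF U(1) sm] smooth_on_mult[OF U(1) sm] U(2)]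
        dirderiv_mult[OF sm U(2)] crit \<phi>)
  then show ?thesis
    unfolding lin_def using smooth_on_tangent_deriv[OF U(1) S \<phi>(1)]
    by (simp add: hess) (simp add: tangent_deriv_def crit)
qed

private lemma lin_approx:
  assumes "lin \<phi> \<alpha> \<beta>"
  shows "approx 1 \<phi> (\<lambda>p. \<alpha> * (p \<bullet> e) + \<beta> * (p \<bullet> rot e))"
proof -
  have \<phi>: "smooth_on U \<phi>" "\<phi> 0 = 0" "dirderiv e \<phi> 0 = \<alpha>" "dirderiv (rot e) \<phi> 0 = \<beta>"
    using assms by (auto simp: lin_def)
  note hd = smooth_on_has_derivative[OF \<phi>(1) U(2)]
  note lin = has_derivative_linear[OF hd]
  have "dirderiv p \<phi> 0 = \<alpha> * (p \<bullet> e) + \<beta> * (p \<bullet> rot e)" for p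
  proof -
    have "dirderiv ((p \<bullet> e) *\<^sub>R e + (p \<bullet> rot e) *\<^sub>R rot e) \<phi> 0 = \<alpha> * (p \<bullet> e) + \<beta> * (p \<bullet> rot e)"
      by (simp add: linear_add[OF lin] linear_scale[OF lin] \<phi>)
    then show ?thesis by (simp only: frame_coordinates(3)[OF e, symmetric])
  qed
  with approx_derivative[OF hd \<phi>(2)] show ?thesis by simp
qed

text \<open>
  If \<open>\<phi>\<close> has the linear part \<open>(\<alpha>, \<beta>)\<close> in the frame, then \<open>D \<phi>\<close> has the linear part \<open>(a \<beta>, - b \<alpha>)\<close>; so the
  leading terms of all iterated tangential derivatives of the gradient are read off from those of \<open>u0\<close> and \<open>w0\<close>.
\<close>

private definition "u0 = dirderiv e S"
private definition "w0 = dirderiv (rot e) S"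
private definition "u1 = D u0"
private definition "w1 = D w0"
private definition "u2 = D u1"
private definition "w2 = D w1"
private definition "u3 = D u2"
private definition "w3 = D w2"

text \<open>Two applications of \<open>D\<close> multiply a linear part by \<open>- a * b\<close>,
  which explains the pattern.\<close>

private lemma lins:
  "lin u0 a 0" "lin u1 0 (- (a * b))" "lin u2 (- (a * (a * b))) 0" "lin u3 0 (a * (a * (b * b)))"
  "lin w0 0 b" "lin w1 (a * b) 0" "lin w2 0 (- (a * (b * b)))" "lin w3 (- (a * (a * (b * b)))) 0"
proof -
  show u0: "lin u0 a 0" and w0: "lin w0 0 b"
    by (simp_all add: lin_def u0_def w0_def hess crit smooth_on_dirderiv[OF S])
  show u1: "lin u1 0 (- (a * b))" using lin_D[OF u0] by (simp add: u1_def mult_ac)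
  show w1: "lin w1 (a * b) 0" using lin_D[OF w0] by (simp add: w1_def mult_ac)
  show u2: "lin u2 (- (a * (a * b))) 0" using lin_D[OF u1] by (simp add: u2_def mult_ac)
  show w2: "lin w2 0 (- (a * (b * b)))" using lin_D[OF w1] by (simp add: w2_def mult_ac)
  show "lin u3 0 (a * (a * (b * b)))" using lin_D[OF u2] by (simp add: u3_def mult_ac)
  show "lin w3 (- (a * (a * (b * b)))) 0" using lin_D[OF w2] by (simp add: w3_def mult_ac)
qed

private lemma sms: "smooth_on U u0" "smooth_on U u1" "smooth_on U u2" "smooth_on U u3"
  "smooth_on U w0" "smooth_on U w1" "smooth_on U w2" "smooth_on U w3"
  using lins by (simp_all add: lin_def)

private lemma infl_fun_eq: "infl_fun e S = (\<lambda>p. u0 p * w1 p - w0 p * u1 p)"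
  by (simp add: infl_fun_def[abs_def] u0_def w0_def u1_def w1_def)

text \<open>Under \<open>D\<close> the functions \<open>h\<close>, \<open>h1\<close>,
  \<open>k\<close> become \<open>h1\<close>, \<open>h2\<close>, \<open>k1\<close>, and
  \<open>n\<close> becomes \<open>2 * k\<close>. As polynomials in the iterated derivatives they
  have leading terms that follow by multiplication; in \<open>h1\<close> the two products of
  \<open>u1\<close> and \<open>w1\<close> have cancelled.\<close>

private definition "h = infl_fun e S"
private definition "h1 p = u0 p * w2 p - w0 p * u2 p" for p
private definition "h2 p = u1 p * w2 p + u0 p * w3 p - (w1 p * u2 p + w0 p * u3 p)" for p
private definition "k p = u0 p * u1 p + w0 p * w1 p" for p
private definition "k1 p = u1 p * u1 p + u0 p * u2 p + (w1 p * w1 p + w0 p * w2 p)" for p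
private definition "n p = u0 p * u0 p + w0 p * w0 p" for p

private lemmas smi = smooth_on_diff[OF U(1)] smooth_on_add[OF U(1)] smooth_on_mult[OF U(1)] smooth_on_const sms

private lemma smhk: "smooth_on U h" "smooth_on U h1" "smooth_on U k" "smooth_on U n"
  unfolding h_def infl_fun_eq h1_def[abs_def] k_def[abs_def] n_def[abs_def] by (intro smi)+

private lemma Dh:
  assumes p: "p \<in> U" shows "D h p = h1 p" "D h1 p = h2 p" "D k p = k1 p" "D n p = 2 * k p"
proof -
  note m = smooth_on_mult[OF U(1)]
  show "D h p = h1 p"
    unfolding h_def infl_fun_eq
    by (simp add: D_diff[OF m m p] D_mult[OF _ _ p] sms h1_def
        u1_def[symmetric] w1_def[symmetric] u2_def[symmetric] w2_def[symmetric])
  show "D h1 p = h2 p"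
    unfolding h1_def[abs_def]
    by (simp add: D_diff[OF m m p] D_mult[OF _ _ p] sms h2_def
        u1_def[symmetric] w1_def[symmetric] u2_def[symmetric] w2_def[symmetric]
        u3_def[symmetric] w3_def[symmetric])
  show "D k p = k1 p"
    unfolding k_def[abs_def]
    by (simp add: D_add[OF m m p] D_mult[OF _ _ p] sms k1_def
        u1_def[symmetric] w1_def[symmetric] u2_def[symmetric] w2_def[symmetric])
  show "D n p = 2 * k p"
    unfolding n_def[abs_def]
    by (simp add: D_add[OF m m p] D_mult[OF _ _ p] sms k_def
        u1_def[symmetric] w1_def[symmetric])
qed

private lemma vert_fun_eq: "p \<in> U \<Longrightarrow> vert_fun e S p = n p * h1 p - 3 * h p * k p"
  by (simp add: vert_fun_def h_def[symmetric] Dh(1) n_def k_def u0_def[symmetric] w0_def[symmetric]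
      u1_def[symmetric] w1_def[symmetric] power2_eq_square)

private lemma D_vert_fun_eq:
  assumes p: "p \<in> U"
  shows "D (vert_fun e S) p = 2 * k p * h1 p + n p * h2 p - 3 * (h1 p * k p + h p * k1 p)"
proof -
  have "D (vert_fun e S) p = D (\<lambda>p. n p * h1 p - 3 * (h p * k p)) p"
    by (rule D_cong[OF _ _ p]) (intro smi smhk, simp add: vert_fun_eq)
  also have "\<dots> = D (\<lambda>p. n p * h1 p) p - D (\<lambda>p. 3 * (h p * k p)) p"
    by (rule D_diff[OF _ _ p]) (intro smi smhk)+
  also have "D (\<lambda>p. n p * h1 p) p = 2 * k p * h1 p + n p * h2 p"
    using D_mult[OF smhk(4,2) p] Dh[OF p] by simp
  also have "D (\<lambda>p. 3 * (h p * k p)) p = D (\<lambda>p. 3) p * (h p * k p) + 3 * D (\<lambda>p. h p * k p) p"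
    by (rule D_mult[OF _ _ p]) (intro smi smhk)+
  also have "D (\<lambda>p. 3) p = 0"
    by (simp add: tangent_deriv_def dirderiv_eq[OF has_derivative_const])
  also have "D (\<lambda>p. h p * k p) p = h1 p * k p + h p * k1 p"
    using D_mult[OF smhk(1,3) p] Dh[OF p] by simp
  finally show ?thesis by simp
qed

private lemma aps:
  "approx 1 u0 (\<lambda>p. a * (p \<bullet> e))" "approx 1 u1 (\<lambda>p. - (a * b) * (p \<bullet> rot e))"
  "approx 1 u2 (\<lambda>p. - (a * (a * b)) * (p \<bullet> e))" "approx 1 u3 (\<lambda>p. a * (a * (b * b)) * (p \<bullet> rot e))"
  "approx 1 w0 (\<lambda>p. b * (p \<bullet> rot e))" "approx 1 w1 (\<lambda>p. a * b * (p \<bullet> e))"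
  "approx 1 w2 (\<lambda>p. - (a * (b * b)) * (p \<bullet> rot e))" "approx 1 w3 (\<lambda>p. - (a * (a * (b * b))) * (p \<bullet> e))"
  using lins[THEN lin_approx] by simp_all

private lemma approx_mult11: "approx 1 \<phi> q \<Longrightarrow> approx 1 \<psi> r \<Longrightarrow> approx 2 (\<lambda>p. \<phi> p * \<psi> p) (\<lambda>p. q p * r p)"
  using approx_mult[of 1 \<phi> q 1 \<psi> r] by (simp add: numeral_2_eq_2)

private lemma approx_mult22: "approx 2 \<phi> q \<Longrightarrow> approx 2 \<psi> r \<Longrightarrow> approx 4 (\<lambda>p. \<phi> p * \<psi> p) (\<lambda>p. q p * r p)"
  using approx_mult[of 2 \<phi> q 2 \<psi> r] by simp

private lemma approx_transform:
  "approx m \<phi> q \<Longrightarrow> (\<And>p. p \<in> U \<Longrightarrow> \<psi> p = \<phi> p) \<Longrightarrow> (\<And>p. q p = r p) \<Longrightarrow> approx m \<psi> r"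
proof -
  assume ap: "approx m \<phi> q" and eq: "\<And>p. p \<in> U \<Longrightarrow> \<psi> p = \<phi> p" and qr: "\<And>p. q p = r p"
  have "q = r" using qr by auto
  have "\<forall>\<^sub>F p in at 0. p \<in> U" using U by (simp add: eventually_at_in_open')
  then have "\<forall>\<^sub>F p in at 0. \<phi> p - q p = \<psi> p - q p" by eventually_elim (simp add: eq)
  from landau_o.small.in_cong[OF this] ap show ?thesis by (simp add: approx_def \<open>q = r\<close>)
qed

text \<open>At leading order \<open>D\<close> differentiates along the level sets of
  \<open>a x^2 + b y^2\<close>, and \<open>h\<close> is a multiple of this form; therefore
  \<open>h1\<close> and \<open>h2\<close> have leading term 0. In \<open>vert_fun\<close> only
  \<open>- 3 h k\<close> survives and in its tangential derivative only \<open>- 3 h k1\<close>. The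
  factor \<open>b - a\<close>, which needs distinct eigenvalues, comes from \<open>k\<close> and
  \<open>k1\<close>.\<close>

private lemma ap2:
  "approx 2 h (\<lambda>p. a * b * (a * (p \<bullet> e)\<^sup>2 + b * (p \<bullet> rot e)\<^sup>2))"
  "approx 2 h1 (\<lambda>p. 0)"
  "approx 2 h2 (\<lambda>p. 0)"
  "approx 2 k (\<lambda>p. a * b * (b - a) * (p \<bullet> e) * (p \<bullet> rot e))"
  "approx 2 k1 (\<lambda>p. a * b * (b - a) * (a * (p \<bullet> e)\<^sup>2 - b * (p \<bullet> rot e)\<^sup>2))"
  "approx 2 n (\<lambda>p. a * (p \<bullet> e) * (a * (p \<bullet> e)) + b * (p \<bullet> rot e) * (b * (p \<bullet> rot e)))"
proof -
  note I = approx_diff approx_add approx_mult11 aps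
  have hp: "approx 2 h (\<lambda>p. a * (p \<bullet> e) * (a * b * (p \<bullet> e)) - b * (p \<bullet> rot e) * (- (a * b) * (p \<bullet> rot e)))"
    unfolding h_def infl_fun_eq by (intro I)
  have h1p: "approx 2 h1 (\<lambda>p. a * (p \<bullet> e) * (- (a * (b * b)) * (p \<bullet> rot e)) - b * (p \<bullet> rot e) * (- (a * (a * b)) * (p \<bullet> e)))"
    unfolding h1_def[abs_def] by (intro I)
  have h2p: "approx 2 h2 (\<lambda>p. - (a * b) * (p \<bullet> rot e) * (- (a * (b * b)) * (p \<bullet> rot e)) +
      a * (p \<bullet> e) * (- (a * (a * (b * b))) * (p \<bullet> e)) - (a * b * (p \<bullet> e) * (- (a * (a * b)) * (p \<bullet> e)) +
      b * (p \<bullet> rot e) * (a * (a * (b * b)) * (p \<bullet> rot e))))"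
    unfolding h2_def[abs_def] by (intro I)
  have kp: "approx 2 k (\<lambda>p. a * (p \<bullet> e) * (- (a * b) * (p \<bullet> rot e)) + b * (p \<bullet> rot e) * (a * b * (p \<bullet> e)))"
    unfolding k_def[abs_def] by (intro I)
  have k1p: "approx 2 k1 (\<lambda>p. - (a * b) * (p \<bullet> rot e) * (- (a * b) * (p \<bullet> rot e)) + a * (p \<bullet> e) * (- (a * (a * b)) * (p \<bullet> e))
      + (a * b * (p \<bullet> e) * (a * b * (p \<bullet> e)) + b * (p \<bullet> rot e) * (- (a * (b * b)) * (p \<bullet> rot e))))"
    unfolding k1_def[abs_def] by (intro I)
  show "approx 2 h (\<lambda>p. a * b * (a * (p \<bullet> e)\<^sup>2 + b * (p \<bullet> rot e)\<^sup>2))"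
    by (rule approx_transform[OF hp refl]) algebra
  show "approx 2 h1 (\<lambda>p. 0)" by (rule approx_transform[OF h1p refl]) algebra
  show "approx 2 h2 (\<lambda>p. 0)" by (rule approx_transform[OF h2p refl]) algebra
  show "approx 2 k (\<lambda>p. a * b * (b - a) * (p \<bullet> e) * (p \<bullet> rot e))"
    by (rule approx_transform[OF kp refl]) algebra
  show "approx 2 k1 (\<lambda>p. a * b * (b - a) * (a * (p \<bullet> e)\<^sup>2 - b * (p \<bullet> rot e)\<^sup>2))"
    by (rule approx_transform[OF k1p refl]) algebra
  show "approx 2 n (\<lambda>p. a * (p \<bullet> e) * (a * (p \<bullet> e)) + b * (p \<bullet> rot e) * (b * (p \<bullet> rot e)))"
    unfolding n_def[abs_def] by (intro I)
qed

lemma approx_gradient: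
  "approx 1 (dirderiv e S) (\<lambda>p. a * (p \<bullet> e))"
  "approx 1 (dirderiv (rot e) S) (\<lambda>p. b * (p \<bullet> rot e))"
  using aps(1,5) by (simp_all add: u0_def w0_def)

lemma approx_infl_fun:
  "approx 2 (infl_fun e S) (\<lambda>p. a * b * (a * (p \<bullet> e)\<^sup>2 + b * (p \<bullet> rot e)\<^sup>2))"
  using ap2(1) by (simp add: h_def)

lemma approx_vert_fun:
  "approx 4 (vert_fun e S) (\<lambda>p. - 3 * a\<^sup>2 * b\<^sup>2 * (b - a) *
     (a * (p \<bullet> e)\<^sup>2 + b * (p \<bullet> rot e)\<^sup>2) * ((p \<bullet> e) * (p \<bullet> rot e)))"
  by (rule approx_transform[OF approx_diff[OF approx_mult22[OF ap2(6,2)]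
        approx_cmult[OF approx_mult22[OF ap2(1,4)], of 3]]])
    (simp_all add: vert_fun_eq power2_eq_square algebra_simps)

lemma approx_tangent_deriv_vert_fun:
  "approx 4 (tangent_deriv e S (vert_fun e S)) (\<lambda>p. - 3 * a\<^sup>2 * b\<^sup>2 * (b - a) *
     (a * (p \<bullet> e)\<^sup>2 + b * (p \<bullet> rot e)\<^sup>2) * (a * (p \<bullet> e)\<^sup>2 - b * (p \<bullet> rot e)\<^sup>2))"
  by (rule approx_transform[OF approx_diff[OF approx_add[OF
        approx_cmult[OF approx_mult22[OF ap2(4,2)], of 2] approx_mult22[OF ap2(6,3)]]
        approx_cmult[OF approx_add[OF approx_mult22[OF ap2(2,4)] approx_mult22[OF ap2(1,5)]], of 3]]])
    (simp_all add: D_vert_fun_eq power2_eq_square algebra_simps)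

end

section \<open>Small level sets around a minimum are ovals\<close>

text \<open>\<open>rot p \<bullet> q\<close> is the determinant of \<open>p\<close> and
  \<open>q\<close>, the same in every positively oriented orthonormal frame.\<close>

lemma rot_inner: "norm e = 1 \<Longrightarrow> rot p \<bullet> q = (p \<bullet> e) * (q \<bullet> rot e) - (p \<bullet> rot e) * (q \<bullet> e)"
proof -
  assume e: "norm e = 1"
  obtain c s where e12: "e = (c, s)" by fastforce
  obtain x y where p: "p = (x, y)" by fastforce
  obtain z w where q: "q = (z, w)" by fastforce
  have "c * c + s * s = 1"
    using e by (simp add: e12 norm_prod_def power2_eq_square)
  then have "- y * z + x * w = (x * c + y * s) * (z * (- s) + w * c) - (x * (- s) + y * c) * (z * c + w * s)"
    by algebra
  then show ?thesis unfolding e12 p q rot_def by simp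
qed

lemma rot_linear: "rot (p + q) = rot p + rot q" "rot (c *\<^sub>R p) = c *\<^sub>R rot p"
  by (simp_all add: rot_def)

lemma rot_inner_self: "rot p \<bullet> p = 0"
  by (simp add: rot_def inner_prod_def)

lemma frame_inner:
  assumes "norm e = 1"
  shows "e \<bullet> e = 1" "rot e \<bullet> rot e = 1" "rot e \<bullet> e = 0" "e \<bullet> rot e = 0"
  using assms rot_inner_self[of e] by (simp_all add: norm_eq_1[symmetric] inner_commute)

text \<open>Stated for any \<open>g\<close> with the zero set \<open>S = s\<close>, since the slices
  of a deformation need not be \<open>S - s\<close>. Singular points depend on \<open>g\<close> and
  not only on its zero set, hence the separate regularity hypothesis.\<close>

definition level_configuration :: "(real \<times> real \<Rightarrow> real) \<Rightarrow> real \<Rightarrow> real \<Rightarrow> bool" where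
  "level_configuration S r \<delta> \<longleftrightarrow> (\<forall>g s. (\<forall>p. norm p < r \<longrightarrow> (g p = 0 \<longleftrightarrow> S p = s)) \<longrightarrow>
     (\<forall>p. norm p < r \<longrightarrow> g p = 0 \<longrightarrow> p \<noteq> 0 \<longrightarrow> \<not> (g has_derivative (\<lambda>_. 0)) (at p)) \<longrightarrow>
     (0 < s \<and> s < \<delta> \<longrightarrow> oval r g) \<and> (s < 0 \<longrightarrow> curve r g = {}) \<and> (s = 0 \<longrightarrow> curve r g = {0}))"

lemma unique_zero_of_increasing:
  fixes \<phi> :: "real \<Rightarrow> real"
  assumes c: "c > 0" and d: "\<And>t. \<bar>t\<bar> \<le> c \<Longrightarrow> \<exists>y>0. (\<phi> has_real_derivative y) (at t)"
    and sgn: "\<phi> (- c) < 0" "\<phi> c > 0"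
  shows "\<exists>m. \<bar>m\<bar> \<le> c \<and> \<phi> m = 0 \<and> (\<forall>t. \<bar>t\<bar> \<le> c \<longrightarrow> \<phi> t = 0 \<longrightarrow> t = m)"
proof -
  have "continuous_on {-c..c} \<phi>"
    by (intro continuous_at_imp_continuous_on ballI) (use d DERIV_isCont in \<open>fastforce simp: abs_le_iff\<close>)
  then obtain m where m: "- c \<le> m" "m \<le> c" "\<phi> m = 0"
    using IVT'[of \<phi> "- c" 0 c] sgn c by auto
  have d': "\<exists>y. (\<phi> has_real_derivative y) (at t) \<and> 0 < y" if "- c \<le> t" "t \<le> c" for t
    using d[of t] that by (auto simp: abs_le_iff)
  have inc: "\<phi> t < \<phi> t'" if "- c \<le> t" "t < t'" "t' \<le> c" for t t'
    by (rule DERIV_pos_imp_increasing[OF that(2)], rule d') (use that in auto)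
  show ?thesis
  proof (intro exI[of _ m] conjI allI impI)
    fix t assume t: "\<bar>t\<bar> \<le> c" "\<phi> t = 0"
    then show "t = m" using inc[of t m] inc[of m t] m by (cases t m rule: linorder_cases) (auto simp: abs_le_iff)
  qed (use m in \<open>auto simp: abs_le_iff\<close>)
qed

section \<open>Level sets under sign conditions on a punctured disc\<close>

context
  fixes S :: "real \<times> real \<Rightarrow> real" and e :: "real \<times> real" and r0 c \<sigma> :: real
  assumes S: "smooth_on (ball 0 r0) S" and S0: "S 0 = 0" and e: "norm e = 1" and r0: "r0 > 0"
    and radial: "\<And>p. p \<noteq> 0 \<Longrightarrow> norm p < r0 \<Longrightarrow>
      (p \<bullet> e) * dirderiv e S p + (p \<bullet> rot e) * dirderiv (rot e) S p > 0"
    and infl: "\<And>p. p \<noteq> 0 \<Longrightarrow> norm p < r0 \<Longrightarrow> infl_fun e S p > 0"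
    and c: "0 < c" "c \<le> 1/8"
    and vert_pos: "\<And>p. p \<noteq> 0 \<Longrightarrow> norm p < r0 \<Longrightarrow> c * \<bar>p \<bullet> e\<bar> \<le> \<bar>p \<bullet> rot e\<bar> \<Longrightarrow>
      c * \<bar>p \<bullet> rot e\<bar> \<le> \<bar>p \<bullet> e\<bar> \<Longrightarrow> (p \<bullet> e) * (p \<bullet> rot e) > 0 \<Longrightarrow> \<sigma> * vert_fun e S p > 0"
    and vert_neg: "\<And>p. p \<noteq> 0 \<Longrightarrow> norm p < r0 \<Longrightarrow> c * \<bar>p \<bullet> e\<bar> \<le> \<bar>p \<bullet> rot e\<bar> \<Longrightarrow>
      c * \<bar>p \<bullet> rot e\<bar> \<le> \<bar>p \<bullet> e\<bar> \<Longrightarrow> (p \<bullet> e) * (p \<bullet> rot e) < 0 \<Longrightarrow> \<sigma> * vert_fun e S p < 0"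
    and dvert_pos: "\<And>p. p \<noteq> 0 \<Longrightarrow> norm p < r0 \<Longrightarrow> \<bar>p \<bullet> rot e\<bar> \<le> c * \<bar>p \<bullet> e\<bar> \<Longrightarrow>
      \<sigma> * tangent_deriv e S (vert_fun e S) p > 0"
    and dvert_neg: "\<And>p. p \<noteq> 0 \<Longrightarrow> norm p < r0 \<Longrightarrow> \<bar>p \<bullet> e\<bar> \<le> c * \<bar>p \<bullet> rot e\<bar> \<Longrightarrow>
      \<sigma> * tangent_deriv e S (vert_fun e S) p < 0"
begin

private lemma ob: "open (ball (0 :: real \<times> real) r0)" by simp

private lemma radial_deriv:
  assumes "p \<noteq> 0" "t > 0" "t * norm p < r0"
  shows "((\<lambda>t. S (t *\<^sub>R p)) has_real_derivative dirderiv p S (t *\<^sub>R p)) (at t)"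
    "dirderiv p S (t *\<^sub>R p) > 0"
proof -
  have tp: "t *\<^sub>R p \<in> ball 0 r0" using assms by simp
  have "((\<lambda>t. t *\<^sub>R p) has_vector_derivative p) (at t)"
    using has_vector_derivative_line[of 0 p t] by simp
  from has_real_derivative_along[of S _ "\<lambda>t. t *\<^sub>R p" t, OF smooth_on_has_derivative[OF S tp] this]
  show "((\<lambda>t. S (t *\<^sub>R p)) has_real_derivative dirderiv p S (t *\<^sub>R p)) (at t)" .
  note lin = has_derivative_linear[OF smooth_on_has_derivative[OF S tp]]
  have "dirderiv ((p \<bullet> e) *\<^sub>R e + (p \<bullet> rot e) *\<^sub>R rot e) S (t *\<^sub>R p)
      = (p \<bullet> e) * dirderiv e S (t *\<^sub>R p) + (p \<bullet> rot e) * dirderiv (rot e) S (t *\<^sub>R p)"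
    by (simp add: linear_add[OF lin] linear_scale[OF lin])
  then have "t * dirderiv p S (t *\<^sub>R p) =
      (t *\<^sub>R p \<bullet> e) * dirderiv e S (t *\<^sub>R p) + (t *\<^sub>R p \<bullet> rot e) * dirderiv (rot e) S (t *\<^sub>R p)"
    by (simp add: frame_coordinates(3)[OF e, symmetric] distrib_left)
  also have "\<dots> > 0" by (rule radial) (use assms in auto)
  finally show "dirderiv p S (t *\<^sub>R p) > 0" using assms(2) by (simp add: zero_less_mult_iff)
qed

private lemma radial_mono:
  assumes "p \<noteq> 0" "0 \<le> t" "t < t'" "t' * norm p < r0"
  shows "S (t *\<^sub>R p) < S (t' *\<^sub>R p)"
proof (rule DERIV_pos_imp_increasing_open[OF assms(3)])
  have le: "x * norm p < r0" if "x \<le> t'" for x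
    using mult_right_mono[OF that norm_ge_zero[of p]] assms(4) by linarith
  show "\<exists>y. ((\<lambda>t. S (t *\<^sub>R p)) has_real_derivative y) (at x) \<and> 0 < y" if "t < x" "x < t'" for x
    using radial_deriv[OF assms(1), of x] le[of x] that assms(2) by auto
  have "(\<lambda>x. x *\<^sub>R p) ` {t..t'} \<subseteq> ball 0 r0"
    using le assms(2) by auto
  then show "continuous_on {t..t'} (\<lambda>t. S (t *\<^sub>R p))"
    by (intro continuous_on_compose2[OF smooth_on_continuous_on[OF S]] continuous_intros)
qed

private lemma S_pos: "p \<noteq> 0 \<Longrightarrow> norm p < r0 \<Longrightarrow> S p > 0"
  using radial_mono[of p 0 1] S0 by simp

private lemma grad_pos:
  assumes "p \<noteq> 0" "norm p < r0"
  shows "(dirderiv e S p)\<^sup>2 + (dirderiv (rot e) S p)\<^sup>2 > 0"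
  using radial[OF assms] by (auto simp: sum_power2_gt_zero_iff)

text \<open>\<open>\<delta>\<close> is the minimum of \<open>S\<close> on the circle of radius
  \<open>r / 2\<close>, so by the intermediate value theorem every ray meets a lower positive level
  no farther out than this circle.\<close>

private lemma gauge_exists:
  assumes r: "0 < r" "r < r0"
  obtains \<delta> where "\<delta> > 0" "\<And>s p. 0 < s \<Longrightarrow> s < \<delta> \<Longrightarrow> p \<noteq> 0 \<Longrightarrow>
     \<exists>t. 0 < t \<and> t * norm p \<le> r / 2 \<and> S (t *\<^sub>R p) = s"
proof -
  have sub: "sphere 0 (r / 2) \<subseteq> ball (0 :: real \<times> real) r0" using r by auto
  have ne: "sphere 0 (r / 2) \<noteq> ({} :: (real \<times> real) set)" using r by simp
  obtain z where z: "z \<in> sphere 0 (r / 2)" "\<And>y. y \<in> sphere 0 (r / 2) \<Longrightarrow> S z \<le> S y"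
    using continuous_attains_inf[OF compact_sphere ne
        continuous_on_subset[OF smooth_on_continuous_on[OF S] sub]] by blast
  show ?thesis
  proof (rule that[of "S z"])
    have "norm z = r / 2" using z(1) by simp
    then show "S z > 0" using r by (intro S_pos) auto
    fix s p assume s: "0 < s" "s < S z" and p: "(p :: real \<times> real) \<noteq> 0"
    define T where "T = r / 2 / norm p"
    have T: "T > 0" "T * norm p = r / 2" using p r by (auto simp: T_def)
    have "S z \<le> S (T *\<^sub>R p)" using T by (intro z(2)) simp
    then have "0 \<le> T" "S (0 *\<^sub>R p) \<le> s" "s \<le> S (T *\<^sub>R p)" using T s S0 by auto
    moreover have "continuous_on {0..T} (\<lambda>t. S (t *\<^sub>R p))"
    proof (rule continuous_on_compose2[OF smooth_on_continuous_on[OF S]])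
      show "(\<lambda>x. x *\<^sub>R p) ` {0..T} \<subseteq> ball 0 r0"
      proof (rule image_subsetI)
        fix x assume "x \<in> {0..T}"
        then have "\<bar>x\<bar> * norm p \<le> T * norm p" by (intro mult_right_mono) auto
        then show "x *\<^sub>R p \<in> ball 0 r0" using T r by simp
      qed
    qed (intro continuous_intros)
    ultimately obtain t where t: "0 \<le> t" "t \<le> T" "S (t *\<^sub>R p) = s"
      using IVT'[of "\<lambda>t. S (t *\<^sub>R p)" 0 s T] by blast
    have "t \<noteq> 0" using t s S0 by auto
    moreover have "t * norm p \<le> r / 2" using mult_right_mono[OF t(2) norm_ge_zero[of p]] T by simp
    ultimately show "\<exists>t. 0 < t \<and> t * norm p \<le> r / 2 \<and> S (t *\<^sub>R p) = s"
      using t by (intro exI[of _ t]) auto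
  qed
qed

section \<open>A fixed level and its gauge\<close>

context
  fixes r s :: real and \<Lambda> :: "real \<times> real \<Rightarrow> real"
  assumes r: "0 < r" "r < r0" and s: "s > 0"
    and \<Lambda>: "\<And>p. p \<noteq> 0 \<Longrightarrow> 0 < \<Lambda> p \<and> \<Lambda> p * norm p \<le> r / 2 \<and> S (\<Lambda> p *\<^sub>R p) = s"
begin

private lemma gauge_bound: "p \<noteq> 0 \<Longrightarrow> \<Lambda> p * norm p < r0"
  using \<Lambda>[of p] r by linarith

private lemma gauge_less:
  assumes "p \<noteq> 0" "0 < t" "t * norm p < r0"
  shows "S (t *\<^sub>R p) < s \<longleftrightarrow> t < \<Lambda> p" "S (t *\<^sub>R p) > s \<longleftrightarrow> t > \<Lambda> p" "S (t *\<^sub>R p) = s \<longleftrightarrow> t = \<Lambda> p"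
  using radial_mono[OF assms(1), of t "\<Lambda> p"] radial_mono[OF assms(1), of "\<Lambda> p" t]
    \<Lambda>[OF assms(1)] gauge_bound[OF assms(1)] assms
  by (cases t "\<Lambda> p" rule: linorder_cases; fastforce)+

private lemma gauge_scale: "p \<noteq> 0 \<Longrightarrow> k > 0 \<Longrightarrow> \<Lambda> (k *\<^sub>R p) = \<Lambda> p / k"
  using gauge_less(3)[of "k *\<^sub>R p" "\<Lambda> p / k"] \<Lambda>[of p] gauge_bound[of p] by simp

text \<open>\<open>\<Lambda> p\<close> solves \<open>S (t *\<^sub>R p) = s\<close> for
  \<open>t\<close>. The derivative in \<open>t\<close> is the radial derivative of \<open>S\<close>,
  which is positive, so the lemmas on implicit functions apply.\<close>

private lemma gauge_smooth: "smooth_on (- {0}) \<Lambda>"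
proof -
  define W where "W = {z :: (real \<times> real) \<times> real. fst z \<noteq> 0 \<and> 0 < snd z \<and> snd z * norm (fst z) < r0}"
  define G where "G z = S (snd z *\<^sub>R fst z) - s" for z :: "(real \<times> real) \<times> real"
  have W: "open W" unfolding W_def
    by (intro open_Collect_conj open_Collect_neq open_Collect_less continuous_intros)
  have img: "(\<lambda>z. snd z *\<^sub>R fst z) ` W \<subseteq> ball 0 r0"
  proof (rule image_subsetI)
    fix z assume "z \<in> W"
    then show "snd z *\<^sub>R fst z \<in> ball 0 r0" by (simp add: W_def)
  qed
  have "smooth_on W (\<lambda>z :: (real \<times> real) \<times> real. snd z *\<^sub>R fst z)"
    by (intro smooth_on_scaleR W smooth_on_linear bounded_linear_fst bounded_linear_snd)
  from smooth_on_diff[OF W smooth_on_compose[OF W img S this] smooth_on_const]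
  have G: "smooth_on W G" unfolding G_def[abs_def] .
  have inW: "(p, \<Lambda> p) \<in> W" if "p \<noteq> 0" for p
    using that \<Lambda>[OF that] gauge_bound[OF that] by (simp add: W_def)
  have op: "open (- {0 :: real \<times> real})" by (simp add: open_Compl)
  have cont: "continuous_on (- {0}) \<Lambda>"
  proof (rule implicit_continuous_on[OF W smooth_on_continuous_on[OF G] op])
    show "(p, \<Lambda> p) \<in> W" if "p \<in> - {0}" for p using inW that by simp
    show "G (p, t) < 0 \<longleftrightarrow> t < \<Lambda> p" "G (p, t) > 0 \<longleftrightarrow> \<Lambda> p < t" if "p \<in> - {0}" "(p, t) \<in> W" for p t
      using gauge_less(1,2)[of p t] that by (simp_all add: G_def W_def)
  qed
  show ?thesis
  proof (rule implicit_smooth_on[OF W G op cont], intro conjI)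
    fix p :: "real \<times> real" assume "p \<in> - {0}"
    then have p: "p \<noteq> 0" by simp
    show "(p, \<Lambda> p) \<in> W" by (rule inW[OF p])
    show "G (p, \<Lambda> p) = 0" using \<Lambda>[OF p] by (simp add: G_def)
    have "((\<lambda>t. (p, t)) has_vector_derivative (0, 1)) (at (\<Lambda> p))"
      by (intro has_vector_derivative_Pair has_vector_derivative_const has_vector_derivative_id)
    from has_real_derivative_along[of G _ "\<lambda>t. (p, t)" "\<Lambda> p", OF smooth_on_has_derivative[OF G inW[OF p]] this]
    have "((\<lambda>t. S (t *\<^sub>R p) - s) has_real_derivative dirderiv (0, 1) G (p, \<Lambda> p)) (at (\<Lambda> p))"
      by (simp add: G_def)
    moreover have "((\<lambda>t. S (t *\<^sub>R p) - s) has_real_derivative dirderiv p S (\<Lambda> p *\<^sub>R p)) (at (\<Lambda> p))"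
      using DERIV_diff[OF radial_deriv(1)[OF p, of "\<Lambda> p"] DERIV_const] \<Lambda>[OF p] gauge_bound[OF p] by simp
    ultimately have "dirderiv (0, 1) G (p, \<Lambda> p) = dirderiv p S (\<Lambda> p *\<^sub>R p)" by (rule DERIV_unique)
    then show "dirderiv (0, 1) G (p, \<Lambda> p) \<noteq> 0"
      using radial_deriv(2)[OF p, of "\<Lambda> p"] \<Lambda>[OF p] gauge_bound[OF p] by simp
  qed
qed

text \<open>A line that misses the origin, projected centrally onto the level set, parametrises an
  arc. The determinant of position and velocity is the squared gauge times that of \<open>q0\<close>
  and \<open>\<tau>\<close>, so the arc runs counterclockwise; by \<open>radial\<close> so does the
  rotated gradient, hence \<open>k\<close> is positive.\<close>

private lemma gauge_line:
  fixes q0 \<tau> :: "real \<times> real"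
  assumes cr: "rot q0 \<bullet> \<tau> > 0"
  defines "\<gamma> \<equiv> \<lambda>t. \<Lambda> (q0 + t *\<^sub>R \<tau>) *\<^sub>R (q0 + t *\<^sub>R \<tau>)"
  shows "q0 + t *\<^sub>R \<tau> \<noteq> 0" "smooth_on UNIV \<gamma>" "S (\<gamma> t) = s" "\<gamma> t \<noteq> 0" "norm (\<gamma> t) \<le> r / 2"
    "vector_derivative \<gamma> (at t) \<noteq> 0"
    "\<exists>k>0. \<forall>\<phi>. smooth_on (ball 0 r0) \<phi> \<longrightarrow>
      ((\<lambda>t. \<phi> (\<gamma> t)) has_real_derivative k * tangent_deriv e S \<phi> (\<gamma> t)) (at t)"
proof -
  define q where "q t = q0 + t *\<^sub>R \<tau>" for t
  have rq: "rot (q t) \<bullet> \<tau> = rot q0 \<bullet> \<tau>" for t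
    by (simp add: q_def rot_linear inner_add_left rot_inner_self)
  have q0: "q t \<noteq> 0" for t
  proof
    assume "q t = 0"
    then have "rot (q t) \<bullet> \<tau> = 0" by (simp add: rot_def inner_prod_def)
    then show False using rq cr by simp
  qed
  then show "q0 + t *\<^sub>R \<tau> \<noteq> 0" by (simp add: q_def)
  have \<gamma>: "\<gamma> t = \<Lambda> (q t) *\<^sub>R q t" for t by (simp add: \<gamma>_def q_def)
  have op: "open (- {0 :: real \<times> real})" by (simp add: open_Compl)
  have smq: "smooth_on UNIV q" unfolding q_def[abs_def]
    by (intro smooth_on_add open_UNIV smooth_on_const smooth_on_linear bounded_linear_scaleR_left)
  have smL: "smooth_on UNIV (\<lambda>t. \<Lambda> (q t))"
    by (rule smooth_on_compose[OF open_UNIV _ gauge_smooth smq]) (use q0 in auto)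
  show sm\<gamma>: "smooth_on UNIV \<gamma>"
    unfolding \<gamma>[abs_def] by (rule smooth_on_scaleR[OF open_UNIV smL smq])
  have S\<gamma>: "S (\<gamma> t) = s" "\<gamma> t \<noteq> 0" "norm (\<gamma> t) \<le> r / 2" for t
    using \<Lambda>[OF q0[of t]] q0[of t] by (auto simp: \<gamma>)
  then show "S (\<gamma> t) = s" "\<gamma> t \<noteq> 0" "norm (\<gamma> t) \<le> r / 2" by auto
  have \<gamma>r0: "norm (\<gamma> t) < r0" for t using S\<gamma>(3)[of t] r by simp
  have cross: "rot (\<gamma> t) \<bullet> vector_derivative \<gamma> (at t) > 0" for t
  proof -
    obtain l where l: "((\<lambda>t. \<Lambda> (q t)) has_real_derivative l) (at t)"
      using smooth_on_differentiable[OF smL, of t] real_differentiable_def by auto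
    have dq: "(q has_vector_derivative \<tau>) (at t)"
      unfolding q_def[abs_def] by (rule has_vector_derivative_line)
    have "vector_derivative \<gamma> (at t) = \<Lambda> (q t) *\<^sub>R \<tau> + l *\<^sub>R q t"
      unfolding \<gamma>[abs_def] by (rule vector_derivative_at[OF has_vector_derivative_scaleR[OF l dq]])
    then have "rot (\<gamma> t) \<bullet> vector_derivative \<gamma> (at t) = \<Lambda> (q t) * \<Lambda> (q t) * (rot q0 \<bullet> \<tau>)"
      by (simp add: \<gamma> rot_linear inner_add_right rot_inner_self rq)
    then show ?thesis using \<Lambda>[OF q0[of t]] cr by simp
  qed
  then have nz: "vector_derivative \<gamma> (at t) \<noteq> 0" for t
    by (metis inner_zero_right less_irrefl)
  then show "vector_derivative \<gamma> (at t) \<noteq> 0" .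
  obtain k where k: "vector_derivative \<gamma> (at t) =
      k *\<^sub>R (dirderiv e S (\<gamma> t) *\<^sub>R rot e - dirderiv (rot e) S (\<gamma> t) *\<^sub>R e)"
    and kd: "\<And>\<phi>. smooth_on (ball 0 r0) \<phi> \<Longrightarrow>
      ((\<lambda>t. \<phi> (\<gamma> t)) has_real_derivative k * tangent_deriv e S \<phi> (\<gamma> t)) (at t)"
    by (rule level_velocity[OF ob S e, of "\<bar>t\<bar> + 1" \<gamma> s t])
      (use S\<gamma> \<gamma>r0 nz grad_pos smooth_on_subset[OF sm\<gamma>] in auto)
  have "rot (\<gamma> t) \<bullet> (dirderiv e S (\<gamma> t) *\<^sub>R rot e - dirderiv (rot e) S (\<gamma> t) *\<^sub>R e) =
     (\<gamma> t \<bullet> e) * dirderiv e S (\<gamma> t) + (\<gamma> t \<bullet> rot e) * dirderiv (rot e) S (\<gamma> t)"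
    using frame_coordinates(1,2)[OF e, of "- dirderiv (rot e) S (\<gamma> t)" "dirderiv e S (\<gamma> t)"]
    unfolding rot_inner[OF e] by simp
  moreover have "\<dots> > 0" by (rule radial[OF S\<gamma>(2) \<gamma>r0])
  ultimately have "k > 0" using cross[of t] unfolding k by (simp add: zero_less_mult_iff)
  with kd show "\<exists>k>0. \<forall>\<phi>. smooth_on (ball 0 r0) \<phi> \<longrightarrow>
      ((\<lambda>t. \<phi> (\<gamma> t)) has_real_derivative k * tangent_deriv e S \<phi> (\<gamma> t)) (at t)" by blast
qed

text \<open>For \<open>\<bar>t\<bar> \<le> c\<close> the projected line covers the sector around
  \<open>d\<close>. There the conditions on \<open>tangent_deriv\<close> make
  \<open>vert_fun\<close> strictly monotone, and at the two ends, which also belong to the region of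
  \<open>vert_pos\<close> and \<open>vert_neg\<close>, it has opposite signs.\<close>

private lemma sector_vertex:
  assumes d: "d = e \<or> d = rot e \<or> d = - e \<or> d = - rot e"
  shows "\<exists>m. \<bar>m\<bar> \<le> c \<and> vert_fun e S (\<Lambda> (d + m *\<^sub>R rot d) *\<^sub>R (d + m *\<^sub>R rot d)) = 0 \<and>
    (\<forall>t. \<bar>t\<bar> \<le> c \<longrightarrow> vert_fun e S (\<Lambda> (d + t *\<^sub>R rot d) *\<^sub>R (d + t *\<^sub>R rot d)) = 0 \<longrightarrow> t = m)"
proof -
  define \<gamma> where "\<gamma> t = \<Lambda> (d + t *\<^sub>R rot d) *\<^sub>R (d + t *\<^sub>R rot d)" for t
  have ee: "e \<bullet> e = 1" "rot e \<bullet> rot e = 1" "rot e \<bullet> e = 0" "e \<bullet> rot e = 0"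
      by (rule frame_inner[OF e])+
  have rm: "rot (- p) = - rot p" for p by (simp add: rot_def)
  have "rot d \<bullet> rot d > 0" using d by (elim disjE) (simp_all add: ee rm)
  note gl = gauge_line[OF this, folded \<gamma>_def]
  have smV: "smooth_on (ball 0 r0) (vert_fun e S)" by (rule smooth_on_vert_fun[OF ob S])
  define A where "A \<longleftrightarrow> d = e \<or> d = - e"
  \<comment> \<open>Around the axis of \<open>rot e\<close> the tangential derivative of
    \<open>vert_fun\<close> changes sign, and so does the product of the coordinates, which is
    \<open>- (l * l * t)\<close> there instead of \<open>l * l * t\<close>.\<close>
  define \<epsilon> where "\<epsilon> = (if A then \<sigma> else - \<sigma>)"
  have L: "\<Lambda> (d + t *\<^sub>R rot d) > 0" for t using \<Lambda>[OF gl(1)] by blast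
  have co: "A \<and> (\<exists>l. l \<noteq> 0 \<and> \<gamma> t \<bullet> e = l \<and> \<gamma> t \<bullet> rot e = l * t) \<or>
      \<not> A \<and> (\<exists>l. l \<noteq> 0 \<and> \<gamma> t \<bullet> e = - (l * t) \<and> \<gamma> t \<bullet> rot e = l)" for t
  proof -
    have "rot e \<bullet> e \<noteq> e \<bullet> e" "rot e \<bullet> e \<noteq> (- e) \<bullet> e" "(- rot e) \<bullet> e \<noteq> e \<bullet> e"
      using ee by simp_all
    then have ne: "rot e \<noteq> e" "rot e \<noteq> - e" "- rot e \<noteq> e" by metis+
    from d consider "d = e" | "d = - e" | "d = rot e" | "d = - rot e" by blast
    then show ?thesis
    proof cases
      case 1 then show ?thesis using L[of t] ee
        by (intro disjI1 conjI exI[of _ "\<Lambda> (d + t *\<^sub>R rot d)"]) (auto simp: A_def \<gamma>_def inner_add_left)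
    next
      case 2 then show ?thesis using L[of t] ee
        by (intro disjI1 conjI exI[of _ "- \<Lambda> (d + t *\<^sub>R rot d)"]) (auto simp: A_def \<gamma>_def inner_add_left inner_diff_left rm)
    next
      case 3 then show ?thesis using L[of t] ee ne
        by (intro disjI2 conjI exI[of _ "\<Lambda> (d + t *\<^sub>R rot d)"]) (auto simp: A_def \<gamma>_def inner_add_left inner_diff_left)
    next
      case 4 then show ?thesis using L[of t] ee ne
        by (intro disjI2 conjI exI[of _ "- \<Lambda> (d + t *\<^sub>R rot d)"]) (auto simp: A_def \<gamma>_def inner_add_left inner_diff_left rm)
    qed
  qed
  have \<gamma>r0: "norm (\<gamma> t) < r0" for t using gl(5)[of t] r by simp
  have "\<exists>y>0. ((\<lambda>t. \<epsilon> * vert_fun e S (\<gamma> t)) has_real_derivative y) (at t)" if t: "\<bar>t\<bar> \<le> c" for t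
  proof -
    obtain k where k: "k > 0"
      "((\<lambda>t. vert_fun e S (\<gamma> t)) has_real_derivative k * tangent_deriv e S (vert_fun e S) (\<gamma> t)) (at t)"
      using gl(7)[of t] smV by blast
    have "\<epsilon> * tangent_deriv e S (vert_fun e S) (\<gamma> t) > 0"
      using co[of t]
    proof (elim disjE conjE exE)
      fix l assume A and l: "l \<noteq> 0" "\<gamma> t \<bullet> e = l" "\<gamma> t \<bullet> rot e = l * t"
      then have "\<epsilon> = \<sigma>" by (simp add: \<epsilon>_def)
      moreover have "\<bar>\<gamma> t \<bullet> rot e\<bar> \<le> c * \<bar>\<gamma> t \<bullet> e\<bar>"
        using l t mult_left_mono[of "\<bar>t\<bar>" c "\<bar>l\<bar>"] by (simp add: abs_mult mult.commute)
      ultimately show ?thesis using dvert_pos[OF gl(4) \<gamma>r0] by simp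
    next
      fix l assume "\<not> A" and l: "l \<noteq> 0" "\<gamma> t \<bullet> e = - (l * t)" "\<gamma> t \<bullet> rot e = l"
      then have "\<epsilon> = - \<sigma>" by (simp add: \<epsilon>_def)
      moreover have "\<bar>\<gamma> t \<bullet> e\<bar> \<le> c * \<bar>\<gamma> t \<bullet> rot e\<bar>"
        using l t mult_left_mono[of "\<bar>t\<bar>" c "\<bar>l\<bar>"] by (simp add: abs_mult mult.commute)
      ultimately show ?thesis using dvert_neg[OF gl(4) \<gamma>r0] by simp
    qed
    then have "k * (\<epsilon> * tangent_deriv e S (vert_fun e S) (\<gamma> t)) > 0" using k(1) by simp
    moreover have "((\<lambda>t. \<epsilon> * vert_fun e S (\<gamma> t)) has_real_derivative
        k * (\<epsilon> * tangent_deriv e S (vert_fun e S) (\<gamma> t))) (at t)"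
      using DERIV_cmult[OF k(2), of \<epsilon>] by (simp add: mult_ac)
    ultimately show ?thesis by blast
  qed
  moreover have end_sgn: "0 < t * (\<epsilon> * vert_fun e S (\<gamma> t))" if t: "\<bar>t\<bar> = c" for t
  proof -
    have t0: "t \<noteq> 0" "\<bar>t\<bar> \<le> 1" using t c by auto
    \<comment> \<open>On the boundary rays one inequality of the outer region is an equality, and
      the other holds since \<open>c \<le> 1\<close>.\<close>
    have cc: "c * (\<bar>l\<bar> * \<bar>t\<bar>) \<le> \<bar>l\<bar>" "c * \<bar>l\<bar> \<le> \<bar>l\<bar> * \<bar>t\<bar>" for l :: real
    proof -
      have "c * \<bar>t\<bar> * \<bar>l\<bar> \<le> 1 * \<bar>l\<bar>"
        by (rule mult_right_mono) (use c t in \<open>auto intro: mult_le_one\<close>)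
      then show "c * (\<bar>l\<bar> * \<bar>t\<bar>) \<le> \<bar>l\<bar>" by (simp add: mult_ac)
      show "c * \<bar>l\<bar> \<le> \<bar>l\<bar> * \<bar>t\<bar>" using t by (simp add: mult.commute)
    qed
    have key: "0 < t * (\<epsilon> * vert_fun e S (\<gamma> t))"
      if "c * \<bar>\<gamma> t \<bullet> e\<bar> \<le> \<bar>\<gamma> t \<bullet> rot e\<bar>" "c * \<bar>\<gamma> t \<bullet> rot e\<bar> \<le> \<bar>\<gamma> t \<bullet> e\<bar>" "l \<noteq> 0"
        "\<epsilon> = \<sigma> \<and> (\<gamma> t \<bullet> e) * (\<gamma> t \<bullet> rot e) = l * l * t \<or> \<epsilon> = - \<sigma> \<and> (\<gamma> t \<bullet> e) * (\<gamma> t \<bullet> rot e) = - (l * l * t)" for l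
    proof -
      have ll: "l * l > 0" using that(3) not_real_square_gt_zero[of l] by blast
      have vp: "(\<gamma> t \<bullet> e) * (\<gamma> t \<bullet> rot e) > 0 \<Longrightarrow> \<sigma> * vert_fun e S (\<gamma> t) > 0"
        "(\<gamma> t \<bullet> e) * (\<gamma> t \<bullet> rot e) < 0 \<Longrightarrow> \<sigma> * vert_fun e S (\<gamma> t) < 0"
        using vert_pos[OF gl(4) \<gamma>r0 that(1,2)] vert_neg[OF gl(4) \<gamma>r0 that(1,2)] by auto
      consider "t > 0" | "t < 0" using t0 by linarith
      then show ?thesis
      proof cases
        case 1
        then have "l * l * t > 0" using ll by simp
        then have "\<epsilon> * vert_fun e S (\<gamma> t) > 0" using that(4)
          by (elim disjE conjE) (simp_all only: minus_mult_left[symmetric] neg_less_0_iff_less neg_0_less_iff_less vp)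
        with 1 show ?thesis by (rule mult_pos_pos)
      next
        case 2
        then have "l * l * t < 0" using ll by (simp add: mult_pos_neg)
        then have "\<epsilon> * vert_fun e S (\<gamma> t) < 0" using that(4)
          by (elim disjE conjE) (simp_all only: minus_mult_left[symmetric] neg_less_0_iff_less neg_0_less_iff_less vp)
        with 2 show ?thesis by (rule mult_neg_neg)
      qed
    qed
    show ?thesis using co[of t]
    proof (elim disjE conjE exE)
      fix l assume A and l: "l \<noteq> 0" "\<gamma> t \<bullet> e = l" "\<gamma> t \<bullet> rot e = l * t"
      then have "\<epsilon> = \<sigma>" by (simp add: \<epsilon>_def)
      then show ?thesis using cc[of l] l by (intro key[of l]) (auto simp: abs_mult)
    next
      fix l assume "\<not> A" and l: "l \<noteq> 0" "\<gamma> t \<bullet> e = - (l * t)" "\<gamma> t \<bullet> rot e = l"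
      then have "\<epsilon> = - \<sigma>" by (simp add: \<epsilon>_def)
      then show ?thesis using cc[of l] l by (intro key[of l]) (auto simp: abs_mult)
    qed
  qed
  have "\<epsilon> * vert_fun e S (\<gamma> (- c)) < 0" "\<epsilon> * vert_fun e S (\<gamma> c) > 0"
    using end_sgn[of c] end_sgn[of "- c"] c(1) by (auto simp: zero_less_mult_iff mult_less_0_iff)
  ultimately obtain m where m: "\<bar>m\<bar> \<le> c \<and> \<epsilon> * vert_fun e S (\<gamma> m) = 0 \<and>
    (\<forall>t. \<bar>t\<bar> \<le> c \<longrightarrow> \<epsilon> * vert_fun e S (\<gamma> t) = 0 \<longrightarrow> t = m)"
    by (rule unique_zero_of_increasing[OF c(1), THEN exE])
  have "\<epsilon> \<noteq> 0" using end_sgn[of c] c(1) by auto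
  then show ?thesis using m by (intro exI[of _ m]) (simp add: \<gamma>_def[symmetric])
qed

lemma oval_of_level_set:
  assumes g: "\<And>p. norm p < r \<Longrightarrow> g p = 0 \<longleftrightarrow> S p = s"
    and greg: "\<And>p. norm p < r \<Longrightarrow> g p = 0 \<Longrightarrow> p \<noteq> 0 \<Longrightarrow> \<not> (g has_derivative (\<lambda>_. 0)) (at p)"
  shows "oval r g"
proof -
  have cu: "curve r g = {p. p \<noteq> 0 \<and> \<Lambda> p = 1}"
  proof (intro set_eqI iffI)
    fix p assume "p \<in> curve r g"
    then have p: "norm p < r" "S p = s" using g[of p] by (simp_all add: curve_def)
    then have "p \<noteq> 0" using s S0 by auto
    then show "p \<in> {p. p \<noteq> 0 \<and> \<Lambda> p = 1}" using gauge_less(3)[of p 1] p r by simp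
  next
    fix p assume "p \<in> {p. p \<noteq> 0 \<and> \<Lambda> p = 1}"
    then have "norm p \<le> r / 2" "S p = s" using \<Lambda>[of p] by auto
    then show "p \<in> curve r g" using g r by (auto simp: curve_def)
  qed
  have "\<not> (g has_derivative (\<lambda>_. 0)) (at p)" if "p \<in> curve r g" for p
    using greg[of p] g[of p] that s S0 by (cases "p = 0") (simp_all add: curve_def)
  then have sing: "singular_points r g = {}"
    unfolding singular_points_def by blast
  then have regp: "regular_points r g = curve r g" by (simp add: regular_points_def)
  \<comment> \<open>\<open>local_param\<close> constrains \<open>\<gamma>\<close> only through
    \<open>g\<close>. On a shorter interval \<open>\<gamma>\<close> stays in the ball and off the
    origin, and so runs in the level set of \<open>S\<close>.\<close>
  have curv: "(curvature \<gamma> 0 = 0 \<longleftrightarrow> infl_fun e S p = 0) \<and>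
      ((curvature \<gamma> has_real_derivative 0) (at 0) \<longleftrightarrow> vert_fun e S p = 0)"
    if p: "p \<in> curve r g" and lp: "local_param g p \<gamma>" for p \<gamma>
  proof -
    obtain d where d: "d > 0" "smooth_on {-d<..<d} \<gamma>"
      "\<And>t. t \<in> {-d<..<d} \<Longrightarrow> g (\<gamma> t) = 0 \<and> vector_derivative \<gamma> (at t) \<noteq> 0" and \<gamma>0: "\<gamma> 0 = p"
      using lp unfolding local_param_def by auto
    have "isCont \<gamma> 0" using smooth_on_isCont[OF d(2)] d(1) by simp
    moreover have "norm (\<gamma> 0) < r" using p \<gamma>0 by (simp add: curve_def)
    moreover have "\<gamma> 0 \<noteq> 0" using p \<gamma>0 cu by auto
    ultimately have "\<forall>\<^sub>F t in at 0. norm (\<gamma> t) < r \<and> \<gamma> t \<noteq> 0"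
      unfolding isCont_def
      by (intro eventually_conj order_tendstoD(2)[OF tendsto_norm] tendsto_imp_eventually_ne) auto
    then obtain d' where d': "d' > 0" "\<And>t. t \<noteq> 0 \<Longrightarrow> \<bar>t\<bar> < d' \<Longrightarrow> norm (\<gamma> t) < r \<and> \<gamma> t \<noteq> 0"
      by (auto simp: eventually_at dist_real_def)
    define d1 where "d1 = min d d'"
    have \<gamma>t: "norm (\<gamma> t) < r \<and> \<gamma> t \<noteq> 0" if "\<bar>t\<bar> < d1" for t
      using d'(2)[of t] that \<open>norm (\<gamma> 0) < r\<close> \<open>\<gamma> 0 \<noteq> 0\<close> by (cases "t = 0") (auto simp: d1_def)
    have hyps: "d1 > 0" "smooth_on {-d1<..<d1} \<gamma>"
      "\<And>t. \<bar>t\<bar> < d1 \<Longrightarrow> vector_derivative \<gamma> (at t) \<noteq> 0" "\<And>t. \<bar>t\<bar> < d1 \<Longrightarrow> \<gamma> t \<in> ball 0 r0"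
      "\<And>t. \<bar>t\<bar> < d1 \<Longrightarrow> S (\<gamma> t) = s"
      "\<And>t. \<bar>t\<bar> < d1 \<Longrightarrow> (dirderiv e S (\<gamma> t))\<^sup>2 + (dirderiv (rot e) S (\<gamma> t))\<^sup>2 > 0"
    proof -
      show "d1 > 0" using d d' by (simp add: d1_def)
      show "smooth_on {-d1<..<d1} \<gamma>" by (rule smooth_on_subset[OF d(2)]) (auto simp: d1_def)
      fix t assume t: "\<bar>t\<bar> < d1"
      then have td: "t \<in> {-d<..<d}" by (auto simp: d1_def)
      show "vector_derivative \<gamma> (at t) \<noteq> 0" using d(3)[OF td] by blast
      show "\<gamma> t \<in> ball 0 r0" using \<gamma>t[OF t] r by simp
      show "S (\<gamma> t) = s" using d(3)[OF td] g \<gamma>t[OF t] by blast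
      show "(dirderiv e S (\<gamma> t))\<^sup>2 + (dirderiv (rot e) S (\<gamma> t))\<^sup>2 > 0"
        by (rule grad_pos) (use \<gamma>t[OF t] r in auto)
    qed
    show ?thesis
      using curvature_zero_iff[OF ob S e hyps] curvature_stationary_iff[OF ob S e hyps] \<gamma>0 by simp
  qed
  \<comment> \<open>\<open>vertices\<close> asks for some parametrisation; the line through
    \<open>p\<close> in the direction \<open>rot p\<close>, projected to the level set, provides
    one.\<close>
  have param: "\<exists>\<gamma>. local_param g p \<gamma>" if p: "p \<in> curve r g" for p
  proof -
    have p0: "p \<noteq> 0" "\<Lambda> p = 1" using p cu by auto
    have "rot p \<bullet> rot p > 0" using p0 by (simp add: rot_def prod_eq_iff inner_prod_def)
      (metis prod.collapse sum_squares_gt_zero_iff zero_prod_def)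
    note gl = gauge_line[OF this]
    show ?thesis
    proof (intro exI)
      show "local_param g p (\<lambda>t. \<Lambda> (p + t *\<^sub>R rot p) *\<^sub>R (p + t *\<^sub>R rot p))"
        unfolding local_param_def
      proof (intro conjI exI[of _ 1] ballI)
        fix t :: real
        have "norm (\<Lambda> (p + t *\<^sub>R rot p) *\<^sub>R (p + t *\<^sub>R rot p)) < r" using gl(5)[of t] r by linarith
        then show "g (\<Lambda> (p + t *\<^sub>R rot p) *\<^sub>R (p + t *\<^sub>R rot p)) = 0" using g gl(3)[of t] by blast
        show "vector_derivative (\<lambda>t. \<Lambda> (p + t *\<^sub>R rot p) *\<^sub>R (p + t *\<^sub>R rot p)) (at t) \<noteq> 0" by (rule gl(6))
      qed (use p0 smooth_on_subset[OF gl(2)] in auto)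
    qed
  qed
  have nb: "p \<noteq> 0 \<and> norm p < r0" if "p \<in> curve r g" for p using that cu r by (auto simp: curve_def)
  have inf: "inflections r g = {}"
    unfolding inflections_def regp using curv infl nb by force
  have vert: "vertices r g = {p \<in> curve r g. vert_fun e S p = 0}"
    unfolding vertices_def regp using curv param by blast
  have rm: "rot (- p) = - rot p" for p by (simp add: rot_def)
  \<comment> \<open>Each sector contributes the slope of its only vertex; the signs come from
    \<open>rot (rot e) = - e\<close>.\<close>
  obtain m0 where "\<bar>m0\<bar> \<le> c \<and> vert_fun e S (\<Lambda> (e + m0 *\<^sub>R rot e) *\<^sub>R (e + m0 *\<^sub>R rot e)) = 0 \<and>
      (\<forall>t. \<bar>t\<bar> \<le> c \<longrightarrow> vert_fun e S (\<Lambda> (e + t *\<^sub>R rot e) *\<^sub>R (e + t *\<^sub>R rot e)) = 0 \<longrightarrow> t = m0)"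
    by (rule exE[OF sector_vertex[of "e", OF disjI1[OF refl]]])
  note m0 = this[THEN conjunct1] this[THEN conjunct2, THEN conjunct1]
    this[THEN conjunct2, THEN conjunct2, rule_format]
  obtain m1 where "\<bar>m1\<bar> \<le> c \<and> vert_fun e S (\<Lambda> (rot e - m1 *\<^sub>R e) *\<^sub>R (rot e - m1 *\<^sub>R e)) = 0 \<and>
      (\<forall>t. \<bar>t\<bar> \<le> c \<longrightarrow> vert_fun e S (\<Lambda> (rot e - t *\<^sub>R e) *\<^sub>R (rot e - t *\<^sub>R e)) = 0 \<longrightarrow> t = m1)"
    by (rule exE[OF sector_vertex[of "rot e", OF disjI2[OF disjI1[OF refl]]], unfolded rot_simps(4) scaleR_minus_right add_uminus_conv_diff])
  note m1 = this[THEN conjunct1] this[THEN conjunct2, THEN conjunct1]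
    this[THEN conjunct2, THEN conjunct2, rule_format]
  obtain m2 where "\<bar>m2\<bar> \<le> c \<and> vert_fun e S (\<Lambda> (- e - m2 *\<^sub>R rot e) *\<^sub>R (- e - m2 *\<^sub>R rot e)) = 0 \<and>
      (\<forall>t. \<bar>t\<bar> \<le> c \<longrightarrow> vert_fun e S (\<Lambda> (- e - t *\<^sub>R rot e) *\<^sub>R (- e - t *\<^sub>R rot e)) = 0 \<longrightarrow> t = m2)"
    by (rule exE[OF sector_vertex[of "- e", OF disjI2[OF disjI2[OF disjI1[OF refl]]]], unfolded rm scaleR_minus_right add_uminus_conv_diff])
  note m2 = this[THEN conjunct1] this[THEN conjunct2, THEN conjunct1]
    this[THEN conjunct2, THEN conjunct2, rule_format]
  obtain m3 where "\<bar>m3\<bar> \<le> c \<and> vert_fun e S (\<Lambda> (- rot e + m3 *\<^sub>R e) *\<^sub>R (- rot e + m3 *\<^sub>R e)) = 0 \<and>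
      (\<forall>t. \<bar>t\<bar> \<le> c \<longrightarrow> vert_fun e S (\<Lambda> (- rot e + t *\<^sub>R e) *\<^sub>R (- rot e + t *\<^sub>R e)) = 0 \<longrightarrow> t = m3)"
    by (rule exE[OF sector_vertex[of "- rot e", OF disjI2[OF disjI2[OF disjI2[OF refl]]]], unfolded rm rot_simps(4) minus_minus])
  note m3 = this[THEN conjunct1] this[THEN conjunct2, THEN conjunct1]
    this[THEN conjunct2, THEN conjunct2, rule_format]
  let ?D = "{e + m0 *\<^sub>R rot e, rot e - m1 *\<^sub>R e, - e - m2 *\<^sub>R rot e, - rot e + m3 *\<^sub>R e}"
  have vset: "vertices r g = (\<lambda>w. \<Lambda> w *\<^sub>R w) ` ?D"
  proof
    show "vertices r g \<subseteq> (\<lambda>w. \<Lambda> w *\<^sub>R w) ` ?D"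
    proof
      fix p assume "p \<in> vertices r g"
      then have p: "p \<in> curve r g" "vert_fun e S p = 0" using vert by auto
      have p0: "p \<noteq> 0" "\<Lambda> p = 1" using p(1) cu by auto
      define x y where "x = p \<bullet> e" and "y = p \<bullet> rot e"
      have pe: "p = x *\<^sub>R e + y *\<^sub>R rot e" unfolding x_def y_def by (rule frame_coordinates(3)[OF e])
      have sect: "\<Lambda> w *\<^sub>R w = p" if "p = l *\<^sub>R w" "l > 0" for l w
      proof -
        have "w \<noteq> 0" using that p0 by auto
        then show ?thesis using gauge_scale[of w l] that p0 by (simp add: field_simps)
      qed
      \<comment> \<open>Between the sectors one coordinate can vanish only together with the other,
        so \<open>x * y\<close> has a sign there and \<open>vert_fun\<close> is not zero.\<close>
      have "\<not> (c * \<bar>x\<bar> \<le> \<bar>y\<bar> \<and> c * \<bar>y\<bar> \<le> \<bar>x\<bar>)"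
      proof
        assume h: "c * \<bar>x\<bar> \<le> \<bar>y\<bar> \<and> c * \<bar>y\<bar> \<le> \<bar>x\<bar>"
        have "x \<noteq> 0 \<and> y \<noteq> 0"
        proof (rule ccontr)
          assume "\<not> (x \<noteq> 0 \<and> y \<noteq> 0)"
          then have "x = 0 \<and> y = 0" using h c by (auto simp: mult_le_0_iff)
          then show False using pe p0 by simp
        qed
        then have "x * y > 0 \<or> x * y < 0" by (auto simp: zero_less_mult_iff mult_less_0_iff)
        then show False
          using vert_pos[of p] vert_neg[of p] nb[OF p(1)] p(2) h by (auto simp: x_def y_def)
      qed
      then consider "\<bar>y\<bar> \<le> c * x" "x > 0" | "\<bar>y\<bar> \<le> c * (- x)" "x < 0" | "\<bar>x\<bar> \<le> c * y" "y > 0" | "\<bar>x\<bar> \<le> c * (- y)" "y < 0"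
        using c(1) by (cases "x = 0"; cases "y = 0"; fastforce simp: abs_if split: if_splits)
      then show "p \<in> (\<lambda>w. \<Lambda> w *\<^sub>R w) ` ?D"
      proof cases
        case 1
        have "p = x *\<^sub>R (e + (y / x) *\<^sub>R rot e)" using 1 by (subst pe) (simp add: scaleR_add_right)
        note w = sect[OF this 1(2)]
        have "\<bar>y / x\<bar> \<le> c" using 1 by (simp add: abs_divide pos_divide_le_eq)
        from m0(3)[OF this] w p(2) have "y / x = m0" by simp
        with w show ?thesis by (intro image_eqI[of _ _ "e + (y / x) *\<^sub>R rot e"]) auto
      next
        case 2
        have "p = (- x) *\<^sub>R (- e - (y / x) *\<^sub>R rot e)" using 2 by (subst pe) (simp add: scaleR_diff_right)
        note w = sect[OF this]
        have "\<bar>y / x\<bar> \<le> c"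
          using 2 by (simp only: abs_divide abs_of_neg pos_divide_le_eq neg_0_less_iff_less)
        from m2(3)[OF this] w 2 p(2) have "y / x = m2" by simp
        with w 2 show ?thesis by (intro image_eqI[of _ _ "- e - (y / x) *\<^sub>R rot e"]) auto
      next
        case 3
        have "p = y *\<^sub>R (rot e - (- (x / y)) *\<^sub>R e)" using 3 by (subst pe) (simp add: scaleR_add_right)
        note w = sect[OF this 3(2)]
        have "\<bar>- (x / y)\<bar> \<le> c" using 3 by (simp add: abs_divide pos_divide_le_eq)
        from m1(3)[OF this] w p(2) have "- (x / y) = m1" by simp
        with w show ?thesis by (intro image_eqI[of _ _ "rot e - (- (x / y)) *\<^sub>R e"]) auto
      next
        case 4
        have "p = (- y) *\<^sub>R (- rot e + (- (x / y)) *\<^sub>R e)" using 4 by (subst pe) (simp add: scaleR_diff_right)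
        note w = sect[OF this]
        have "\<bar>- (x / y)\<bar> \<le> c"
          using 4 by (simp only: abs_minus_cancel abs_divide abs_of_neg pos_divide_le_eq neg_0_less_iff_less)
        from m3(3)[OF this] w 4 p(2) have "- (x / y) = m3" by simp
        with w 4 show ?thesis by (intro image_eqI[of _ _ "- rot e + (- (x / y)) *\<^sub>R e"]) auto
      qed
    qed
    have ee: "e \<bullet> e = 1" "rot e \<bullet> rot e = 1" "rot e \<bullet> e = 0" "e \<bullet> rot e = 0"
      by (rule frame_inner[OF e])+
    have oncurve: "\<Lambda> w *\<^sub>R w \<in> curve r g" if "w \<noteq> 0" for w
      using \<Lambda>[OF that] gauge_scale[OF that, of "\<Lambda> w"] that by (simp add: cu)
    have "(e + m0 *\<^sub>R rot e) \<bullet> e \<noteq> 0" "(rot e - m1 *\<^sub>R e) \<bullet> rot e \<noteq> 0" "(- e - m2 *\<^sub>R rot e) \<bullet> e \<noteq> 0"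
      "(- rot e + m3 *\<^sub>R e) \<bullet> rot e \<noteq> 0"
      using ee by (simp_all add: inner_add_left inner_diff_left)
    then have "w \<noteq> 0" if "w \<in> ?D" for w using that by auto
    then show "(\<lambda>w. \<Lambda> w *\<^sub>R w) ` ?D \<subseteq> vertices r g"
      unfolding vert using oncurve m0(2) m1(2) m2(2) m3(2) by blast
  qed
  have bd: "\<forall>p. p \<noteq> 0 \<longrightarrow> \<Lambda> p > 0 \<and> norm (\<Lambda> p *\<^sub>R p) \<le> r / 2"
  proof (intro allI impI)
    fix p :: "real \<times> real" assume "p \<noteq> 0"
    from \<Lambda>[OF this] show "\<Lambda> p > 0 \<and> norm (\<Lambda> p *\<^sub>R p) \<le> r / 2" by simp
  qed
  have sc: "\<forall>p k. p \<noteq> 0 \<longrightarrow> k > 0 \<longrightarrow> \<Lambda> (k *\<^sub>R p) = \<Lambda> p / k"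
    using gauge_scale by blast
  have "oval_with r g \<Lambda> e m0 m1 m2 m3"
    unfolding oval_with_def
    by (intro conjI sing inf gauge_smooth bd sc cu e vset order_trans[OF m0(1) c(2)]
        order_trans[OF m1(1) c(2)] order_trans[OF m2(1) c(2)] order_trans[OF m3(1) c(2)])
  then show ?thesis unfolding oval_def by blast
qed

end

lemma level_set_configuration:
  assumes r: "0 < r" "r < r0"
  shows "\<exists>\<delta>>0. level_configuration S r \<delta>"
proof -
  obtain \<delta> where \<delta>: "\<delta> > 0" "\<And>s p. 0 < s \<Longrightarrow> s < \<delta> \<Longrightarrow> p \<noteq> 0 \<Longrightarrow>
     \<exists>t. 0 < t \<and> t * norm p \<le> r / 2 \<and> S (t *\<^sub>R p) = s"
    using gauge_exists[OF r] by metis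
  show ?thesis
    unfolding level_configuration_def
  proof (intro exI[of _ \<delta>] conjI \<delta>(1) allI impI)
    fix g :: "real \<times> real \<Rightarrow> real" and s
    assume g: "\<forall>p. norm p < r \<longrightarrow> (g p = 0 \<longleftrightarrow> S p = s)"
      "\<forall>p. norm p < r \<longrightarrow> g p = 0 \<longrightarrow> p \<noteq> 0 \<longrightarrow> \<not> (g has_derivative (\<lambda>_. 0)) (at p)"
    show "oval r g" if "0 < s \<and> s < \<delta>"
    proof -
      have s: "0 < s" "s < \<delta>" using that by auto
      obtain \<Lambda> where "\<And>p. p \<noteq> 0 \<Longrightarrow> 0 < \<Lambda> p \<and> \<Lambda> p * norm p \<le> r / 2 \<and> S (\<Lambda> p *\<^sub>R p) = s"
        using \<delta>(2)[OF s] by metis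
      from oval_of_level_set[OF r s(1) this g[rule_format]] show ?thesis .
    qed
    have cu: "curve r g = {p. norm p < r \<and> S p = s}"
      unfolding curve_def by (intro Collect_cong conj_cong) (simp_all add: g(1)[rule_format])
    have pos: "S p > 0" if "norm p < r" "p \<noteq> 0" for p
      using S_pos[of p] that r by simp
    show "curve r g = {}" if "s < 0"
    proof -
      have "S p \<noteq> s" if "norm p < r" for p
        using pos[OF that] S0 \<open>s < 0\<close> by (cases "p = 0") auto
      then show ?thesis unfolding cu by blast
    qed
    show "curve r g = {0}" if "s = 0"
    proof (intro set_eqI iffI)
      fix p assume "p \<in> curve r g"
      then show "p \<in> {0}" using pos[of p] that unfolding cu by (cases "p = 0") simp_all
    next
      fix p :: "real \<times> real" assume "p \<in> {0}"
      then show "p \<in> curve r g" using S0 that r unfolding cu by simp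
    qed
  qed
qed

end

section \<open>From leading terms to sign conditions\<close>

lemma frame_norm:
  assumes "norm e = 1" shows "(norm p)\<^sup>2 = (p \<bullet> e)\<^sup>2 + (p \<bullet> rot e)\<^sup>2"
proof -
  define x y where "x = p \<bullet> e" and "y = p \<bullet> rot e"
  have "p \<bullet> p = (x *\<^sub>R e + y *\<^sub>R rot e) \<bullet> (x *\<^sub>R e + y *\<^sub>R rot e)"
    unfolding x_def y_def by (simp only: frame_coordinates(3)[OF assms, symmetric])
  also have "\<dots> = x\<^sup>2 + y\<^sup>2"
    using frame_inner[OF assms] by (simp add: inner_add_left inner_add_right power2_eq_square)
  finally show ?thesis by (simp add: power2_norm_eq_inner x_def y_def)
qed

text \<open>A sign condition holds near the origin once the leading term in question is at least a
  positive multiple of the matching power of \<open>norm p\<close> on its sector; the inequalities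
  below provide these multiples.\<close>

lemma minimum_configuration_frame:
  fixes S :: "real \<times> real \<Rightarrow> real"
  assumes U: "open U" "0 \<in> U" and S: "smooth_on U S" and S0: "S 0 = 0" and e: "norm e = 1"
    and crit: "dirderiv e S 0 = 0" "dirderiv (rot e) S 0 = 0"
    and hess: "dirderiv e (dirderiv e S) 0 = a" "dirderiv (rot e) (dirderiv e S) 0 = 0"
      "dirderiv e (dirderiv (rot e) S) 0 = 0" "dirderiv (rot e) (dirderiv (rot e) S) 0 = b"
    and ab: "a > 0" "b > 0" "a \<noteq> b"
  shows "\<exists>r0>0. ball 0 r0 \<subseteq> U \<and> (\<forall>p. p \<noteq> 0 \<longrightarrow> norm p < r0 \<longrightarrow> \<not> (S has_derivative (\<lambda>_. 0)) (at p)) \<and>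
    (\<forall>r. 0 < r \<longrightarrow> r < r0 \<longrightarrow> (\<exists>\<delta>>0. level_configuration S r \<delta>))"
proof -
  \<comment> \<open>\<open>1/8\<close> is the slope allowed in an oval; the other two bounds make
    \<open>a x^2\<close> dominate \<open>b y^2\<close> in the sectors around the first axis, and
    conversely around the second.\<close>
  define c where "c = min (1/8) (min (a / (2 * b)) (b / (2 * a)))"
  have c: "0 < c" "c \<le> 1/8" using ab by (auto simp: c_def)
  have cb: "b * c \<le> a / 2" "a * c \<le> b / 2"
  proof -
    have "c \<le> a / (2 * b)" "c \<le> b / (2 * a)" by (auto simp: c_def)
    then show "b * c \<le> a / 2" "a * c \<le> b / 2" using ab by (simp_all add: field_simps)
  qed
  have cc: "c * c \<le> c" using c by (simp add: mult_left_le)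
  \<comment> \<open>The sign of \<open>a - b\<close>, which turns the common factor of the two
    quartic leading terms into \<open>K > 0\<close>.\<close>
  define \<sigma> :: real where "\<sigma> = (if a > b then 1 else - 1)"
  define K where "K = 3 * a\<^sup>2 * b\<^sup>2 * \<bar>a - b\<bar>"
  have K: "K > 0" using ab by (simp add: K_def)
  have \<sigma>K: "\<sigma> * (- 3 * a\<^sup>2 * b\<^sup>2 * (b - a) * t) = K * t" for t
    using ab by (simp add: \<sigma>_def K_def abs_if algebra_simps)
  define m where "m = min a b"
  have m: "m > 0" "m \<le> a" "m \<le> b" using ab by (auto simp: m_def)
  define x y where "x p = p \<bullet> e" and "y p = p \<bullet> rot e" for p
  have nrm: "(norm p)\<^sup>2 = (x p)\<^sup>2 + (y p)\<^sup>2" for p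
    unfolding x_def y_def by (rule frame_norm[OF e])
  have q0: "m * (norm p)\<^sup>2 \<le> a * (x p)\<^sup>2 + b * (y p)\<^sup>2" for p
    unfolding nrm distrib_left using m by (intro add_mono mult_right_mono) auto
  have n4: "norm p ^ 4 = (norm p)\<^sup>2 * (norm p)\<^sup>2" for p :: "real \<times> real"
    by (simp add: power2_eq_square eval_nat_numeral)
  \<comment> \<open>Both quartic leading terms have the form
    \<open>K * ((a x^2 + b y^2) * t)\<close>; only the lower bound on \<open>t\<close> depends on
    the sector.\<close>
  have q4: "K * m * l * norm p ^ 4 \<le> K * ((a * (x p)\<^sup>2 + b * (y p)\<^sup>2) * t)" if "l * (norm p)\<^sup>2 \<le> t" "0 \<le> l" for l t p
  proof -
    have "(m * (norm p)\<^sup>2) * (l * (norm p)\<^sup>2) \<le> (a * (x p)\<^sup>2 + b * (y p)\<^sup>2) * t"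
      by (rule mult_mono[OF q0 that(1)]) (use ab that(2) in simp_all)
    then have "K * ((m * (norm p)\<^sup>2) * (l * (norm p)\<^sup>2)) \<le> K * ((a * (x p)\<^sup>2 + b * (y p)\<^sup>2) * t)"
      by (rule mult_left_mono) (use K in simp)
    then show ?thesis by (simp only: n4 mult_ac)
  qed
  note asm = U S e crit hess
  have ax: "approx 1 x x" "approx 1 y y"
    unfolding x_def y_def
    by (rule approx_derivative[OF bounded_linear_imp_has_derivative[OF bounded_linear_inner_left]]; simp)+
  have "approx 2 (\<lambda>p. x p * dirderiv e S p + y p * dirderiv (rot e) S p) (\<lambda>p. x p * (a * x p) + y p * (b * y p))"
    using approx_add[OF approx_mult[OF ax(1) approx_gradient(1)[OF asm]] approx_mult[OF ax(2) approx_gradient(2)[OF asm]]]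
    by (simp add: x_def y_def numeral_2_eq_2)
  from approx_eventually_pos[OF this m(1)]
  have e1: "\<forall>\<^sub>F p in at 0. x p * dirderiv e S p + y p * dirderiv (rot e) S p > 0"
    by eventually_elim (use q0 in \<open>simp add: power2_eq_square mult_ac\<close>)
  have "a * b * m > 0" using ab m by simp
  from approx_eventually_pos[OF approx_infl_fun[OF asm] this]
  have e2: "\<forall>\<^sub>F p in at 0. infl_fun e S p > 0"
  proof eventually_elim
    case (elim p)
    have "a * b * (m * (norm p)\<^sup>2) \<le> a * b * (a * (x p)\<^sup>2 + b * (y p)\<^sup>2)"
      using q0[of p] ab by (intro mult_left_mono) auto
    then show ?case using elim by (simp add: x_def y_def mult_ac)
  qed
  have V: "approx 4 (\<lambda>p. \<sigma> * vert_fun e S p) (\<lambda>p. K * ((a * (x p)\<^sup>2 + b * (y p)\<^sup>2) * (x p * y p)))"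
    using approx_cmult[OF approx_vert_fun[OF asm], of \<sigma>]
    unfolding x_def[symmetric] y_def[symmetric] by (simp only: \<sigma>K mult.assoc[of "- 3 * a\<^sup>2 * b\<^sup>2 * (b - a)"])
  have DV: "approx 4 (\<lambda>p. \<sigma> * tangent_deriv e S (vert_fun e S) p)
      (\<lambda>p. K * ((a * (x p)\<^sup>2 + b * (y p)\<^sup>2) * (a * (x p)\<^sup>2 - b * (y p)\<^sup>2)))"
    using approx_cmult[OF approx_tangent_deriv_vert_fun[OF asm], of \<sigma>]
    unfolding x_def[symmetric] y_def[symmetric] by (simp only: \<sigma>K mult.assoc[of "- 3 * a\<^sup>2 * b\<^sup>2 * (b - a)"])
  \<comment> \<open>\<open>approx_eventually_pos\<close> yields positivity, so negative signs are
    obtained from the negated functions.\<close>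
  have V': "approx 4 (\<lambda>p. - 1 * (\<sigma> * vert_fun e S p)) (\<lambda>p. - 1 * (K * ((a * (x p)\<^sup>2 + b * (y p)\<^sup>2) * (x p * y p))))"
    and DV': "approx 4 (\<lambda>p. - 1 * (\<sigma> * tangent_deriv e S (vert_fun e S) p))
      (\<lambda>p. - 1 * (K * ((a * (x p)\<^sup>2 + b * (y p)\<^sup>2) * (a * (x p)\<^sup>2 - b * (y p)\<^sup>2))))"
    by (intro approx_cmult V DV)+
  have xy: "c / 2 * (norm p)\<^sup>2 \<le> \<bar>x p * y p\<bar>" if h: "c * \<bar>x p\<bar> \<le> \<bar>y p\<bar>" "c * \<bar>y p\<bar> \<le> \<bar>x p\<bar>" for p
  proof -
    have "c * \<bar>x p\<bar> * \<bar>x p\<bar> \<le> \<bar>y p\<bar> * \<bar>x p\<bar>" "c * \<bar>y p\<bar> * \<bar>y p\<bar> \<le> \<bar>x p\<bar> * \<bar>y p\<bar>"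
      using h by (intro mult_right_mono; simp)+
    then have "c * (x p)\<^sup>2 \<le> \<bar>x p * y p\<bar>" "c * (y p)\<^sup>2 \<le> \<bar>x p * y p\<bar>"
      by (simp_all add: power2_eq_square abs_mult mult_ac)
    note s = add_mono[OF this]
    have "c / 2 * (norm p)\<^sup>2 = (c * (x p)\<^sup>2 + c * (y p)\<^sup>2) / 2"
      unfolding nrm by (simp add: distrib_left)
    also have "\<dots> \<le> (\<bar>x p * y p\<bar> + \<bar>x p * y p\<bar>) / 2" using s by (rule divide_right_mono) simp
    finally show ?thesis by simp
  qed
  have kc: "K * m * (c / 2) > 0" "K * m * (a / 4) > 0" "K * m * (b / 4) > 0" using K m c ab by auto
  from approx_eventually_pos[OF V kc(1)]
  have e3: "\<forall>\<^sub>F p in at 0. c * \<bar>x p\<bar> \<le> \<bar>y p\<bar> \<longrightarrow> c * \<bar>y p\<bar> \<le> \<bar>x p\<bar> \<longrightarrow> x p * y p > 0 \<longrightarrow> \<sigma> * vert_fun e S p > 0"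
  proof (eventually_elim, intro impI)
    fix p assume *: "K * m * (c / 2) * norm p ^ 4 \<le> K * ((a * (x p)\<^sup>2 + b * (y p)\<^sup>2) * (x p * y p)) \<longrightarrow> 0 < \<sigma> * vert_fun e S p"
      and h: "c * \<bar>x p\<bar> \<le> \<bar>y p\<bar>" "c * \<bar>y p\<bar> \<le> \<bar>x p\<bar>" "x p * y p > 0"
    show "0 < \<sigma> * vert_fun e S p"
      using * q4[of "c / 2" p "x p * y p"] xy[OF h(1,2)] h(3) c by simp
  qed
  from approx_eventually_pos[OF V' kc(1)]
  have e4: "\<forall>\<^sub>F p in at 0. c * \<bar>x p\<bar> \<le> \<bar>y p\<bar> \<longrightarrow> c * \<bar>y p\<bar> \<le> \<bar>x p\<bar> \<longrightarrow> x p * y p < 0 \<longrightarrow> \<sigma> * vert_fun e S p < 0"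
  proof (eventually_elim, intro impI)
    fix p assume *: "K * m * (c / 2) * norm p ^ 4 \<le> - 1 * (K * ((a * (x p)\<^sup>2 + b * (y p)\<^sup>2) * (x p * y p))) \<longrightarrow> 0 < - 1 * (\<sigma> * vert_fun e S p)"
      and h: "c * \<bar>x p\<bar> \<le> \<bar>y p\<bar>" "c * \<bar>y p\<bar> \<le> \<bar>x p\<bar>" "x p * y p < 0"
    show "\<sigma> * vert_fun e S p < 0"
      using * q4[of "c / 2" p "- (x p * y p)"] xy[OF h(1,2)] h(3) c by simp
  qed
  \<comment> \<open>Half of \<open>a' * u^2\<close> is lost to \<open>b' * v^2\<close>, and
    \<open>u^2\<close> is at least half of \<open>(norm p)^2\<close>; hence the factor
    \<open>1/4\<close>.\<close>
  have sec: "a' / 4 * (norm p)\<^sup>2 \<le> a' * u\<^sup>2 - b' * v\<^sup>2"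
    if "\<bar>v\<bar> \<le> c * \<bar>u\<bar>" "(norm p)\<^sup>2 = u\<^sup>2 + v\<^sup>2" "0 < a'" "0 < b'" "b' * c \<le> a' / 2"
    for a' b' u v :: real and p :: "real \<times> real"
  proof -
    have "\<bar>v\<bar> * \<bar>v\<bar> \<le> (c * \<bar>u\<bar>) * (c * \<bar>u\<bar>)" using that(1) by (intro mult_mono) auto
    also have "\<dots> = c * c * u\<^sup>2" by (simp add: power2_eq_square)
    finally have v: "v\<^sup>2 \<le> c * c * u\<^sup>2" by (simp add: power2_eq_square)
    also have "\<dots> \<le> c * u\<^sup>2" using cc by (intro mult_right_mono) auto
    finally have v2: "v\<^sup>2 \<le> c * u\<^sup>2" .
    have "b' * v\<^sup>2 \<le> b' * (c * u\<^sup>2)" using v2 that by simp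
    also have "\<dots> = b' * c * u\<^sup>2" by simp
    also have "\<dots> \<le> a' / 2 * u\<^sup>2" using that by (intro mult_right_mono) auto
    finally have 1: "b' * v\<^sup>2 \<le> a' / 2 * u\<^sup>2" .
    have "c * u\<^sup>2 \<le> 1 * u\<^sup>2" using c by (intro mult_right_mono) auto
    then have "v\<^sup>2 \<le> u\<^sup>2" using v2 by simp
    then have "a' / 4 * (norm p)\<^sup>2 \<le> a' / 4 * (u\<^sup>2 + u\<^sup>2)" unfolding that(2) using that by (intro mult_left_mono) auto
    also have "\<dots> = a' * u\<^sup>2 - a' / 2 * u\<^sup>2" by (simp add: algebra_simps)
    also have "\<dots> \<le> a' * u\<^sup>2 - b' * v\<^sup>2" using 1 by simp
    finally show ?thesis .
  qed
  from approx_eventually_pos[OF DV kc(2)]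
  have e5: "\<forall>\<^sub>F p in at 0. \<bar>y p\<bar> \<le> c * \<bar>x p\<bar> \<longrightarrow> \<sigma> * tangent_deriv e S (vert_fun e S) p > 0"
  proof (eventually_elim, intro impI)
    fix p assume *: "K * m * (a / 4) * norm p ^ 4 \<le> K * ((a * (x p)\<^sup>2 + b * (y p)\<^sup>2) * (a * (x p)\<^sup>2 - b * (y p)\<^sup>2)) \<longrightarrow> 0 < \<sigma> * tangent_deriv e S (vert_fun e S) p"
      and h: "\<bar>y p\<bar> \<le> c * \<bar>x p\<bar>"
    show "0 < \<sigma> * tangent_deriv e S (vert_fun e S) p"
      by (rule *[rule_format, OF q4[OF sec[OF h nrm ab(1,2) cb(1)]]]) (use ab in simp)
  qed
  from approx_eventually_pos[OF DV' kc(3)]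
  have e6: "\<forall>\<^sub>F p in at 0. \<bar>x p\<bar> \<le> c * \<bar>y p\<bar> \<longrightarrow> \<sigma> * tangent_deriv e S (vert_fun e S) p < 0"
  proof (eventually_elim, intro impI)
    fix p assume *: "K * m * (b / 4) * norm p ^ 4 \<le> - 1 * (K * ((a * (x p)\<^sup>2 + b * (y p)\<^sup>2) * (a * (x p)\<^sup>2 - b * (y p)\<^sup>2))) \<longrightarrow> 0 < - 1 * (\<sigma> * tangent_deriv e S (vert_fun e S) p)"
      and h: "\<bar>x p\<bar> \<le> c * \<bar>y p\<bar>"
    have "(norm p)\<^sup>2 = (y p)\<^sup>2 + (x p)\<^sup>2" using nrm by simp
    from q4[OF sec[OF h this ab(2,1) cb(2)]] ab
    have "K * m * (b / 4) * norm p ^ 4 \<le> K * ((a * (x p)\<^sup>2 + b * (y p)\<^sup>2) * (b * (y p)\<^sup>2 - a * (x p)\<^sup>2))" by simp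
    also have "\<dots> = - 1 * (K * ((a * (x p)\<^sup>2 + b * (y p)\<^sup>2) * (a * (x p)\<^sup>2 - b * (y p)\<^sup>2)))"
      by (simp add: algebra_simps)
    finally show "\<sigma> * tangent_deriv e S (vert_fun e S) p < 0" using * by simp
  qed
  obtain d where d: "d > 0" and dd: "\<And>p. p \<noteq> 0 \<Longrightarrow> norm p < d \<Longrightarrow>
      x p * dirderiv e S p + y p * dirderiv (rot e) S p > 0 \<and> infl_fun e S p > 0 \<and>
      (c * \<bar>x p\<bar> \<le> \<bar>y p\<bar> \<longrightarrow> c * \<bar>y p\<bar> \<le> \<bar>x p\<bar> \<longrightarrow> x p * y p > 0 \<longrightarrow> \<sigma> * vert_fun e S p > 0) \<and>
      (c * \<bar>x p\<bar> \<le> \<bar>y p\<bar> \<longrightarrow> c * \<bar>y p\<bar> \<le> \<bar>x p\<bar> \<longrightarrow> x p * y p < 0 \<longrightarrow> \<sigma> * vert_fun e S p < 0) \<and>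
      (\<bar>y p\<bar> \<le> c * \<bar>x p\<bar> \<longrightarrow> \<sigma> * tangent_deriv e S (vert_fun e S) p > 0) \<and>
      (\<bar>x p\<bar> \<le> c * \<bar>y p\<bar> \<longrightarrow> \<sigma> * tangent_deriv e S (vert_fun e S) p < 0)"
    using eventually_conj[OF e1 eventually_conj[OF e2 eventually_conj[OF e3 eventually_conj[OF e4
        eventually_conj[OF e5 e6]]]]] unfolding eventually_at dist_norm diff_zero by blast
  obtain \<rho> where \<rho>: "\<rho> > 0" "ball 0 \<rho> \<subseteq> U" using U open_contains_ball by blast
  define r0 where "r0 = min d \<rho>"
  have r0: "r0 > 0" "ball 0 r0 \<subseteq> U" using d \<rho> by (auto simp: r0_def)
  have h: "p \<noteq> 0 \<Longrightarrow> norm p < r0 \<Longrightarrow> norm p < d" for p :: "real \<times> real" by (simp add: r0_def)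
  note dx = dd[OF _ h, unfolded x_def y_def]
  have nodv: "\<not> (S has_derivative (\<lambda>_. 0)) (at p)" if "p \<noteq> 0" "norm p < r0" for p
  proof
    assume "(S has_derivative (\<lambda>_. 0)) (at p)"
    then have "dirderiv v S p = 0" for v by (rule dirderiv_eq)
    then show False using dx[OF that(1) that] by simp
  qed
  have conf: "\<exists>\<delta>>0. level_configuration S r \<delta>"
    if r: "0 < r" "r < r0" for r
    by (rule level_set_configuration[of r0 S e c \<sigma> r])
      (rule smooth_on_subset[OF S r0(2)] S0 e r0(1) c r | use dx in blast)+
  show ?thesis using r0 nodv conf by blast
qed

section \<open>Solving the deformation for its parameter\<close>

text \<open>On a box \<open>G\<close> increases in \<open>t\<close> and has opposite signs at the
  two ends, so there is one root over each \<open>p\<close>, and the sign of \<open>G\<close> tells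
  on which side of it \<open>t\<close> lies. The conclusion covers the whole box, not just the graph
  of \<open>S\<close>, so that it describes the zero sets of the slices completely.\<close>

lemma implicit_function_exists:
  fixes G :: "'a::euclidean_space \<times> real \<Rightarrow> real"
  assumes W: "open W" "0 \<in> W" and G: "smooth_on W G" and G0: "G 0 = 0"
    and pos: "dirderiv (0, 1) G 0 > 0"
  shows "\<exists>\<rho>>0. \<exists>\<eta>>0. \<exists>S. smooth_on (ball 0 \<rho>) S \<and> S 0 = 0 \<and>
    (\<forall>p t. norm p < \<rho> \<longrightarrow> \<bar>t\<bar> < \<eta> \<longrightarrow> (p, t) \<in> W \<and> dirderiv (0, 1) G (p, t) \<noteq> 0 \<and>
      \<bar>S p\<bar> < \<eta> \<and> (G (p, t) = 0 \<longleftrightarrow> S p = t))"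
proof -
  note smt = smooth_on_dirderiv[OF G, of "(0, 1)"]
  have "open (W \<inter> dirderiv (0, 1) G -` {0<..})"
    by (rule continuous_open_preimage[OF smooth_on_continuous_on[OF smt] W(1) open_greaterThan])
  then obtain d where d: "d > 0" "ball 0 d \<subseteq> W \<inter> dirderiv (0, 1) G -` {0<..}"
    using open_contains_ball W(2) pos by (metis IntI greaterThan_iff vimageI)
  \<comment> \<open>\<open>norm p < d / 2\<close> and \<open>\<bar>t\<bar> \<le> d / 4\<close> keep
    \<open>(p, t)\<close> in the ball of radius \<open>d\<close>, the end points
    \<open>\<plusminus>\<eta>\<close> included.\<close>
  define \<eta> where "\<eta> = d / 4"
  have \<eta>: "\<eta> > 0" using d by (simp add: \<eta>_def)
  have box: "(p, t) \<in> W" "dirderiv (0, 1) G (p, t) > 0" if "norm p < d / 2" "\<bar>t\<bar> \<le> \<eta>" for p :: 'a and t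
  proof -
    have "norm (p, t) < d"
      using norm_Pair_le[of p t] that d(1) unfolding \<eta>_def real_norm_def by linarith
    then have "(p, t) \<in> ball 0 d" by simp
    then show "(p, t) \<in> W" "dirderiv (0, 1) G (p, t) > 0" using d(2) by auto
  qed
  have dG: "((\<lambda>t. G (p, t)) has_real_derivative dirderiv (0, 1) G (p, t)) (at t)" if "(p, t) \<in> W" for p t
  proof -
    have "((\<lambda>t. (p, t)) has_vector_derivative (0, 1)) (at t)"
      by (intro has_vector_derivative_Pair has_vector_derivative_const has_vector_derivative_id)
    from has_real_derivative_along[of G _ "\<lambda>t. (p, t)" t, OF smooth_on_has_derivative[OF G that] this]
    show ?thesis .
  qed
  have mono: "G (p, t) < G (p, t')" if "norm p < d / 2" "- \<eta> \<le> t" "t < t'" "t' \<le> \<eta>" for p t t'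
  proof (rule DERIV_pos_imp_increasing[OF that(3)])
    fix u assume u: "t \<le> u" "u \<le> t'"
    then have "\<bar>u\<bar> \<le> \<eta>" using that by auto
    from dG[OF box(1)[OF that(1) this]] box(2)[OF that(1) this]
    show "\<exists>y. ((\<lambda>t. G (p, t)) has_real_derivative y) (at u) \<and> 0 < y" by blast
  qed
  have contG: "isCont G (p, t)" if "(p, t) \<in> W" for p t by (rule smooth_on_isCont[OF G that])
  have G0': "G (0, 0) = 0" using G0 by (simp add: zero_prod_def)
  have "norm (0 :: 'a) < d / 2" using d by simp
  from mono[OF this, of 0 \<eta>] mono[OF this, of "- \<eta>" 0] box(1)[OF this] \<eta> G0'
  have ends: "G (0, \<eta>) > 0" "G (0, - \<eta>) < 0" "(0, \<eta>) \<in> W" "(0, - \<eta>) \<in> W" by auto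
  have tend: "((\<lambda>p. G (p, t)) \<longlongrightarrow> G (0, t)) (nhds 0)" if "(0, t) \<in> W" for t
  proof -
    have "isCont (\<lambda>p. G (p, t)) 0"
      using isCont_o2[of 0 "\<lambda>p. (p, t)" G] contG[OF that] by (simp add: continuous_intros)
    then show ?thesis by (simp add: isCont_def tendsto_at_iff_tendsto_nhds[of "\<lambda>p. G (p, t)" 0])
  qed
  have "\<forall>\<^sub>F p in nhds 0. G (p, \<eta>) > 0 \<and> G (p, - \<eta>) < 0"
    by (intro eventually_conj order_tendstoD(1)[OF tend[OF ends(3)] ends(1)]
        order_tendstoD(2)[OF tend[OF ends(4)] ends(2)])
  then obtain \<rho>' where \<rho>': "\<rho>' > 0" "\<And>p. norm p < \<rho>' \<Longrightarrow> G (p, \<eta>) > 0 \<and> G (p, - \<eta>) < 0"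
    unfolding eventually_nhds_metric dist_norm diff_zero by blast
  define \<rho> where "\<rho> = min \<rho>' (d / 2)"
  have \<rho>: "\<rho> > 0" using \<rho>' d by (simp add: \<rho>_def)
  have \<rho>d: "norm p < d / 2" if "norm p < \<rho>" for p :: 'a using that by (simp add: \<rho>_def)
  have "\<exists>t. \<bar>t\<bar> < \<eta> \<and> G (p, t) = 0" if p: "norm p < \<rho>" for p
  proof -
    have e: "G (p, \<eta>) > 0" "G (p, - \<eta>) < 0" using \<rho>'(2)[of p] p by (auto simp: \<rho>_def)
    have "continuous_on {-\<eta>..\<eta>} (\<lambda>t. G (p, t))"
    proof (rule continuous_at_imp_continuous_on, rule ballI)
      fix t assume "t \<in> {-\<eta>..\<eta>}"
      then have "\<bar>t\<bar> \<le> \<eta>" by auto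
      from DERIV_isCont[OF dG[OF box(1)[OF \<rho>d[OF p] this]]] show "isCont (\<lambda>t. G (p, t)) t" .
    qed
    then obtain t where t: "- \<eta> \<le> t" "t \<le> \<eta>" "G (p, t) = 0"
      using IVT'[of "\<lambda>t. G (p, t)" "- \<eta>" 0 \<eta>] e \<eta> by auto
    then have "t \<noteq> \<eta>" "t \<noteq> - \<eta>" using e by auto
    then show ?thesis using t by (intro exI[of _ t]) auto
  qed
  then obtain S where S: "\<And>p. norm p < \<rho> \<Longrightarrow> \<bar>S p\<bar> < \<eta> \<and> G (p, S p) = 0" by metis
  have sgn: "G (p, t) < 0 \<longleftrightarrow> t < S p" "G (p, t) > 0 \<longleftrightarrow> t > S p" "G (p, t) = 0 \<longleftrightarrow> S p = t"
    if p: "norm p < \<rho>" "\<bar>t\<bar> < \<eta>" for p t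
  proof -
    have "- \<eta> \<le> t" "t \<le> \<eta>" "- \<eta> \<le> S p" "S p \<le> \<eta>" and z: "G (p, S p) = 0" using p S[OF p(1)] by auto
    then have h: "t < S p \<Longrightarrow> G (p, t) < 0" "S p < t \<Longrightarrow> G (p, t) > 0"
      using mono[OF \<rho>d[OF p(1)], of t "S p"] mono[OF \<rho>d[OF p(1)], of "S p" t] by simp_all
    consider "t < S p" | "t = S p" | "S p < t" by linarith
    then have "(G (p, t) < 0 \<longleftrightarrow> t < S p) \<and> (G (p, t) > 0 \<longleftrightarrow> t > S p) \<and> (G (p, t) = 0 \<longleftrightarrow> S p = t)"
    proof cases
      case 1
      from h(1)[OF 1] 1 show ?thesis by simp
    next
      case 2
      from z[folded 2] 2 show ?thesis by simp
    next
      case 3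
      from h(2)[OF 3] 3 show ?thesis by simp
    qed
    then show "G (p, t) < 0 \<longleftrightarrow> t < S p" "G (p, t) > 0 \<longleftrightarrow> t > S p" "G (p, t) = 0 \<longleftrightarrow> S p = t" by blast+
  qed
  define W' where "W' = ball (0 :: 'a) \<rho> \<times> {-\<eta><..<\<eta>}"
  have W': "open W'" unfolding W'_def by (intro open_Times) auto
  have W'W: "W' \<subseteq> W"
  proof
    fix z assume "z \<in> W'"
    then have "norm (fst z) < \<rho>" "\<bar>snd z\<bar> \<le> \<eta>" by (auto simp: W'_def)
    from box(1)[OF \<rho>d[OF this(1)] this(2)] show "z \<in> W" by simp
  qed
  note G' = smooth_on_subset[OF G W'W]
  have inW': "(p, S p) \<in> W'" if "norm p < \<rho>" for p using S[OF that] that by (auto simp: W'_def)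
  have cont: "continuous_on (ball 0 \<rho>) S"
    by (rule implicit_continuous_on[OF W' smooth_on_continuous_on[OF G'] open_ball])
      (use inW' sgn in \<open>auto simp: W'_def\<close>)
  have "smooth_on (ball 0 \<rho>) S"
  proof (rule implicit_smooth_on[OF W' G' open_ball cont], intro conjI)
    fix p :: 'a assume "p \<in> ball 0 \<rho>"
    then have p: "norm p < \<rho>" by simp
    show "(p, S p) \<in> W'" "G (p, S p) = 0" using inW'[OF p] S[OF p] by auto
    show "dirderiv (0, 1) G (p, S p) \<noteq> 0" using box(2)[OF \<rho>d[OF p], of "S p"] S[OF p] by auto
  qed
  moreover have "S 0 = 0" using sgn(3)[of 0 0] \<rho> \<eta> G0' by simp
  moreover have "\<forall>p t. norm p < \<rho> \<longrightarrow> \<bar>t\<bar> < \<eta> \<longrightarrow> (p, t) \<in> W \<and> dirderiv (0, 1) G (p, t) \<noteq> 0 \<and>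
      \<bar>S p\<bar> < \<eta> \<and> (G (p, t) = 0 \<longleftrightarrow> S p = t)"
  proof (intro allI impI)
    fix p :: 'a and t assume p: "norm p < \<rho>" "\<bar>t\<bar> < \<eta>"
    have "\<bar>t\<bar> \<le> \<eta>" using p by simp
    from box[OF \<rho>d[OF p(1)] this] sgn(3)[OF p] S[OF p(1)]
    show "(p, t) \<in> W \<and> dirderiv (0, 1) G (p, t) \<noteq> 0 \<and> \<bar>S p\<bar> < \<eta> \<and> (G (p, t) = 0 \<longleftrightarrow> S p = t)" by simp
  qed
  ultimately show ?thesis using \<rho> \<eta> by blast
qed

lemma slice_has_derivative:
  fixes G :: "'a::euclidean_space \<times> real \<Rightarrow> real"
  assumes "smooth_on W G" "(p, t) \<in> W"
  shows "((\<lambda>p. G (p, t)) has_derivative (\<lambda>h. dirderiv (h, 0) G (p, t))) (at p)"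
  by (rule has_derivative_compose[of "\<lambda>p. (p, t)", OF _ smooth_on_has_derivative[OF assms]])
    (auto intro!: derivative_eq_intros)

lemma slice_hessian:
  fixes G :: "'a::euclidean_space \<times> real \<Rightarrow> real"
  assumes W: "open W" "0 \<in> W" and G: "smooth_on W G" and f: "\<forall>\<^sub>F p in nhds 0. G (p, 0) = f p"
  shows "dirderiv v f 0 = dirderiv (v, 0) G 0"
    "dirderiv v (dirderiv w f) 0 = dirderiv (v, 0) (dirderiv (w, 0) G) 0"
proof -
  obtain V where V: "open V" "0 \<in> V" "\<And>p. p \<in> V \<Longrightarrow> G (p, 0) = f p"
    using f unfolding eventually_nhds by blast
  define V' where "V' = V \<inter> (\<lambda>p. (p, 0)) -` W"
  have V': "open V'" unfolding V'_def
    by (intro open_Int V open_vimage W) (auto intro!: continuous_intros)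
  have 0: "0 \<in> V'" using V W by (simp add: V'_def zero_prod_def)
  have d: "dirderiv v f p = dirderiv (v, 0) G (p, 0)" if "p \<in> V'" for v p
  proof (rule dirderiv_eq)
    show "(f has_derivative (\<lambda>h. dirderiv (h, 0) G (p, 0))) (at p)"
      by (rule has_derivative_transform_within_open[OF slice_has_derivative[OF G] V' that])
        (use that V in \<open>auto simp: V'_def\<close>)
  qed
  from d[OF 0] show "dirderiv v f 0 = dirderiv (v, 0) G 0" by (simp add: zero_prod_def)
  have "(dirderiv w f has_derivative (\<lambda>h. dirderiv (h, 0) (dirderiv (w, 0) G) (0, 0))) (at 0)"
    by (rule has_derivative_transform_within_open[OF slice_has_derivative[OF smooth_on_dirderiv[OF G]] V' 0])
      (use 0 d in \<open>auto simp: V'_def\<close>)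
  from dirderiv_eq[OF this] show "dirderiv v (dirderiv w f) 0 = dirderiv (v, 0) (dirderiv (w, 0) G) 0"
    by (simp add: zero_prod_def)
qed

text \<open>At the origin the numerator of the quotient and the derivative of \<open>S\<close>
  vanish. Differentiating once more thus involves neither the derivative of the denominator nor the
  direction of \<open>t\<close>, and the Hessian of \<open>S\<close> is a multiple of that of the
  slice.\<close>

lemma implicit_hessian:
  fixes G :: "'a::euclidean_space \<times> real \<Rightarrow> real"
  assumes W: "open W" and G: "smooth_on W G" and U: "open U" "0 \<in> U" and S: "smooth_on U S" "S 0 = 0"
    and z: "\<And>p. p \<in> U \<Longrightarrow> (p, S p) \<in> W \<and> dirderiv (0, 1) G (p, S p) \<noteq> 0 \<and> G (p, S p) = 0"
    and crit: "\<And>v. dirderiv (v, 0) G 0 = 0"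
  shows "p \<in> U \<Longrightarrow> dirderiv w S p = - dirderiv (w, 0) G (p, S p) / dirderiv (0, 1) G (p, S p)"
    "dirderiv v (dirderiv w S) 0 = - dirderiv (v, 0) (dirderiv (w, 0) G) 0 / dirderiv (0, 1) G 0"
proof -
  have d: "dirderiv w S p = - dirderiv (w, 0) G (p, S p) / dirderiv (0, 1) G (p, S p)" if "p \<in> U" for w p
    by (rule dirderiv_eq[OF implicit_has_derivative[OF smooth_on_has_derivative[OF G] _ U(1) that]])
      (use z that smooth_on_isCont[OF S(1)] in auto)
  then show "p \<in> U \<Longrightarrow> dirderiv w S p = - dirderiv (w, 0) G (p, S p) / dirderiv (0, 1) G (p, S p)" .
  have zz: "(0, S 0) = (0 :: 'a \<times> real)" using S(2) by (simp add: zero_prod_def)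
  have dS: "(S has_derivative (\<lambda>_. 0)) (at 0)"
    using smooth_on_has_derivative[OF S(1) U(2)] d[OF U(2)] crit by (simp add: zz)
  have pr: "((\<lambda>p. (p, S p)) has_derivative (\<lambda>h. (h, 0))) (at 0)"
    by (rule has_derivative_Pair[OF has_derivative_ident dS])
  have ch: "((\<lambda>p. dirderiv u G (p, S p)) has_derivative (\<lambda>h. dirderiv (h, 0) (dirderiv u G) 0)) (at 0)" for u
    using has_derivative_compose[OF pr smooth_on_has_derivative[OF smooth_on_dirderiv[OF G]], of u] z[OF U(2)]
    by (simp add: zz)
  have c0: "dirderiv (0, 1) G (0, S 0) \<noteq> 0" using z[OF U(2)] by blast
  have "((\<lambda>p. - dirderiv (w, 0) G (p, S p) / dirderiv (0, 1) G (p, S p)) has_derivative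
      (\<lambda>h. - dirderiv (h, 0) (dirderiv (w, 0) G) 0 / dirderiv (0, 1) G 0)) (at 0)"
    by (rule has_derivative_eq_rhs[OF has_derivative_divide[OF has_derivative_minus[OF ch] ch c0]])
      (simp add: zz crit divide_inverse)
  from has_derivative_transform_within_open[OF this U, of "dirderiv w S"] d
  have "(dirderiv w S has_derivative (\<lambda>h. - dirderiv (h, 0) (dirderiv (w, 0) G) 0 / dirderiv (0, 1) G 0)) (at 0)"
    by simp
  from dirderiv_eq[OF this]
  show "dirderiv v (dirderiv w S) 0 = - dirderiv (v, 0) (dirderiv (w, 0) G) 0 / dirderiv (0, 1) G 0" .
qed

section \<open>Versal deformations\<close>

lemma dirderiv_plane:
  fixes \<phi> :: "real \<times> real \<Rightarrow> real"
  assumes "\<phi> differentiable (at p)"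
  shows "dirderiv w \<phi> p = fst w * ddx \<phi> p + snd w * ddy \<phi> p"
proof -
  note lin = has_derivative_linear[OF has_derivative_dirderiv[OF assms]]
  have w: "w = fst w *\<^sub>R (1, 0) + snd w *\<^sub>R (0, 1)" by (simp add: prod_eq_iff)
  have "dirderiv (fst w *\<^sub>R (1, 0) + snd w *\<^sub>R (0, 1)) \<phi> p = fst w * ddx \<phi> p + snd w * ddy \<phi> p"
    by (simp only: linear_add[OF lin] linear_scale[OF lin] real_scaleR_def)
  then show ?thesis by (simp only: w[symmetric])
qed

lemma hessian_plane:
  fixes S :: "real \<times> real \<Rightarrow> real"
  assumes U: "open U" "0 \<in> U" and S: "smooth_on U S"
  shows "dirderiv u (dirderiv w S) 0 = fst u * fst w * ddx (ddx S) 0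
     + (fst u * snd w + snd u * fst w) * ddx (ddy S) 0 + snd u * snd w * ddy (ddy S) 0"
proof -
  note d = smooth_on_differentiable[OF smooth_on_dirderiv[OF S] U(2)]
  have "((\<lambda>p. fst w * ddx S p + snd w * ddy S p) has_derivative
      (\<lambda>h. fst w * dirderiv h (ddx S) 0 + snd w * dirderiv h (ddy S) 0)) (at 0)"
    by (intro has_derivative_add has_derivative_mult_right has_derivative_dirderiv[OF d])
  from has_derivative_transform_within_open[OF this U dirderiv_plane[OF smooth_on_differentiable[OF S], symmetric]]
  have "(dirderiv w S has_derivative
      (\<lambda>h. fst w * dirderiv h (ddx S) 0 + snd w * dirderiv h (ddy S) 0)) (at 0)" .
  from dirderiv_eq[OF this, of u]
  have 1: "dirderiv u (dirderiv w S) 0 = fst w * dirderiv u (ddx S) 0 + snd w * dirderiv u (ddy S) 0" .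
  have 2: "dirderiv u (ddx S) 0 = fst u * ddx (ddx S) 0 + snd u * ddy (ddx S) 0"
    and 3: "dirderiv u (ddy S) 0 = fst u * ddx (ddy S) 0 + snd u * ddy (ddy S) 0"
    by (rule dirderiv_plane[OF d])+
  have 4: "ddy (ddx S) 0 = ddx (ddy S) 0" by (rule dirderiv_commute[OF U S])
  show ?thesis unfolding 1 2 3 4 by (simp add: algebra_simps)
qed

text \<open>The expression is the off-diagonal entry of the Hessian in the frame rotated by
  \<open>\<theta>\<close>. A quarter turn reverses its sign, so it vanishes in between.\<close>

lemma diagonalizing_angle:
  fixes A B C :: real
  obtains \<theta> where "cos \<theta> * sin \<theta> * (C - A) + ((cos \<theta>)\<^sup>2 - (sin \<theta>)\<^sup>2) * B = 0"
proof -
  define g where "g \<theta> = cos \<theta> * sin \<theta> * (C - A) + ((cos \<theta>)\<^sup>2 - (sin \<theta>)\<^sup>2) * B" for \<theta>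
  have g: "g 0 = B" "g (pi / 2) = - B" by (simp_all add: g_def)
  have cont: "continuous_on {0..pi / 2} g" unfolding g_def by (intro continuous_intros)
  have "\<exists>\<theta>. g \<theta> = 0"
  proof (cases "B \<ge> 0")
    case True
    then show ?thesis using IVT2'[of g "pi / 2" 0 0] g cont by auto
  next
    case False
    then show ?thesis using IVT'[of g 0 0 "pi / 2"] g cont by auto
  qed
  then show ?thesis using that by (auto simp: g_def)
qed

lemma minimum_configuration:
  fixes S :: "real \<times> real \<Rightarrow> real"
  assumes U: "open U" "0 \<in> U" and S: "smooth_on U S" and S0: "S 0 = 0"
    and crit: "\<And>v. dirderiv v S 0 = 0" and pos: "\<And>w. w \<noteq> 0 \<Longrightarrow> quadratic_part S w > 0"
    and nonumbilic: "\<not> (ddx (ddx S) 0 = ddy (ddy S) 0 \<and> ddx (ddy S) 0 = 0)"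
  shows "\<exists>r0>0. ball 0 r0 \<subseteq> U \<and> (\<forall>p. p \<noteq> 0 \<longrightarrow> norm p < r0 \<longrightarrow> \<not> (S has_derivative (\<lambda>_. 0)) (at p)) \<and>
    (\<forall>r. 0 < r \<longrightarrow> r < r0 \<longrightarrow> (\<exists>\<delta>>0. level_configuration S r \<delta>))"
proof -
  define A B C where "A = ddx (ddx S) 0" and "B = ddx (ddy S) 0" and "C = ddy (ddy S) 0"
  obtain \<theta> where \<theta>: "cos \<theta> * sin \<theta> * (C - A) + ((cos \<theta>)\<^sup>2 - (sin \<theta>)\<^sup>2) * B = 0"
    by (rule diagonalizing_angle)
  define k l where "k = cos \<theta>" and "l = sin \<theta>"
  have kl: "k\<^sup>2 + l\<^sup>2 = 1" by (simp add: k_def l_def)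
  have 0: "k * l * (C - A) + (k\<^sup>2 - l\<^sup>2) * B = 0" using \<theta> by (simp add: k_def l_def)
  define e where "e = (k, l)"
  have e: "norm e = 1" using kl by (simp add: e_def norm_prod_def)
  have re: "rot e = (- l, k)" by (simp add: e_def rot_def)
  define a b where "a = dirderiv e (dirderiv e S) 0" and "b = dirderiv (rot e) (dirderiv (rot e) S) 0"
  note H = hessian_plane[OF U S, folded A_def B_def C_def]
  have a: "a = k * k * A + (k * l + l * k) * B + l * l * C"
    and b: "b = l * l * A - (l * k + k * l) * B + k * k * C"
    unfolding a_def b_def H re by (simp_all add: e_def)
  have mixed: "dirderiv (rot e) (dirderiv e S) 0 = 0" "dirderiv e (dirderiv (rot e) S) 0 = 0"
    unfolding H re using 0 by (simp_all add: e_def power2_eq_square algebra_simps)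
  have "norm (rot e) = 1" using e by simp
  then have "e \<noteq> 0" "rot e \<noteq> 0" using e norm_zero zero_neq_one by metis+
  from pos[OF this(1)] pos[OF this(2)] have ab: "a > 0" "b > 0"
    unfolding quadratic_part_def a b re A_def B_def C_def
    by (simp_all add: e_def power2_eq_square algebra_simps)
  have "a \<noteq> b"
  proof
    assume "a = b"
    \<comment> \<open>Together with the vanishing off-diagonal entry this says that the rotation by
      twice the angle annihilates \<open>(A - C, 2 * B)\<close>; its determinant is
      \<open>(k^2 + l^2)^2 = 1\<close>.\<close>
    then have 1: "(k\<^sup>2 - l\<^sup>2) * (A - C) + 4 * (k * l) * B = 0"
      unfolding a b by (simp add: power2_eq_square algebra_simps)
    have "A - C = (k\<^sup>2 + l\<^sup>2)\<^sup>2 * (A - C)" "B = (k\<^sup>2 + l\<^sup>2)\<^sup>2 * B" using kl by simp_all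
    moreover have "(k\<^sup>2 + l\<^sup>2)\<^sup>2 * (A - C) = 0" "(k\<^sup>2 + l\<^sup>2)\<^sup>2 * B = 0" using 0 1 by algebra+
    ultimately have "A = C" "B = 0" by simp_all
    then show False using nonumbilic by (simp add: A_def B_def C_def)
  qed
  then show ?thesis
    by (intro minimum_configuration_frame[OF U S S0 e crit crit a_def[symmetric] mixed b_def[symmetric] ab])
qed

lemma implicit_function_exists_nonzero:
  fixes G :: "'a::euclidean_space \<times> real \<Rightarrow> real"
  assumes W: "open W" "0 \<in> W" and G: "smooth_on W G" and G0: "G 0 = 0"
    and nz: "dirderiv (0, 1) G 0 \<noteq> 0"
  shows "\<exists>\<rho>>0. \<exists>\<eta>>0. \<exists>S. smooth_on (ball 0 \<rho>) S \<and> S 0 = 0 \<and>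
    (\<forall>p t. norm p < \<rho> \<longrightarrow> \<bar>t\<bar> < \<eta> \<longrightarrow> (p, t) \<in> W \<and> dirderiv (0, 1) G (p, t) \<noteq> 0 \<and>
      \<bar>S p\<bar> < \<eta> \<and> (G (p, t) = 0 \<longleftrightarrow> S p = t))"
proof (cases "dirderiv (0, 1) G 0 > 0")
  case True
  then show ?thesis by (rule implicit_function_exists[OF W G G0])
next
  case False
  have m: "dirderiv v (\<lambda>z. - G z) z = - dirderiv v G z" if "z \<in> W" for v z
    by (rule dirderiv_eq[OF has_derivative_minus[OF smooth_on_has_derivative[OF G that]]])
  have "dirderiv (0, 1) (\<lambda>z. - G z) 0 > 0" using False nz m[OF W(2)] by simp
  from implicit_function_exists[OF W smooth_on_uminus[OF W(1) G] _ this] G0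
  obtain \<rho> \<eta> S where *: "\<rho> > 0" "\<eta> > 0" "smooth_on (ball 0 \<rho>) S" "S 0 = 0"
    "\<And>p t. norm p < \<rho> \<Longrightarrow> \<bar>t\<bar> < \<eta> \<Longrightarrow> (p, t) \<in> W \<and> dirderiv (0, 1) (\<lambda>z. - G z) (p, t) \<noteq> 0 \<and>
      \<bar>S p\<bar> < \<eta> \<and> (- G (p, t) = 0 \<longleftrightarrow> S p = t)" by auto
  have "(p, t) \<in> W \<and> dirderiv (0, 1) G (p, t) \<noteq> 0 \<and> \<bar>S p\<bar> < \<eta> \<and> (G (p, t) = 0 \<longleftrightarrow> S p = t)"
    if "norm p < \<rho>" "\<bar>t\<bar> < \<eta>" for p t
    using *(5)[OF that] m[of "(p, t)" "(0, 1)"] by simp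
  with *(1-4) show ?thesis by blast
qed

section \<open>The zero sets of a deformation\<close>

text \<open>Solving for \<open>t = \<epsilon> * s\<close> gives a function \<open>S\<close> whose
  Hessian is that of \<open>f\<close> divided by \<open>- \<epsilon> * m\<close>;
  \<open>\<epsilon>\<close> is chosen to make it positive, whatever the signs of \<open>f\<close>
  and \<open>m\<close>. By proportionality the origin is not umbilic for \<open>S\<close>
  either.\<close>

lemma deformation_configuration:
  fixes F :: "(real \<times> real) \<times> real \<Rightarrow> real"
  assumes F: "smooth_germ F" and F0: "F 0 = 0" and f: "\<forall>\<^sub>F p in nhds 0. F (p, 0) = f p"
    and A1: "A1_plus f" and nonumbilic: "\<not> umbilic_at_origin f" and nz: "dirderiv (0, 1) F 0 \<noteq> 0"
  shows "\<exists>\<epsilon>\<in>{-1, 1 :: real}. \<exists>r0>0. \<forall>r. 0 < r \<and> r < r0 \<longrightarrow> (\<exists>\<delta>>0. \<forall>s. \<bar>s\<bar> < \<delta> \<longrightarrow>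
     (0 < \<epsilon> * s \<longrightarrow> oval r (slice F s)) \<and> (\<epsilon> * s < 0 \<longrightarrow> curve r (slice F s) = {}) \<and>
     (s = 0 \<longrightarrow> curve r (slice F s) = {0} \<and> singular_points r (slice F s) = {0}))"
proof -
  obtain W where W: "open W" "0 \<in> W" "smooth_on W F" using F unfolding smooth_germ_def by blast
  have fd: "(f has_derivative (\<lambda>_. 0)) (at 0)" using A1 by (simp add: A1_plus_def)
  have fcrit: "dirderiv v f 0 = 0" for v by (rule dirderiv_eq[OF fd])
  define m where "m = dirderiv (0, 1) F 0"
  have m: "m \<noteq> 0" using nz by (simp add: m_def)
  obtain \<epsilon> :: real where \<epsilon>: "\<epsilon> \<in> {-1, 1}" "\<And>w. w \<noteq> 0 \<Longrightarrow> - quadratic_part f w / (\<epsilon> * m) > 0"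
  proof -
    consider "\<forall>w. w \<noteq> 0 \<longrightarrow> quadratic_part f w > 0" | "\<forall>w. w \<noteq> 0 \<longrightarrow> quadratic_part f w < 0"
      using A1 unfolding A1_plus_def by blast
    then show ?thesis
    proof cases
      case 1
      show ?thesis by (rule that[of "- sgn m"]) (use 1 m in \<open>auto simp: sgn_if divide_simps\<close>)
    next
      case 2
      show ?thesis by (rule that[of "sgn m"]) (use 2 m in \<open>auto simp: sgn_if divide_simps\<close>)
    qed
  qed
  have \<epsilon>\<epsilon>: "\<epsilon> * (\<epsilon> * t) = t" for t using \<epsilon>(1) by auto
  define L where "L z = (fst z, \<epsilon> * snd z)" for z :: "(real \<times> real) \<times> real"
  define G where "G z = F (L z)" for z
  have L: "bounded_linear L"
    unfolding L_def[abs_def]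
    by (intro bounded_linear_Pair bounded_linear_fst bounded_linear_const_mult bounded_linear_snd)
  have WG: "open (L -` W)" using W(1) linear_continuous_on[OF L] by (intro open_vimage)
  have L0: "L 0 = 0" by (simp add: L_def zero_prod_def)
  have W0: "0 \<in> L -` W" using W(2) L0 by simp
  have G: "smooth_on (L -` W) G"
    unfolding G_def[abs_def] by (rule smooth_on_compose[OF WG _ W(3) smooth_on_linear[OF L]]) auto
  have Gt: "dirderiv (0, 1) G 0 = \<epsilon> * m"
  proof -
    note hd = smooth_on_has_derivative[OF W(3)]
    have "(G has_derivative (\<lambda>h. dirderiv (L h) F (L 0))) (at 0)"
      unfolding G_def[abs_def]
      by (rule has_derivative_compose[OF bounded_linear_imp_has_derivative[OF L] hd]) (use W0 in simp)
    then have "dirderiv (0, 1) G 0 = dirderiv (L (0, 1)) F 0" by (simp add: dirderiv_eq L0)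
    also have "L (0, 1) = \<epsilon> *\<^sub>R (0, 1)" by (simp add: L_def)
    also have "dirderiv (\<epsilon> *\<^sub>R (0, 1)) F 0 = \<epsilon> * m"
      using linear_scale[OF has_derivative_linear[OF hd[OF W(2)]], of \<epsilon> "(0, 1)"]
      by (simp only: m_def real_scaleR_def)
    finally show ?thesis .
  qed
  have Gnz: "dirderiv (0, 1) G 0 \<noteq> 0" using \<epsilon>(1) m by (auto simp: Gt)
  have G0: "G 0 = 0" using F0 by (simp add: G_def L0)
  have Gf: "\<forall>\<^sub>F p in nhds 0. G (p, 0) = f p" using f by (simp add: G_def L_def)
  note sh = slice_hessian[OF WG W0 G Gf]
  have Gcrit: "dirderiv (v, 0) G 0 = 0" for v using sh(1)[of v] fcrit by simp
  obtain \<rho> \<eta> S where \<rho>: "\<rho> > 0" and \<eta>: "\<eta> > 0" and S: "smooth_on (ball 0 \<rho>) S" "S 0 = 0"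
    and box: "\<And>p t. norm p < \<rho> \<Longrightarrow> \<bar>t\<bar> < \<eta> \<Longrightarrow> (p, t) \<in> L -` W \<and> dirderiv (0, 1) G (p, t) \<noteq> 0 \<and>
      \<bar>S p\<bar> < \<eta> \<and> (G (p, t) = 0 \<longleftrightarrow> S p = t)"
    using implicit_function_exists_nonzero[OF WG W0 G G0 Gnz] by blast
  have U: "open (ball (0 :: real \<times> real) \<rho>)" "0 \<in> ball (0 :: real \<times> real) \<rho>" using \<rho> by auto
  have z: "(p, S p) \<in> L -` W \<and> dirderiv (0, 1) G (p, S p) \<noteq> 0 \<and> G (p, S p) = 0" if "p \<in> ball 0 \<rho>" for p
  proof -
    have p: "norm p < \<rho>" using that by simp
    have "\<bar>S p\<bar> < \<eta>" using box[OF p, of 0] \<eta> by simp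
    from box[OF p this] show ?thesis by blast
  qed
  have ih1: "dirderiv w S p = - dirderiv (w, 0) G (p, S p) / dirderiv (0, 1) G (p, S p)"
    if "p \<in> ball 0 \<rho>" for w p
    by (rule implicit_hessian(1)[OF WG G U S z Gcrit that])
  have ih2: "dirderiv v (dirderiv w S) 0 = - dirderiv (v, 0) (dirderiv (w, 0) G) 0 / dirderiv (0, 1) G 0" for v w
    by (rule implicit_hessian(2)[OF WG G U S z Gcrit])
  have Scrit: "dirderiv v S 0 = 0" for v
    using ih1[OF U(2), of v] Gcrit[of v] S(2) by (simp add: zero_prod_def)
  have Shess: "dirderiv v (dirderiv w S) 0 = - dirderiv v (dirderiv w f) 0 / (\<epsilon> * m)" for v w
    using ih2[of v w] sh(2)[of v w] Gt by simp
  have Spos: "quadratic_part S w > 0" if "w \<noteq> 0" for w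
  proof -
    have "(- A / c * x + 2 * (- B / c) * y * z + - C / c * t) / 2 = - ((A * x + 2 * B * y * z + C * t) / 2) / c"
      if "c \<noteq> 0" for A B C c x y z t :: real
      using that by (simp add: field_simps)
    from this[of "\<epsilon> * m"] have "quadratic_part S w = - quadratic_part f w / (\<epsilon> * m)"
      unfolding quadratic_part_def Shess split_beta using Gnz by (simp only: Gt not_False_eq_True)
    then show ?thesis using \<epsilon>(2)[OF that] by simp
  qed
  have "\<not> (ddx (ddx S) 0 = ddy (ddy S) 0 \<and> ddx (ddy S) 0 = 0)"
    using nonumbilic Gnz unfolding umbilic_at_origin_critical[OF fd] Shess Gt by simp
  from minimum_configuration[OF U S Scrit Spos this]
  obtain r0 where r0: "r0 > 0" "ball 0 r0 \<subseteq> ball (0 :: real \<times> real) \<rho>"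
    "\<And>p. p \<noteq> 0 \<Longrightarrow> norm p < r0 \<Longrightarrow> \<not> (S has_derivative (\<lambda>_. 0)) (at p)"
    and conf: "\<And>r. 0 < r \<Longrightarrow> r < r0 \<Longrightarrow> \<exists>\<delta>>0. level_configuration S r \<delta>"
    by blast
  have "\<exists>\<delta>>0. \<forall>s. \<bar>s\<bar> < \<delta> \<longrightarrow>
     (0 < \<epsilon> * s \<longrightarrow> oval r (slice F s)) \<and> (\<epsilon> * s < 0 \<longrightarrow> curve r (slice F s) = {}) \<and>
     (s = 0 \<longrightarrow> curve r (slice F s) = {0} \<and> singular_points r (slice F s) = {0})"
    if r: "0 < r \<and> r < r0" for r
  proof -
    obtain \<delta> where \<delta>: "\<delta> > 0" and c: "level_configuration S r \<delta>"
      using conf[of r] r by blast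
    show ?thesis
    proof (intro exI[of _ "min \<delta> \<eta>"] conjI[of "_ < _"] allI impI)
      show "0 < min \<delta> \<eta>" using \<delta> \<eta> by simp
      fix s assume s: "\<bar>s\<bar> < min \<delta> \<eta>"
      define t where "t = \<epsilon> * s"
      have t: "\<bar>t\<bar> < \<eta>" "\<bar>t\<bar> < \<delta>" using s \<epsilon>(1) by (auto simp: t_def)
      have g: "slice F s = (\<lambda>p. G (p, t))" by (simp add: slice_def G_def L_def t_def \<epsilon>\<epsilon>)
      have in\<rho>: "norm p < \<rho>" if "norm p < r" for p :: "real \<times> real"
      proof -
        have "p \<in> ball 0 r0" using that r by simp
        then show ?thesis using r0(2) by auto
      qed
      have 1: "\<forall>p. norm p < r \<longrightarrow> (slice F s p = 0 \<longleftrightarrow> S p = t)"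
        unfolding g using box[OF in\<rho> t(1)] by blast
      \<comment> \<open>By the formula for the derivative of \<open>S\<close>, a critical zero of
        the slice away from the origin would be a critical point of \<open>S\<close>.\<close>
      have 2: "\<forall>p. norm p < r \<longrightarrow> slice F s p = 0 \<longrightarrow> p \<noteq> 0 \<longrightarrow> \<not> (slice F s has_derivative (\<lambda>_. 0)) (at p)"
      proof (intro allI impI notI)
        fix p assume p: "norm p < r" "slice F s p = 0" "p \<noteq> 0" "(slice F s has_derivative (\<lambda>_. 0)) (at p)"
        have St: "S p = t" using 1 p by blast
        have pt: "(p, t) \<in> L -` W" using box[OF in\<rho>[OF p(1)] t(1)] by blast
        have "(\<lambda>h. dirderiv (h, 0) G (p, t)) = (\<lambda>_. 0)"
          using has_derivative_unique[OF slice_has_derivative[OF G pt] p(4)[unfolded g]] .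
        then have "dirderiv (h, 0) G (p, S p) = 0" for h unfolding St by meson
        moreover have pU: "p \<in> ball 0 \<rho>" using in\<rho>[OF p(1)] by simp
        ultimately have "dirderiv w S p = 0" for w using ih1[OF pU, of w] by simp
        then have "(S has_derivative (\<lambda>_. 0)) (at p)" using smooth_on_has_derivative[OF S(1) pU] by simp
        moreover have "norm p < r0" using p(1) r by simp
        ultimately show False using r0(3)[OF p(3)] by blast
      qed
      have cf: "(0 < t \<and> t < \<delta> \<longrightarrow> oval r (slice F s)) \<and> (t < 0 \<longrightarrow> curve r (slice F s) = {}) \<and>
          (t = 0 \<longrightarrow> curve r (slice F s) = {0})"
        by (rule c[unfolded level_configuration_def, rule_format, OF 1[rule_format] 2[rule_format]])
      have "singular_points r (slice F s) = {0}" if "s = 0"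
      proof -
        have c0: "curve r (slice F s) = {0}" using cf that by (simp add: t_def)
        have d0: "(slice F s has_derivative (\<lambda>_. 0)) (at 0)"
        proof -
          obtain V where V: "open V" "0 \<in> V" "\<And>p. p \<in> V \<Longrightarrow> F (p, 0) = f p"
            using f unfolding eventually_nhds by blast
          show ?thesis
            by (rule has_derivative_transform_within_open[OF fd V(1,2)]) (simp add: V(3) slice_def that)
        qed
        show ?thesis unfolding singular_points_def c0 using d0 by blast
      qed
      then show "(0 < \<epsilon> * s \<longrightarrow> oval r (slice F s)) \<and> (\<epsilon> * s < 0 \<longrightarrow> curve r (slice F s) = {}) \<and>
          (s = 0 \<longrightarrow> curve r (slice F s) = {0} \<and> singular_points r (slice F s) = {0})"
        using cf t(2) unfolding t_def by simp
    qed
  qed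
  then show ?thesis using \<epsilon>(1) r0(1) by blast
qed

lemma Re_versal_parameter_derivative:
  fixes F :: "(real \<times> real) \<times> real \<Rightarrow> real"
  assumes "A1_plus f" "Re_versal f F"
  shows "dirderiv (0, 1) F 0 \<noteq> 0"
proof -
  have "smooth_germ (\<lambda>_ :: real \<times> real. 1 :: real)"
    unfolding smooth_germ_def using smooth_on_const[of UNIV] by blast
  from assms(2)[unfolded Re_versal_def, rule_format, OF this]
  obtain a b :: "real \<times> real \<Rightarrow> real" and c :: "real \<Rightarrow> real"
    where "\<forall>\<^sub>F p in nhds 0. 1 = a p * ddx f p + b p * ddy f p + (\<Sum>i\<in>Basis. c i * dirderiv (0, i) F (p, 0))"
    by blast
  from eventually_nhds_x_imp_x[OF this]
  have "1 = a 0 * ddx f 0 + b 0 * ddy f 0 + c 1 * dirderiv (0, 1) F 0"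
    by (simp add: zero_prod_def)
  moreover have "dirderiv v f 0 = 0" for v
    using assms(1) by (intro dirderiv_eq) (simp add: A1_plus_def)
  ultimately show ?thesis by auto
qed

section \<open>FRS-equivalence from the sign of the parameter\<close>

text \<open>\<open>\<epsilon>\<close> marks the side of the parameter line on which the ovals
  lie.\<close>

definition standard_configuration ::
    "((real \<times> real) \<times> real \<Rightarrow> real) \<Rightarrow> real \<Rightarrow> real \<Rightarrow> real \<Rightarrow> bool" where
  "standard_configuration F \<epsilon> r \<delta> \<longleftrightarrow> (\<forall>s. \<bar>s\<bar> < \<delta> \<longrightarrow>
     (0 < \<epsilon> * s \<longrightarrow> oval r (slice F s)) \<and> (\<epsilon> * s < 0 \<longrightarrow> curve r (slice F s) = {}) \<and>
     (s = 0 \<longrightarrow> curve r (slice F s) = {0} \<and> singular_points r (slice F s) = {0}))"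

text \<open>Two sign factors allow the two deformations to have their ovals on opposite sides; with
  \<open>F = G\<close> the lemma compares parameters within one stratum.\<close>

lemma same_configuration_of_standard:
  assumes F: "standard_configuration F \<epsilon> r \<delta>" and G: "standard_configuration G \<epsilon>' r \<delta>'"
    and \<epsilon>: "\<epsilon> \<noteq> 0" "\<epsilon>' \<noteq> 0" and r: "r > 0" and s: "\<bar>s\<bar> < \<delta>" "\<bar>u\<bar> < \<delta>'" "sgn (\<epsilon> * s) = sgn (\<epsilon>' * u)"
  shows "same_configuration r (slice F s) (slice G u)"
proof -
  have f: "(0 < \<epsilon> * s \<longrightarrow> oval r (slice F s)) \<and> (\<epsilon> * s < 0 \<longrightarrow> curve r (slice F s) = {}) \<and>
     (s = 0 \<longrightarrow> curve r (slice F s) = {0} \<and> singular_points r (slice F s) = {0})"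
    using F s(1) unfolding standard_configuration_def by blast
  have g: "(0 < \<epsilon>' * u \<longrightarrow> oval r (slice G u)) \<and> (\<epsilon>' * u < 0 \<longrightarrow> curve r (slice G u) = {}) \<and>
     (u = 0 \<longrightarrow> curve r (slice G u) = {0} \<and> singular_points r (slice G u) = {0})"
    using G s(2) unfolding standard_configuration_def by blast
  consider "\<epsilon> * s > 0" | "\<epsilon> * s < 0" | "\<epsilon> * s = 0" by linarith
  then show ?thesis
  proof cases
    case 1
    then have "\<epsilon>' * u > 0" using s(3) by (metis sgn_greater)
    then show ?thesis using f g 1 r by (intro oval_same_configuration) auto
  next
    case 2
    then have "\<epsilon>' * u < 0" using s(3) by (metis sgn_less)
    then have e: "curve r (slice F s) = {}" "curve r (slice G u) = {}" using f g 2 by auto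
    then have "singular_points r (slice F s) = {}" "singular_points r (slice G u) = {}"
      by (auto simp: singular_points_def)
    with e show ?thesis
      by (intro same_configuration_cong) (simp_all add: inflections_def vertices_def regular_points_def)
  next
    case 3
    then have "\<epsilon>' * u = 0" using s(3) by (metis sgn_zero_iff)
    then have "s = 0" "u = 0" using 3 \<epsilon> by auto
    with f g show ?thesis
      by (intro same_configuration_cong) (simp_all add: inflections_def vertices_def regular_points_def)
  qed
qed

lemma smooth_submanifold_open:
  fixes X :: "'a::euclidean_space set"
  assumes "open X" shows "smooth_submanifold X"
  unfolding smooth_submanifold_def
  by (intro exI[of _ "DIM('a)"] ballI exI[of _ X] exI[of _ "\<lambda>x. x"] exI[of _ UNIV])
    (simp add: assms diffeomorphism_on_ident dim_UNIV)

lemma smooth_submanifold_origin: "smooth_submanifold {0 :: 'a::euclidean_space}"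
  unfolding smooth_submanifold_def
  by (intro exI[of _ 0] ballI exI[of _ UNIV] exI[of _ "\<lambda>x. x"] exI[of _ "{0}"])
    (simp add: diffeomorphism_on_ident)

definition sign_strata :: "real set set" where
  "sign_strata = {{..<0}, {0}, {0<..}}"

lemma empty_notin_sign_strata: "{} \<notin> sign_strata"
  using lessThan_non_empty[of "0::real", symmetric] greaterThan_non_empty[of "0::real", symmetric]
  by (simp add: sign_strata_def)

lemma stratification_sign_strata: "stratification UNIV sign_strata"
  unfolding stratification_def
proof (intro conjI ballI impI)
  show "partition_on UNIV sign_strata"
    unfolding partition_on_def using empty_notin_sign_strata
    by (auto simp: sign_strata_def disjoint_def)
  show "\<exists>V. open V \<and> p \<in> V \<and> finite {X \<in> sign_strata. X \<inter> V \<noteq> {}}" for p :: real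
    by (intro exI[of _ UNIV]) (simp add: sign_strata_def)
  fix X assume X: "X \<in> sign_strata"
  then show "connected X" by (auto simp: sign_strata_def)
  have "X = {0} \<or> open X" using X by (auto simp: sign_strata_def)
  then show "smooth_submanifold X"
    using smooth_submanifold_origin smooth_submanifold_open by blast
  fix Y assume Y: "Y \<in> sign_strata" "X \<inter> closure Y \<noteq> {}"
  then show "X \<subseteq> closure Y"
    using X by (auto simp: sign_strata_def)
qed auto

lemma stratified_homeo_sign:
  assumes "\<kappa> \<in> {-1, 1 :: real}"
  shows "stratified_homeo UNIV sign_strata UNIV sign_strata UNIV (\<lambda>s. \<kappa> * s)"
proof -
  have "(`) (\<lambda>s. \<kappa> * s) ` sign_strata = sign_strata"
  proof (cases "\<kappa> = 1")
    case True
    then show ?thesis by simp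
  next
    case False
    then have "(\<lambda>s. \<kappa> * s) = uminus" using assms by auto
    then show ?thesis by (auto simp: sign_strata_def)
  qed
  moreover note empty_notin_sign_strata
  ultimately have img: "{(\<lambda>s. \<kappa> * s) ` (X \<inter> UNIV) | X. X \<in> sign_strata \<and> X \<inter> UNIV \<noteq> {}} =
      {Y \<inter> UNIV | Y. Y \<in> sign_strata \<and> Y \<inter> UNIV \<noteq> {}}"
    by (auto simp: image_iff)
  have "homeomorphism UNIV UNIV (\<lambda>s. \<kappa> * s) (\<lambda>s. \<kappa> * s)"
  proof (rule homeomorphismI)
    show "\<kappa> * (\<kappa> * s) = s" for s using assms by auto
    show "\<kappa> * (\<kappa> * s) = s" for s using assms by auto
  qed (auto intro!: continuous_intros)
  then show ?thesis unfolding stratified_homeo_def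
    by (intro conjI exI[of _ UNIV] exI[of _ "\<lambda>s. \<kappa> * s"] img) simp_all
qed

lemma sgn_eq_on_stratum:
  assumes "X \<in> sign_strata" "s \<in> X" "s' \<in> X"
  shows "sgn (\<epsilon> * s) = sgn (\<epsilon> * s')"
  using assms by (auto simp: sign_strata_def sgn_mult)

lemma FRS_equivalent_of_standard:
  fixes F G :: "(real \<times> real) \<times> real \<Rightarrow> real"
  assumes def: "deformation f F" "deformation f G" and \<epsilon>: "\<epsilon> \<in> {-1, 1}" "\<epsilon>' \<in> {-1, 1}"
    and F: "r0 > 0" "\<And>r. 0 < r \<and> r < r0 \<Longrightarrow> \<exists>\<delta>>0. standard_configuration F \<epsilon> r \<delta>"
    and G: "r0' > 0" "\<And>r. 0 < r \<and> r < r0' \<Longrightarrow> \<exists>\<delta>>0. standard_configuration G \<epsilon>' r \<delta>"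
  shows "FRS_equivalent f F G"
proof -
  \<comment> \<open>Since the signs square to 1, \<open>\<epsilon>' * k s = \<epsilon> * s\<close>,
    so \<open>k\<close> takes the oval side of \<open>F\<close> to that of \<open>G\<close>. It also
    preserves \<open>\<bar>s\<bar>\<close>, so one \<open>\<delta>\<close> serves both.\<close>
  define k where "k s = \<epsilon> * \<epsilon>' * s" for s
  have nz: "\<epsilon> \<noteq> 0" "\<epsilon>' \<noteq> 0" and k: "\<bar>k s\<bar> = \<bar>s\<bar>" "\<epsilon>' * k s = \<epsilon> * s" for s
    using \<epsilon> by (auto simp: k_def)
  have homeo: "stratified_homeo UNIV sign_strata UNIV sign_strata UNIV k"
    unfolding k_def[abs_def] using \<epsilon> by (intro stratified_homeo_sign) auto
  have main: "\<exists>\<delta>>0. (\<forall>X\<in>sign_strata. \<forall>s\<in>X \<inter> ball 0 \<delta>. \<forall>s'\<in>X \<inter> ball 0 \<delta>.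
              same_configuration r (slice F s) (slice F s')) \<and>
           (\<forall>Y\<in>sign_strata. \<forall>u\<in>Y \<inter> ball 0 \<delta>. \<forall>u'\<in>Y \<inter> ball 0 \<delta>.
              same_configuration r (slice G u) (slice G u')) \<and>
           (\<forall>s\<in>UNIV \<inter> ball 0 \<delta>. same_configuration r (slice F s) (slice G (k s)))"
    if r: "0 < r \<and> r < min r0 r0'" for r
  proof -
    obtain \<delta> where \<delta>: "\<delta> > 0" "standard_configuration F \<epsilon> r \<delta>" using F(2)[of r] r by auto
    obtain \<delta>' where \<delta>': "\<delta>' > 0" "standard_configuration G \<epsilon>' r \<delta>'" using G(2)[of r] r by auto
    have r0: "r > 0" using r by simp
    show ?thesis
    proof (intro exI[of _ "min \<delta> \<delta>'"] conjI ballI)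
      show "0 < min \<delta> \<delta>'" using \<delta> \<delta>' by simp
      show "same_configuration r (slice F s) (slice F s')"
        if "X \<in> sign_strata" "s \<in> X \<inter> ball 0 (min \<delta> \<delta>')" "s' \<in> X \<inter> ball 0 (min \<delta> \<delta>')" for X s s'
        by (rule same_configuration_of_standard[OF \<delta>(2) \<delta>(2) nz(1,1) r0])
          (use that sgn_eq_on_stratum in auto)
      show "same_configuration r (slice G s) (slice G s')"
        if "X \<in> sign_strata" "s \<in> X \<inter> ball 0 (min \<delta> \<delta>')" "s' \<in> X \<inter> ball 0 (min \<delta> \<delta>')" for X s s'
        by (rule same_configuration_of_standard[OF \<delta>'(2) \<delta>'(2) nz(2,2) r0])
          (use that sgn_eq_on_stratum in auto)
      show "same_configuration r (slice F s) (slice G (k s))" if "s \<in> UNIV \<inter> ball 0 (min \<delta> \<delta>')" for s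
        by (rule same_configuration_of_standard[OF \<delta>(2) \<delta>'(2) nz r0]) (use that k in auto)
    qed
  qed
  have pos: "min r0 r0' > 0" using F(1) G(1) by simp
  have "\<exists>r\<^sub>0>0. \<forall>r. 0 < r \<and> r < r\<^sub>0 \<longrightarrow> (\<exists>\<delta>>0.
           (\<forall>X\<in>sign_strata. \<forall>s\<in>X \<inter> ball 0 \<delta>. \<forall>s'\<in>X \<inter> ball 0 \<delta>.
              same_configuration r (slice F s) (slice F s')) \<and>
           (\<forall>Y\<in>sign_strata. \<forall>u\<in>Y \<inter> ball 0 \<delta>. \<forall>u'\<in>Y \<inter> ball 0 \<delta>.
              same_configuration r (slice G u) (slice G u')) \<and>
           (\<forall>s\<in>UNIV \<inter> ball 0 \<delta>. same_configuration r (slice F s) (slice G (k s))))"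
    by (rule exI[of _ "min r0 r0'"], rule conjI[OF pos], intro allI impI, rule main)
  note big = conjI[OF stratification_sign_strata conjI[OF stratification_sign_strata conjI[OF homeo this]]]
  show ?thesis
    unfolding FRS_equivalent_def
    by (rule conjI[OF def(1) conjI[OF def(2)]], rule exI[of _ UNIV], rule exI[of _ sign_strata],
        rule exI[of _ UNIV], rule exI[of _ sign_strata], rule exI[of _ UNIV], rule exI[of _ k], rule big)
qed

lemma oval_inflections: "oval r g \<Longrightarrow> inflections r g = {}"
  unfolding oval_def oval_with_def by (elim exE conjE)

lemma deformation_translation:
  fixes f :: "real \<times> real \<Rightarrow> real"
  assumes "smooth_germ f" "f 0 = 0"
  shows "deformation f (\<lambda>(p, t :: real). f p + t)" "dirderiv (0, 1) (\<lambda>(p, t :: real). f p + t) 0 = 1"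
proof -
  obtain U where U: "open U" "0 \<in> U" "smooth_on U f" using assms(1) unfolding smooth_germ_def by blast
  have op: "open (U \<times> (UNIV :: real set))" using U by (simp add: open_Times)
  have "smooth_on (U \<times> (UNIV :: real set)) (\<lambda>z. f (fst z) + snd z)"
    by (intro smooth_on_add[OF op] smooth_on_compose[OF op _ U(3)] smooth_on_linear
        bounded_linear_fst bounded_linear_snd) auto
  then have sm: "smooth_on (U \<times> (UNIV :: real set)) (\<lambda>(p, t). f p + t)" by (simp add: case_prod_beta')
  have in0: "(0 :: (real \<times> real) \<times> real) \<in> U \<times> UNIV" using U by (simp add: zero_prod_def)
  have "smooth_germ (\<lambda>(p, t :: real). f p + t)"
    unfolding smooth_germ_def by (rule exI[of _ "U \<times> UNIV"], intro conjI op in0 sm)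
  then show "deformation f (\<lambda>(p, t :: real). f p + t)"
    by (simp add: deformation_def assms(2)[unfolded zero_prod_def] zero_prod_def)
  have "((\<lambda>z. f (fst z) + snd z) has_derivative (\<lambda>h. dirderiv (fst h) f 0 + snd h)) (at (0 :: (real \<times> real) \<times> real))"
  proof (intro has_derivative_add has_derivative_snd has_derivative_ident)
    have "fst (0 :: (real \<times> real) \<times> real) \<in> U" using U by simp
    from has_derivative_compose[OF has_derivative_fst[OF has_derivative_ident] smooth_on_has_derivative[OF U(3) this]]
    show "((\<lambda>z. f (fst z)) has_derivative (\<lambda>h. dirderiv (fst h) f 0)) (at (0 :: (real \<times> real) \<times> real))"
      by simp
  qed
  then have "dirderiv (0, 1) (\<lambda>z. f (fst z) + snd z) (0 :: (real \<times> real) \<times> real) = dirderiv 0 f 0 + 1"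
    by (simp add: dirderiv_eq)
  moreover have "dirderiv 0 f 0 = 0"
    by (rule linear_0[OF has_derivative_linear[OF smooth_on_has_derivative[OF U(3,2)]]])
  ultimately show "dirderiv (0, 1) (\<lambda>(p, t :: real). f p + t) 0 = 1" by (simp add: case_prod_beta')
qed

theorem theorem5p1:
  fixes f :: "real \<times> real \<Rightarrow> real"
  assumes "smooth_germ f" and "f 0 = 0"
    and "A1_plus f"
    and "\<not> umbilic_at_origin f"
  shows "generically f (\<lambda>F :: (real \<times> real) \<times> real \<Rightarrow> real.
            Re_versal f F \<longrightarrow> FRS_equivalent f F (\<lambda>(p, t). f p + t)) \<and>
         (\<exists>\<sigma>\<in>{-1, 1 :: real}. \<exists>r\<^sub>0>0. \<forall>r. 0 < r \<and> r < r\<^sub>0 \<longrightarrow> (\<exists>\<delta>>0. \<forall>t :: real.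
            (0 < \<sigma> * t \<and> \<sigma> * t < \<delta> \<longrightarrow>
               card (vertices r (slice (\<lambda>(p, t). f p + t) t)) = 4 \<and>
               inflections r (slice (\<lambda>(p, t). f p + t) t) = {}) \<and>
            (- \<delta> < \<sigma> * t \<and> \<sigma> * t < 0 \<longrightarrow>
               curve r (slice (\<lambda>(p, t). f p + t) t) = {})))"
proof
  let ?G = "\<lambda>(p, t :: real). f p + t"
  have std: "\<exists>\<epsilon>\<in>{-1, 1 :: real}. \<exists>r0>0. \<forall>r. 0 < r \<and> r < r0 \<longrightarrow> (\<exists>\<delta>>0. standard_configuration F \<epsilon> r \<delta>)"
    if "deformation f F" "dirderiv (0, 1) F 0 \<noteq> 0" for F :: "(real \<times> real) \<times> real \<Rightarrow> real"
    unfolding standard_configuration_def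
    by (rule deformation_configuration) (use that assms in \<open>auto simp: deformation_def\<close>)
  note G = deformation_translation[OF assms(1,2)]
  \<comment> \<open>The sign and the radius found for the model serve both conclusions.\<close>
  obtain \<epsilon> r0 where \<epsilon>: "\<epsilon> \<in> {-1, 1 :: real}" and r0: "r0 > 0"
    and Gs: "\<And>r. 0 < r \<and> r < r0 \<Longrightarrow> \<exists>\<delta>>0. standard_configuration ?G \<epsilon> r \<delta>"
    using std[OF G(1)] G(2) by auto
  have frs: "FRS_equivalent f F ?G" if F: "deformation f F" "Re_versal f F" for F
  proof -
    obtain \<epsilon>' r0' where "\<epsilon>' \<in> {-1, 1 :: real}" "r0' > 0"
      "\<And>r. 0 < r \<and> r < r0' \<Longrightarrow> \<exists>\<delta>>0. standard_configuration F \<epsilon>' r \<delta>"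
      using std[OF F(1) Re_versal_parameter_derivative[OF assms(3) F(2)]] by blast
    then show ?thesis by (intro FRS_equivalent_of_standard[OF F(1) G(1) _ \<epsilon> _ _ r0 Gs])
  qed
  show "generically f (\<lambda>F :: (real \<times> real) \<times> real \<Rightarrow> real. Re_versal f F \<longrightarrow> FRS_equivalent f F ?G)"
    unfolding generically_def
    by (intro exI[of _ "topspace (deformation_space f)"]) (use frs in \<open>auto simp: closure_of_topspace\<close>)
  have "\<exists>\<delta>>0. \<forall>t. (0 < \<epsilon> * t \<and> \<epsilon> * t < \<delta> \<longrightarrow>
               card (vertices r (slice ?G t)) = 4 \<and> inflections r (slice ?G t) = {}) \<and>
            (- \<delta> < \<epsilon> * t \<and> \<epsilon> * t < 0 \<longrightarrow> curve r (slice ?G t) = {})"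
    if r: "0 < r \<and> r < r0" for r
  proof -
    obtain \<delta> where \<delta>: "\<delta> > 0" and sc: "standard_configuration ?G \<epsilon> r \<delta>" using Gs[OF r] by blast
    have ab: "\<bar>\<epsilon> * t\<bar> = \<bar>t\<bar>" for t using \<epsilon> by auto
    show ?thesis
    proof (intro exI[of _ \<delta>] conjI[of "_ < _"] \<delta> allI conjI impI)
      fix t assume "0 < \<epsilon> * t \<and> \<epsilon> * t < \<delta>"
      then have "oval r (slice ?G t)"
        using sc ab[of t] unfolding standard_configuration_def by auto
      then show "card (vertices r (slice ?G t)) = 4" "inflections r (slice ?G t) = {}"
        using oval_card_vertices[of r "slice ?G t"] oval_inflections r by simp_all
    next
      fix t assume "- \<delta> < \<epsilon> * t \<and> \<epsilon> * t < 0"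
      then show "curve r (slice ?G t) = {}"
        using sc ab[of t] unfolding standard_configuration_def by auto
    qed
  qed
  then show "\<exists>\<sigma>\<in>{-1, 1 :: real}. \<exists>r\<^sub>0>0. \<forall>r. 0 < r \<and> r < r\<^sub>0 \<longrightarrow> (\<exists>\<delta>>0. \<forall>t :: real.
            (0 < \<sigma> * t \<and> \<sigma> * t < \<delta> \<longrightarrow>
               card (vertices r (slice ?G t)) = 4 \<and> inflections r (slice ?G t) = {}) \<and>
            (- \<delta> < \<sigma> * t \<and> \<sigma> * t < 0 \<longrightarrow> curve r (slice ?G t) = {}))"
    using \<epsilon> r0 by blast
qed

end
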